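(* Let $\psi$ be a QCBF instance and let $n\ge 1$. There exists a tree-like clause judgement proof $P$ (viewed as a tree) of an empty clause with exactly $n$ non-flow judgements if and only if there exists a trace $T$ of $\psi$ whose root has label $(\emptyset,e)$ and which has exactly $n$ nodes. Moreover, both translations (from such a proof to such a trace, and from such a trace to such a proof) are computable in polynomial time.
   Context: A literal is a propositional variable $v$ or its negation $\overline{v}$; $v,\overline{v}$ are complementary. A clause is a disjunction of literals with at most one literal on each variable (also a set of literals); it is empty if it has no literals; $\mathrm{vars}(\alpha)$ is its set of variables. $\gamma$ is a resolvent of $\alpha,\beta$ if there is $L\in\alpha$ with complement $M\in\beta$ and $\gamma=(\alpha\setminus\{L\})\cup(\beta\setminus\{M\})$ is a clause. A clause $\gamma$ is falsified by an assignment $a$ if $a$ is defined on $\mathrm{vars}(\gamma)$ and every literal of $\gamma$ is false under $a$. A QCBF instance is a propositional formula without free variables built from clauses, conjunction and $\forall/\exists$ quantification; $I_\psi$ has one index per subformula occurrence (a clause has no proper subformulas), $\psi(i)$ is the subformula at $i$, parent/child refer to the syntax tree. Clause judgements and proofs: a clause judgement is $(i,\alpha)$ with $\mathrm{vars}(\alpha)\subseteq\mathrm{free}(\psi(i))$; empty if $\alpha$ is empty. A clause judgement proof is a finite sequence of clause judgements each of one of the types: (clause) $(i,\alpha)$ with $\psi(i)$ the clause $\alpha$; (resolve) $(i,\gamma)$ from previous $(i,\alpha),(i,\beta)$ with $\gamma$ a resolvent of $\alpha,\beta$; (upward flow) $(i,\alpha)$ from previous $(j,\alpha)$, $i$ the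 parent of $j$; ($\forall$-removal) $(i,\alpha\setminus\{y,\overline{y}\})$ from previous $(j,\alpha)$ with $\psi(i)=\forall y\,\psi(j)$, $i$ the parent of $j$; (downward flow) $(j,\alpha)$ from previous $(i,\alpha)$, $i$ the parent of $j$. Non-flow judgements are those not derived by (upward flow) or (downward flow). A judgement derived using a previous judgement $J$ is a successor of $J$, and $J$ a predecessor of it. A proof is tree-like if each judgement has at most one successor; then each judgement induces a tree whose root is labelled with it and whose root's children are the trees of its predecessors; a tree-like proof of an empty clause is the tree induced by an empty clause judgement. Located variables: $i\le_\psi j$ means $i$ lies on the path from $j$ to the root; $i<_\psi j$ means $i\le_\psi j$ and $i\ne j$. A located variable is a pair $(i,u)$ with $u$ quantified at location $i$; it is $\forall$-located if $u$ is universally quantified there. An index $j$ follows $(i,u)$ if $i<_\psi j$ and $u\in\mathrm{free}(\psi(k))$ for every $k$ with $i<_\psi k\le_\psi j$; a located variable $(j,v)$ follows $(i,u)$ if $j$ does; an index or located variable follows a set $S$ of located variables if it follows each element of $S$. $S$ is coherent if of any two distinct elements one follows the other. $\mathrm{vars}(S)$ is the set of variables in $S$. $e$ is the unique assignment $\emptyset\to\{0,1\}$. For an assignment $a$, $a\upharpoonright X$ is restriction and $a[u\to b]$ the extension mapping $u$ to $b$. A trace of $\psi$ is a rooted tree in which each node has a label $(S,a)$ with $S$ a coherent set of located variables and $a:\mathrm{vars}(S)\to\{0,1\}$, and each node has $0$, $1$ or $2$ children, such that: if a node labelled $(S,a)$ has $2$ children, their labels are $(S_0\cup\{(i,u)\},(a\upharpoonright\mathrm{vars}(S_0))[u\to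 0])$ and $(S_1\cup\{(i,u)\},(a\upharpoonright\mathrm{vars}(S_1))[u\to 1])$ for some located variable $(i,u)\notin S$ with $S\cup\{(i,u)\}$ coherent and some $S_0,S_1\subseteq S$ with $S_0\cup S_1=S$; if it has $1$ child, its label is $(S\cup\{(i,y)\},a[y\to b])$ for some $\forall$-located variable $(i,y)$ following $S$ and some $b\in\{0,1\}$; if it has $0$ children, there is an index $i$ following $S$ such that $\psi(i)$ is a clause falsified by $a$ with $\mathrm{vars}(\psi(i))=\mathrm{vars}(S)$. *)

theory Defs
  imports "HOL-Library.Sublist"
begin

section \<open>Clauses and QCBF instances\<close>

datatype lit = Pos nat | Neg nat

fun var_of :: "lit \<Rightarrow> nat" where
  "var_of (Pos v) = v"
| "var_of (Neg v) = v"

fun compl :: "lit \<Rightarrow> lit" where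
  "compl (Pos v) = Neg v"
| "compl (Neg v) = Pos v"

definition is_clause :: "lit set \<Rightarrow> bool" where
  "is_clause \<alpha> \<longleftrightarrow> finite \<alpha> \<and> inj_on var_of \<alpha>"

definition cvars :: "lit set \<Rightarrow> nat set" where
  "cvars \<alpha> = var_of ` \<alpha>"

definition resolvent :: "lit set \<Rightarrow> lit set \<Rightarrow> lit set \<Rightarrow> bool" where
  "resolvent \<alpha> \<beta> \<gamma> \<longleftrightarrow>
     (\<exists>L\<in>\<alpha>. compl L \<in> \<beta> \<and> \<gamma> = (\<alpha> - {L}) \<union> (\<beta> - {compl L}) \<and> is_clause \<gamma>)"

type_synonym assignment = "nat \<rightharpoonup> bool"

fun lit_false :: "assignment \<Rightarrow> lit \<Rightarrow> bool" where
  "lit_false a (Pos v) \<longleftrightarrow> a v = Some False"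
| "lit_false a (Neg v) \<longleftrightarrow> a v = Some True"

definition falsified :: "lit set \<Rightarrow> assignment \<Rightarrow> bool" where
  "falsified \<gamma> a \<longleftrightarrow> cvars \<gamma> \<subseteq> dom a \<and> (\<forall>L\<in>\<gamma>. lit_false a L)"

datatype qcbf =
    Clause "lit set"
  | Conj qcbf qcbf
  | All nat qcbf
  | Exi nat qcbf

fun wf_qcbf :: "qcbf \<Rightarrow> bool" where
  "wf_qcbf (Clause \<alpha>) \<longleftrightarrow> is_clause \<alpha>"
| "wf_qcbf (Conj \<phi> \<chi>) \<longleftrightarrow> wf_qcbf \<phi> \<and> wf_qcbf \<chi>"
| "wf_qcbf (All v \<phi>) \<longleftrightarrow> wf_qcbf \<phi>"
| "wf_qcbf (Exi v \<phi>) \<longleftrightarrow> wf_qcbf \<phi>"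

fun free :: "qcbf \<Rightarrow> nat set" where
  "free (Clause \<alpha>) = cvars \<alpha>"
| "free (Conj \<phi> \<chi>) = free \<phi> \<union> free \<chi>"
| "free (All v \<phi>) = free \<phi> - {v}"
| "free (Exi v \<phi>) = free \<phi> - {v}"

definition qcbf_instance :: "qcbf \<Rightarrow> bool" where
  "qcbf_instance \<psi> \<longleftrightarrow> wf_qcbf \<psi> \<and> free \<psi> = {}"

text \<open>Indices are root-to-node paths in the syntax tree, given by child numbers; the
  ancestors of a node are then exactly the prefixes of its path.\<close>

type_synonym index = "nat list"

fun children :: "qcbf \<Rightarrow> qcbf list" where
  "children (Clause \<alpha>) = []"
| "children (Conj \<phi> \<chi>) = [\<phi>, \<chi>]"
| "children (All v \<phi>) = [\<phi>]"
| "children (Exi v \<phi>) = [\<phi>]"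

fun sub_at :: "qcbf \<Rightarrow> index \<Rightarrow> qcbf option" where
  "sub_at \<psi> [] = Some \<psi>"
| "sub_at \<psi> (k # i) =
     (if k < length (children \<psi>) then sub_at (children \<psi> ! k) i else None)"

definition indices :: "qcbf \<Rightarrow> index set" where
  "indices \<psi> = dom (sub_at \<psi>)"

definition free_at :: "qcbf \<Rightarrow> index \<Rightarrow> nat set" where
  "free_at \<psi> i = free (the (sub_at \<psi> i))"

definition is_parent :: "qcbf \<Rightarrow> index \<Rightarrow> index \<Rightarrow> bool" where
  "is_parent \<psi> i j \<longleftrightarrow> j \<in> indices \<psi> \<and> (\<exists>k. j = i @ [k])"

section \<open>Clause judgement proofs\<close>

datatype 'a tree = Node (root: 'a) (subtrees: "'a tree list")

type_synonym judgement = "index \<times> lit set"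

definition is_judgement :: "qcbf \<Rightarrow> judgement \<Rightarrow> bool" where
  "is_judgement \<psi> J \<longleftrightarrow> (case J of (i, \<alpha>) \<Rightarrow>
     i \<in> indices \<psi> \<and> is_clause \<alpha> \<and> cvars \<alpha> \<subseteq> free_at \<psi> i)"

text \<open>Each rule relates a judgement to the list of its predecessors.\<close>

definition clause_rule :: "qcbf \<Rightarrow> judgement \<Rightarrow> judgement list \<Rightarrow> bool" where
  "clause_rule \<psi> J Js \<longleftrightarrow> (\<exists>i \<alpha>. J = (i, \<alpha>) \<and> Js = [] \<and> sub_at \<psi> i = Some (Clause \<alpha>))"

definition resolve_rule :: "qcbf \<Rightarrow> judgement \<Rightarrow> judgement list \<Rightarrow> bool" where
  "resolve_rule \<psi> J Js \<longleftrightarrow>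
     (\<exists>i \<alpha> \<beta> \<gamma>. J = (i, \<gamma>) \<and> Js = [(i, \<alpha>), (i, \<beta>)] \<and> resolvent \<alpha> \<beta> \<gamma>)"

definition upward_flow :: "qcbf \<Rightarrow> judgement \<Rightarrow> judgement list \<Rightarrow> bool" where
  "upward_flow \<psi> J Js \<longleftrightarrow> (\<exists>i j \<alpha>. J = (i, \<alpha>) \<and> Js = [(j, \<alpha>)] \<and> is_parent \<psi> i j)"

definition forall_removal :: "qcbf \<Rightarrow> judgement \<Rightarrow> judgement list \<Rightarrow> bool" where
  "forall_removal \<psi> J Js \<longleftrightarrow>
     (\<exists>i j y \<alpha> \<phi>. J = (i, \<alpha> - {Pos y, Neg y}) \<and> Js = [(j, \<alpha>)] \<and> is_parent \<psi> i j
        \<and> sub_at \<psi> i = Some (All y \<phi>))"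

definition downward_flow :: "qcbf \<Rightarrow> judgement \<Rightarrow> judgement list \<Rightarrow> bool" where
  "downward_flow \<psi> J Js \<longleftrightarrow> (\<exists>i j \<alpha>. J = (j, \<alpha>) \<and> Js = [(i, \<alpha>)] \<and> is_parent \<psi> i j)"

definition derived :: "qcbf \<Rightarrow> judgement \<Rightarrow> judgement list \<Rightarrow> bool" where
  "derived \<psi> J Js \<longleftrightarrow>
     clause_rule \<psi> J Js \<or> resolve_rule \<psi> J Js \<or> upward_flow \<psi> J Js
     \<or> forall_removal \<psi> J Js \<or> downward_flow \<psi> J Js"

text \<open>A proof is a sequence of judgements, each with the list of positions of the
  predecessors it is derived from.\<close>

type_synonym judgement_seq = "(judgement \<times> nat list) list"

definition is_proof :: "qcbf \<Rightarrow> judgement_seq \<Rightarrow> bool" where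
  "is_proof \<psi> \<pi> \<longleftrightarrow> (\<forall>k<length \<pi>. case \<pi> ! k of (J, ps) \<Rightarrow>
     is_judgement \<psi> J \<and> (\<forall>p\<in>set ps. p < k) \<and> derived \<psi> J (map (\<lambda>p. fst (\<pi> ! p)) ps))"

definition tree_like :: "judgement_seq \<Rightarrow> bool" where
  "tree_like \<pi> \<longleftrightarrow>
     (\<forall>p<length \<pi>. card {k. k < length \<pi> \<and> p \<in> set (snd (\<pi> ! k))} \<le> 1)"

inductive induced_tree :: "judgement_seq \<Rightarrow> nat \<Rightarrow> judgement tree \<Rightarrow> bool" for \<pi> where
  "\<lbrakk> k < length \<pi>; \<pi> ! k = (J, ps); list_all2 (induced_tree \<pi>) ps ts \<rbrakk>
     \<Longrightarrow> induced_tree \<pi> k (Node J ts)"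

definition tree_like_empty_clause_proof :: "qcbf \<Rightarrow> judgement tree \<Rightarrow> bool" where
  "tree_like_empty_clause_proof \<psi> P \<longleftrightarrow>
     (\<exists>\<pi> k i ps. is_proof \<psi> \<pi> \<and> tree_like \<pi> \<and> k < length \<pi> \<and> \<pi> ! k = ((i, {}), ps)
        \<and> induced_tree \<pi> k P)"

text \<open>Being derived by a flow rule depends only on the judgement and its predecessors. In
  particular, a judgement \<open>(i, \<alpha>)\<close> obtained from \<open>(j, \<alpha>)\<close> by removing a universal variable
  that does not occur in \<open>\<alpha>\<close> is an instance of upward flow, and does not count as non-flow.
  (If it did, \<open>\<forall>y \<bottom>\<close> would have a proof with two non-flow judgements, but no trace
  with two nodes.)\<close>

fun num_nonflow :: "qcbf \<Rightarrow> judgement tree \<Rightarrow> nat" where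
  "num_nonflow \<psi> (Node J ts) =
     (if upward_flow \<psi> J (map root ts) \<or> downward_flow \<psi> J (map root ts) then 0 else 1)
     + sum_list (map (num_nonflow \<psi>) ts)"

section \<open>Traces\<close>

type_synonym located = "index \<times> nat"

definition forall_located :: "qcbf \<Rightarrow> located \<Rightarrow> bool" where
  "forall_located \<psi> l \<longleftrightarrow> (\<exists>\<phi>. sub_at \<psi> (fst l) = Some (All (snd l) \<phi>))"

definition located_var :: "qcbf \<Rightarrow> located \<Rightarrow> bool" where
  "located_var \<psi> l \<longleftrightarrow>
     forall_located \<psi> l \<or> (\<exists>\<phi>. sub_at \<psi> (fst l) = Some (Exi (snd l) \<phi>))"

definition follows :: "qcbf \<Rightarrow> index \<Rightarrow> located \<Rightarrow> bool" where
  "follows \<psi> j l \<longleftrightarrow> (case l of (i, u) \<Rightarrow>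
     j \<in> indices \<psi> \<and> strict_prefix i j
     \<and> (\<forall>k. strict_prefix i k \<and> prefix k j \<longrightarrow> u \<in> free_at \<psi> k))"

definition follows_set :: "qcbf \<Rightarrow> index \<Rightarrow> located set \<Rightarrow> bool" where
  "follows_set \<psi> j S \<longleftrightarrow> j \<in> indices \<psi> \<and> (\<forall>l\<in>S. follows \<psi> j l)"

definition coherent :: "qcbf \<Rightarrow> located set \<Rightarrow> bool" where
  "coherent \<psi> S \<longleftrightarrow>
     (\<forall>l\<in>S. \<forall>m\<in>S. l \<noteq> m \<longrightarrow> follows \<psi> (fst l) m \<or> follows \<psi> (fst m) l)"

definition lvars :: "located set \<Rightarrow> nat set" where
  "lvars S = snd ` S"

type_synonym label = "located set \<times> assignment"

definition trace_label :: "qcbf \<Rightarrow> label \<Rightarrow> bool" where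
  "trace_label \<psi> L \<longleftrightarrow> (case L of (S, a) \<Rightarrow>
     (\<forall>l\<in>S. located_var \<psi> l) \<and> coherent \<psi> S \<and> dom a = lvars S)"

definition binary_node :: "qcbf \<Rightarrow> label \<Rightarrow> label \<Rightarrow> label \<Rightarrow> bool" where
  "binary_node \<psi> L L0 L1 \<longleftrightarrow> (case L of (S, a) \<Rightarrow>
     \<exists>i u S0 S1. located_var \<psi> (i, u) \<and> (i, u) \<notin> S \<and> coherent \<psi> (S \<union> {(i, u)})
       \<and> S0 \<subseteq> S \<and> S1 \<subseteq> S \<and> S0 \<union> S1 = S
       \<and> L0 = (S0 \<union> {(i, u)}, (a |` lvars S0)(u \<mapsto> False))
       \<and> L1 = (S1 \<union> {(i, u)}, (a |` lvars S1)(u \<mapsto> True)))"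

definition unary_node :: "qcbf \<Rightarrow> label \<Rightarrow> label \<Rightarrow> bool" where
  "unary_node \<psi> L L' \<longleftrightarrow> (case L of (S, a) \<Rightarrow>
     \<exists>i y b. forall_located \<psi> (i, y) \<and> follows_set \<psi> i S
       \<and> L' = (S \<union> {(i, y)}, a(y \<mapsto> b)))"

definition leaf_node :: "qcbf \<Rightarrow> label \<Rightarrow> bool" where
  "leaf_node \<psi> L \<longleftrightarrow> (case L of (S, a) \<Rightarrow>
     \<exists>i \<alpha>. follows_set \<psi> i S \<and> sub_at \<psi> i = Some (Clause \<alpha>) \<and> falsified \<alpha> a
       \<and> cvars \<alpha> = lvars S)"

fun trace_node :: "qcbf \<Rightarrow> label \<Rightarrow> label list \<Rightarrow> bool" where
  "trace_node \<psi> L [] \<longleftrightarrow> leaf_node \<psi> L"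
| "trace_node \<psi> L [L'] \<longleftrightarrow> unary_node \<psi> L L'"
| "trace_node \<psi> L [L0, L1] \<longleftrightarrow> binary_node \<psi> L L0 L1"
| "trace_node \<psi> L _ \<longleftrightarrow> False"

fun is_trace :: "qcbf \<Rightarrow> label tree \<Rightarrow> bool" where
  "is_trace \<psi> (Node L ts) \<longleftrightarrow>
     trace_label \<psi> L \<and> trace_node \<psi> L (map root ts) \<and> (\<forall>t\<in>set ts. is_trace \<psi> t)"

fun num_nodes :: "'a tree \<Rightarrow> nat" where
  "num_nodes (Node L ts) = 1 + sum_list (map num_nodes ts)"

section \<open>Polynomial-time computability\<close>

text \<open>The machine model is a first-order functional language over binary trees (pure Lisp):
  a program is a list of function bodies that may call each other recursively. Every
  evaluation step is charged one unit plus the size of the value it yields. Hence within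
  cost \<open>t\<close> there are at most \<open>t\<close> steps, and only values of size at most \<open>t\<close> occur, even when
  written out without sharing; so a Turing machine simulates such a run in time polynomial in
  \<open>t\<close> and the size of the input. Conversely, a Turing machine configuration is a pair of lists
  and a state, and one machine step has cost linear in its size. So polynomial time in this
  model coincides with polynomial time on Turing machines.\<close>

datatype val = Atom | Cell val val

fun vsize :: "val \<Rightarrow> nat" where
  "vsize Atom = 1"
| "vsize (Cell v w) = 1 + vsize v + vsize w"

fun vfst :: "val \<Rightarrow> val" where
  "vfst Atom = Atom"
| "vfst (Cell v w) = v"

fun vsnd :: "val \<Rightarrow> val" where
  "vsnd Atom = Atom"
| "vsnd (Cell v w) = w"

definition vbool :: "bool \<Rightarrow> val" where
  "vbool b = (if b then Cell Atom Atom else Atom)"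

datatype expr =
    Arg nat
  | EAtom
  | ECell expr expr
  | EFst expr
  | ESnd expr
  | EEq expr expr
  | EIf expr expr expr
  | Call nat "expr list"

type_synonym prog = "expr list"

text \<open>\<open>run \<Pi> \<rho> e v t\<close>: under the argument list \<open>\<rho>\<close>, expression \<open>e\<close> evaluates to \<open>v\<close> at cost \<open>t\<close>.\<close>

inductive run :: "prog \<Rightarrow> val list \<Rightarrow> expr \<Rightarrow> val \<Rightarrow> nat \<Rightarrow> bool"
  and runs :: "prog \<Rightarrow> val list \<Rightarrow> expr list \<Rightarrow> val list \<Rightarrow> nat \<Rightarrow> bool"
  for \<Pi> where
  run_Arg: "n < length \<rho> \<Longrightarrow> run \<Pi> \<rho> (Arg n) (\<rho> ! n) (1 + vsize (\<rho> ! n))"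
| run_Atom: "run \<Pi> \<rho> EAtom Atom (1 + vsize Atom)"
| run_Cell: "\<lbrakk> run \<Pi> \<rho> e1 v1 t1; run \<Pi> \<rho> e2 v2 t2 \<rbrakk>
    \<Longrightarrow> run \<Pi> \<rho> (ECell e1 e2) (Cell v1 v2) (t1 + t2 + 1 + vsize (Cell v1 v2))"
| run_Fst: "run \<Pi> \<rho> e v t \<Longrightarrow> run \<Pi> \<rho> (EFst e) (vfst v) (t + 1 + vsize (vfst v))"
| run_Snd: "run \<Pi> \<rho> e v t \<Longrightarrow> run \<Pi> \<rho> (ESnd e) (vsnd v) (t + 1 + vsize (vsnd v))"
| run_Eq: "\<lbrakk> run \<Pi> \<rho> e1 v1 t1; run \<Pi> \<rho> e2 v2 t2 \<rbrakk>
    \<Longrightarrow> run \<Pi> \<rho> (EEq e1 e2) (vbool (v1 = v2)) (t1 + t2 + 1 + vsize (vbool (v1 = v2)))"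
| run_If_true: "\<lbrakk> run \<Pi> \<rho> e0 v0 t0; v0 \<noteq> Atom; run \<Pi> \<rho> e1 v t \<rbrakk>
    \<Longrightarrow> run \<Pi> \<rho> (EIf e0 e1 e2) v (t0 + t + 1 + vsize v)"
| run_If_false: "\<lbrakk> run \<Pi> \<rho> e0 Atom t0; run \<Pi> \<rho> e2 v t \<rbrakk>
    \<Longrightarrow> run \<Pi> \<rho> (EIf e0 e1 e2) v (t0 + t + 1 + vsize v)"
| run_Call: "\<lbrakk> f < length \<Pi>; runs \<Pi> \<rho> es vs t0; run \<Pi> vs (\<Pi> ! f) v t \<rbrakk>
    \<Longrightarrow> run \<Pi> \<rho> (Call f es) v (t0 + t + 1 + vsize v)"
| runs_Nil: "runs \<Pi> \<rho> [] [] 0"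
| runs_Cons: "\<lbrakk> run \<Pi> \<rho> e v t0; runs \<Pi> \<rho> es vs t \<rbrakk>
    \<Longrightarrow> runs \<Pi> \<rho> (e # es) (v # vs) (t0 + t)"

inductive_cases run_ArgE: "run \<Pi> \<rho> (Arg n) v t"
inductive_cases run_AtomE: "run \<Pi> \<rho> EAtom v t"
inductive_cases run_CellE: "run \<Pi> \<rho> (ECell e1 e2) v t"
inductive_cases run_FstE: "run \<Pi> \<rho> (EFst e) v t"
inductive_cases run_SndE: "run \<Pi> \<rho> (ESnd e) v t"
inductive_cases run_EqE: "run \<Pi> \<rho> (EEq e1 e2) v t"
inductive_cases run_IfE: "run \<Pi> \<rho> (EIf e0 e1 e2) v t"
inductive_cases run_CallE: "run \<Pi> \<rho> (Call f es) v t"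
inductive_cases runs_NilE: "runs \<Pi> \<rho> [] vs t"
inductive_cases runs_ConsE: "runs \<Pi> \<rho> (e # es) vs t"

lemma run_deterministic:
  "run \<Pi> \<rho> e v t \<Longrightarrow> run \<Pi> \<rho> e v' t' \<Longrightarrow> v' = v \<and> t' = t"
  "runs \<Pi> \<rho> es vs t \<Longrightarrow> runs \<Pi> \<rho> es vs' t' \<Longrightarrow> vs' = vs \<and> t' = t"
proof (induction arbitrary: v' t' and vs' t' rule: run_runs.inducts)
  case run_Arg then show ?case by (auto elim: run_ArgE)
next
  case run_Atom then show ?case by (auto elim: run_AtomE)
next
  case run_Cell show ?case
    by (rule run_CellE[OF run_Cell.prems]) (auto dest!: run_Cell.IH(2) run_Cell.IH(4))
next
  case run_Fst show ?case by (rule run_FstE[OF run_Fst.prems]) (auto dest!: run_Fst.IH(2))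
next
  case run_Snd show ?case by (rule run_SndE[OF run_Snd.prems]) (auto dest!: run_Snd.IH(2))
next
  case run_Eq show ?case
    by (rule run_EqE[OF run_Eq.prems]) (auto dest!: run_Eq.IH(2) run_Eq.IH(4))
next
  case run_If_true show ?case
    by (rule run_IfE[OF run_If_true.prems])
      (use run_If_true.hyps in \<open>auto dest!: run_If_true.IH(2) run_If_true.IH(4)\<close>)
next
  case run_If_false show ?case
    by (rule run_IfE[OF run_If_false.prems]) (auto dest!: run_If_false.IH(2) run_If_false.IH(4))
next
  case run_Call show ?case
    by (rule run_CallE[OF run_Call.prems]) (auto dest!: run_Call.IH(3) run_Call.IH(5))
next
  case runs_Nil then show ?case by (auto elim: runs_NilE)
next
  case runs_Cons show ?case
    by (rule runs_ConsE[OF runs_Cons.prems]) (auto dest!: runs_Cons.IH(2) runs_Cons.IH(4))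
qed

definition poly_time_on :: "val set \<Rightarrow> (val \<Rightarrow> val) \<Rightarrow> bool" where
  "poly_time_on D f \<longleftrightarrow> (\<exists>\<Pi> f0 c d. \<forall>x\<in>D. \<exists>t. run \<Pi> [x] (Call f0 [Arg 0]) (f x) t
     \<and> t \<le> c * vsize x ^ d)"

section \<open>Encodings as binary trees\<close>

text \<open>Numbers are in binary, least significant digit first. A finite set is encoded by any
  repetition-free list of its elements, so encodings are relations.\<close>

fun enc_nat :: "nat \<Rightarrow> val" where
  "enc_nat n = (if n = 0 then Atom else Cell (vbool (odd n)) (enc_nat (n div 2)))"

declare enc_nat.simps [simp del]

definition enc_list :: "val list \<Rightarrow> val" where
  "enc_list vs = foldr Cell vs Atom"

type_synonym 'a enc = "'a \<Rightarrow> val \<Rightarrow> bool"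

definition encodes_nat :: "nat enc" where
  "encodes_nat n v \<longleftrightarrow> v = enc_nat n"

definition encodes_bool :: "bool enc" where
  "encodes_bool b v \<longleftrightarrow> v = vbool b"

definition encodes_prod :: "'a enc \<Rightarrow> 'b enc \<Rightarrow> ('a \<times> 'b) enc" where
  "encodes_prod E F p v \<longleftrightarrow> (\<exists>v1 v2. v = Cell v1 v2 \<and> E (fst p) v1 \<and> F (snd p) v2)"

definition encodes_list :: "'a enc \<Rightarrow> 'a list enc" where
  "encodes_list E xs v \<longleftrightarrow> (\<exists>vs. list_all2 E xs vs \<and> v = enc_list vs)"

definition encodes_set :: "'a enc \<Rightarrow> 'a set enc" where
  "encodes_set E A v \<longleftrightarrow> (\<exists>xs. distinct xs \<and> set xs = A \<and> encodes_list E xs v)"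

inductive encodes_tree :: "'a enc \<Rightarrow> 'a tree enc" for E where
  "\<lbrakk> E x v; list_all2 (encodes_tree E) ts vs \<rbrakk>
     \<Longrightarrow> encodes_tree E (Node x ts) (Cell v (enc_list vs))"

fun encodes_lit :: "lit enc" where
  "encodes_lit (Pos u) v \<longleftrightarrow> v = Cell (vbool True) (enc_nat u)"
| "encodes_lit (Neg u) v \<longleftrightarrow> v = Cell (vbool False) (enc_nat u)"

definition encodes_clause :: "lit set enc" where
  "encodes_clause = encodes_set encodes_lit"

fun encodes_qcbf :: "qcbf enc" where
  "encodes_qcbf (Clause \<alpha>) v \<longleftrightarrow> (\<exists>w. v = Cell (enc_nat 0) w \<and> encodes_clause \<alpha> w)"
| "encodes_qcbf (Conj \<phi> \<chi>) v \<longleftrightarrow>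
     (\<exists>w1 w2. v = Cell (enc_nat 1) (Cell w1 w2) \<and> encodes_qcbf \<phi> w1 \<and> encodes_qcbf \<chi> w2)"
| "encodes_qcbf (All u \<phi>) v \<longleftrightarrow>
     (\<exists>w. v = Cell (enc_nat 2) (Cell (enc_nat u) w) \<and> encodes_qcbf \<phi> w)"
| "encodes_qcbf (Exi u \<phi>) v \<longleftrightarrow>
     (\<exists>w. v = Cell (enc_nat 3) (Cell (enc_nat u) w) \<and> encodes_qcbf \<phi> w)"

definition encodes_index :: "index enc" where
  "encodes_index = encodes_list encodes_nat"

definition encodes_proof_tree :: "judgement tree enc" where
  "encodes_proof_tree = encodes_tree (encodes_prod encodes_index encodes_clause)"

definition encodes_assignment :: "assignment enc" where
  "encodes_assignment a = encodes_set (encodes_prod encodes_nat encodes_bool) (Map.graph a)"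

definition encodes_label :: "label enc" where
  "encodes_label =
     encodes_prod (encodes_set (encodes_prod encodes_index encodes_nat)) encodes_assignment"

definition encodes_trace :: "label tree enc" where
  "encodes_trace = encodes_tree encodes_label"

text \<open>A polynomial-time translation sends every encoding of an instance \<open>\<psi>\<close> together with an
  object \<open>x\<close> such that \<open>A \<psi> x\<close> to an encoding of an object \<open>y\<close> such that \<open>B \<psi> x y\<close>; the same
  program works for all \<open>\<psi>\<close>.\<close>

definition poly_time_translation ::
    "'a enc \<Rightarrow> 'b enc \<Rightarrow> (qcbf \<Rightarrow> 'a \<Rightarrow> bool) \<Rightarrow> (qcbf \<Rightarrow> 'a \<Rightarrow> 'b \<Rightarrow> bool) \<Rightarrow> bool" where
  "poly_time_translation E F A B \<longleftrightarrow>
     (\<exists>f. poly_time_on {v. \<exists>\<psi> x. qcbf_instance \<psi> \<and> A \<psi> x \<and> encodes_prod encodes_qcbf E (\<psi>, x) v} f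
        \<and> (\<forall>\<psi> x v. qcbf_instance \<psi> \<and> A \<psi> x \<and> encodes_prod encodes_qcbf E (\<psi>, x) v
             \<longrightarrow> (\<exists>y. B \<psi> x y \<and> F y (f v))))"

end

theory Submission
  imports Defs
begin

text \<open>A judgement \<open>(i, \<alpha>)\<close> corresponds to the label consisting of the binders, as seen from \<open>i\<close>,
  of the variables of \<open>\<alpha>\<close>, and of the assignment falsifying \<open>\<alpha>\<close>. Flow steps do not change this
  label, and the clause, resolve and \<open>\<forall>\<close>-removal steps become the leaves, binary nodes and unary
  nodes of a trace. Conversely, a trace node labelled \<open>(S, a)\<close> becomes a proof of the clause
  falsified by \<open>a\<close>, located at the child of the innermost quantifier of \<open>S\<close>; the proofs of its
  children are carried there by flow steps along the branch of the syntax tree on which the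
  coherent set \<open>S\<close> lies.

  For the time bounds, functions on codes are built from operations under which polynomial time
  is closed. The only recursion needed is structural recursion on binary trees, which stays in
  polynomial time as long as its values have polynomial size.\<close>

section \<open>Polynomially bounded functions\<close>

abbreviation uncurry2 :: "(val \<Rightarrow> val \<Rightarrow> 'a) \<Rightarrow> val \<Rightarrow> 'a" where
  "uncurry2 f \<equiv> \<lambda>z. f (vfst z) (vsnd z)"

abbreviation uncurry3 :: "(val \<Rightarrow> val \<Rightarrow> val \<Rightarrow> 'a) \<Rightarrow> val \<Rightarrow> 'a" where
  "uncurry3 f \<equiv> uncurry2 (\<lambda>x. uncurry2 (f x))"

abbreviation uncurry4 :: "(val \<Rightarrow> val \<Rightarrow> val \<Rightarrow> val \<Rightarrow> 'a) \<Rightarrow> val \<Rightarrow> 'a" where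
  "uncurry4 f \<equiv> uncurry2 (\<lambda>x. uncurry3 (f x))"

abbreviation uncurry5 :: "(val \<Rightarrow> val \<Rightarrow> val \<Rightarrow> val \<Rightarrow> val \<Rightarrow> 'a) \<Rightarrow> val \<Rightarrow> 'a" where
  "uncurry5 f \<equiv> uncurry2 (\<lambda>x. uncurry4 (f x))"

definition poly_bounded :: "(val \<Rightarrow> nat) \<Rightarrow> bool" where
  "poly_bounded t \<longleftrightarrow> (\<exists>c d. \<forall>x. t x \<le> c * vsize x ^ d)"

named_theorems poly_bounded_intros

lemma poly_boundedI: "(\<And>x. t x \<le> c * vsize x ^ d) \<Longrightarrow> poly_bounded t"
  unfolding poly_bounded_def by blast

lemma poly_boundedE:
  assumes "poly_bounded t"
  obtains c d where "\<And>x. t x \<le> c * vsize x ^ d"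
  using assms unfolding poly_bounded_def by blast

lemma poly_bounded_mono: "poly_bounded t \<Longrightarrow> (\<And>x. s x \<le> t x) \<Longrightarrow> poly_bounded s"
  unfolding poly_bounded_def by (meson le_trans)

lemma vsize_pos: "1 \<le> vsize v"
  by (cases v) auto

lemma vsize_vfst_le: "vsize (vfst v) \<le> vsize v"
  by (cases v) auto

lemma vsize_vsnd_le: "vsize (vsnd v) \<le> vsize v"
  by (cases v) auto

lemma poly_bounded_const [poly_bounded_intros]: "poly_bounded (\<lambda>x. c)"
  by (rule poly_boundedI[of _ c 0]) simp

lemma poly_bounded_vsize [poly_bounded_intros]: "poly_bounded vsize"
  by (rule poly_boundedI[of _ 1 1]) simp

lemma poly_bounded_add [poly_bounded_intros]:
  assumes "poly_bounded s" "poly_bounded t"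
  shows "poly_bounded (\<lambda>x. s x + t x)"
proof -
  obtain c d where s: "\<And>x. s x \<le> c * vsize x ^ d" using assms(1) by (rule poly_boundedE) blast
  obtain c' d' where t: "\<And>x. t x \<le> c' * vsize x ^ d'" using assms(2) by (rule poly_boundedE) blast
  show ?thesis
  proof (rule poly_boundedI)
    fix x
    have "vsize x ^ d \<le> vsize x ^ (d + d')" "vsize x ^ d' \<le> vsize x ^ (d + d')"
      by (intro power_increasing le_add1 le_add2 vsize_pos)+
    then have "s x \<le> c * vsize x ^ (d + d')" "t x \<le> c' * vsize x ^ (d + d')"
      using s[of x] t[of x] by (auto elim!: order.trans intro: mult_le_mono2)
    then show "s x + t x \<le> (c + c') * vsize x ^ (d + d')" by (simp add: distrib_right)
  qed
qed

lemma poly_bounded_mult [poly_bounded_intros]: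
  assumes "poly_bounded s" "poly_bounded t"
  shows "poly_bounded (\<lambda>x. s x * t x)"
proof -
  obtain c d where s: "\<And>x. s x \<le> c * vsize x ^ d" using assms(1) by (rule poly_boundedE) blast
  obtain c' d' where t: "\<And>x. t x \<le> c' * vsize x ^ d'" using assms(2) by (rule poly_boundedE) blast
  show ?thesis
  proof (rule poly_boundedI)
    fix x
    have "s x * t x \<le> (c * vsize x ^ d) * (c' * vsize x ^ d')" using s t by (rule mult_le_mono)
    then show "s x * t x \<le> (c * c') * vsize x ^ (d + d')" by (simp add: power_add mult_ac)
  qed
qed

lemma poly_bounded_power [poly_bounded_intros]:
  "poly_bounded t \<Longrightarrow> poly_bounded (\<lambda>x. t x ^ d)"
  by (induction d) (simp_all add: poly_bounded_const poly_bounded_mult)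

lemma poly_bounded_comp:
  assumes "poly_bounded t" "poly_bounded (\<lambda>x. vsize (g x))"
  shows "poly_bounded (\<lambda>x. t (g x))"
proof -
  obtain c d where t: "\<And>x. t x \<le> c * vsize x ^ d" using assms(1) by (rule poly_boundedE) blast
  obtain c' d' where g: "\<And>x. vsize (g x) \<le> c' * vsize x ^ d'"
    using assms(2) by (rule poly_boundedE) blast
  show ?thesis
  proof (rule poly_boundedI)
    fix x
    have "t (g x) \<le> c * vsize (g x) ^ d" by (rule t)
    also have "\<dots> \<le> c * (c' * vsize x ^ d') ^ d" using g by (intro mult_le_mono2 power_mono) auto
    finally show "t (g x) \<le> (c * c' ^ d) * vsize x ^ (d' * d)"
      by (simp add: power_mult_distrib power_mult mult.assoc)
  qed
qed

lemma poly_bounded_vsize_Cell [poly_bounded_intros]: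
  "poly_bounded (\<lambda>x. vsize (f x)) \<Longrightarrow> poly_bounded (\<lambda>x. vsize (g x))
    \<Longrightarrow> poly_bounded (\<lambda>x. vsize (Cell (f x) (g x)))"
  unfolding vsize.simps by (intro poly_bounded_intros)

lemma poly_bounded_comp2:
  "poly_bounded (uncurry2 t) \<Longrightarrow> poly_bounded (\<lambda>x. vsize (f x))
    \<Longrightarrow> poly_bounded (\<lambda>x. vsize (g x)) \<Longrightarrow> poly_bounded (\<lambda>x. t (f x) (g x))"
  using poly_bounded_comp[of "uncurry2 t" "\<lambda>x. Cell (f x) (g x)"]
    poly_bounded_vsize_Cell by simp

lemma poly_bounded_vsize_vfst [poly_bounded_intros]:
  "poly_bounded (\<lambda>x. vsize (f x)) \<Longrightarrow> poly_bounded (\<lambda>x. vsize (vfst (f x)))"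
  by (erule poly_bounded_mono) (rule vsize_vfst_le)

lemma poly_bounded_vsize_vsnd [poly_bounded_intros]:
  "poly_bounded (\<lambda>x. vsize (f x)) \<Longrightarrow> poly_bounded (\<lambda>x. vsize (vsnd (f x)))"
  by (erule poly_bounded_mono) (rule vsize_vsnd_le)

lemma poly_bounded_rec:
  assumes a: "poly_bounded a" "\<And>e. r e Atom \<le> a e"
    and g: "poly_bounded g" "\<And>e v w. r e (Cell v w) \<le> r e v + r e w + g (Cell e (Cell v w))"
  shows "poly_bounded (uncurry2 r)"
proof -
  define s where "s z = a (vfst z) + g z" for z
  have "poly_bounded s"
    unfolding s_def by (intro poly_bounded_intros poly_bounded_comp[OF a(1)] g(1))
  then obtain c d where s: "\<And>z. s z \<le> c * vsize z ^ d" by (rule poly_boundedE) blast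
  have r: "r e x \<le> vsize x * (c * N ^ d)" if "vsize (Cell e x) \<le> N" for e x N
    using that
  proof (induction x)
    case Atom
    have "r e Atom \<le> s (Cell e Atom)" using a(2)[of e] by (simp add: s_def)
    also have "\<dots> \<le> c * vsize (Cell e Atom) ^ d" by (rule s)
    also have "\<dots> \<le> c * N ^ d" using Atom by (intro mult_le_mono2 power_mono) auto
    finally show ?case by simp
  next
    case (Cell v w)
    have "g (Cell e (Cell v w)) \<le> s (Cell e (Cell v w))" by (simp add: s_def)
    also have "\<dots> \<le> c * vsize (Cell e (Cell v w)) ^ d" by (rule s)
    also have "\<dots> \<le> c * N ^ d" using Cell.prems by (intro mult_le_mono2 power_mono) auto
    finally have "r e (Cell v w) \<le> vsize v * (c * N ^ d) + vsize w * (c * N ^ d) + c * N ^ d"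
      using g(2)[of e v w] Cell.IH Cell.prems by simp
    then show ?case by (simp add: distrib_right)
  qed
  show ?thesis
  proof (rule poly_bounded_mono)
    show "poly_bounded (\<lambda>z. vsize (vsnd z) * (c * (vsize z + 2) ^ d))"
      by (intro poly_bounded_intros)
    show "r (vfst z) (vsnd z) \<le> vsize (vsnd z) * (c * (vsize z + 2) ^ d)" for z
      by (rule r) (cases z; simp)
  qed
qed

section \<open>Polynomial-time functions\<close>

definition computes :: "prog \<Rightarrow> expr \<Rightarrow> (val \<Rightarrow> val) \<Rightarrow> bool" where
  "computes \<Pi> e f \<longleftrightarrow> (\<exists>t. poly_bounded t \<and> (\<forall>x. run \<Pi> [x] e (f x) (t x)))"

lemma computesI: "poly_bounded t \<Longrightarrow> (\<And>x. run \<Pi> [x] e (f x) (t x)) \<Longrightarrow> computes \<Pi> e f"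
  unfolding computes_def by blast

lemma computesE:
  assumes "computes \<Pi> e f"
  obtains t where "poly_bounded t" "\<And>x. run \<Pi> [x] e (f x) (t x)"
  using assms unfolding computes_def by blast

lemma vsize_le_cost: "run \<Pi> \<rho> e v t \<Longrightarrow> vsize v \<le> t"
  by (cases rule: run.cases) auto

lemma computes_vsize: "computes \<Pi> e f \<Longrightarrow> poly_bounded (\<lambda>x. vsize (f x))"
  by (meson computesE poly_bounded_mono vsize_le_cost)

lemma computes_Arg: "computes \<Pi> (Arg 0) (\<lambda>x. x)"
proof (rule computesI)
  show "poly_bounded (\<lambda>x. 1 + vsize x)" by (intro poly_bounded_intros)
  show "run \<Pi> [x] (Arg 0) x (1 + vsize x)" for x using run_Arg[of 0 "[x]"] by simp
qed

lemma computes_Atom: "computes \<Pi> EAtom (\<lambda>x. Atom)"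
  by (rule computesI[OF poly_bounded_const run_Atom])

lemma computes_Cell:
  assumes f: "computes \<Pi> e f" and g: "computes \<Pi> e' g"
  shows "computes \<Pi> (ECell e e') (\<lambda>x. Cell (f x) (g x))"
proof -
  note sizes = f[THEN computes_vsize] g[THEN computes_vsize]
  obtain t where t: "poly_bounded t" "\<And>x. run \<Pi> [x] e (f x) (t x)" using f by (rule computesE) blast
  obtain t' where t': "poly_bounded t'" "\<And>x. run \<Pi> [x] e' (g x) (t' x)"
    using g by (rule computesE) blast
  show ?thesis
    by (rule computesI[OF _ run_Cell[OF t(2) t'(2)]]) (intro poly_bounded_intros t(1) t'(1) sizes)
qed

lemma computes_Fst:
  assumes f: "computes \<Pi> e f"
  shows "computes \<Pi> (EFst e) (\<lambda>x. vfst (f x))"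
proof -
  obtain t where t: "poly_bounded t" "\<And>x. run \<Pi> [x] e (f x) (t x)" using f by (rule computesE) blast
  show ?thesis
    by (rule computesI[OF _ run_Fst[OF t(2)]])
      (intro poly_bounded_intros t(1) f[THEN computes_vsize])
qed

lemma computes_Snd:
  assumes f: "computes \<Pi> e f"
  shows "computes \<Pi> (ESnd e) (\<lambda>x. vsnd (f x))"
proof -
  obtain t where t: "poly_bounded t" "\<And>x. run \<Pi> [x] e (f x) (t x)" using f by (rule computesE) blast
  show ?thesis
    by (rule computesI[OF _ run_Snd[OF t(2)]])
      (intro poly_bounded_intros t(1) f[THEN computes_vsize])
qed

lemma computes_Eq:
  assumes "computes \<Pi> e f" "computes \<Pi> e' g"
  shows "computes \<Pi> (EEq e e') (\<lambda>x. vbool (f x = g x))"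
proof -
  obtain t where t: "poly_bounded t" "\<And>x. run \<Pi> [x] e (f x) (t x)"
    using assms(1) by (rule computesE) blast
  obtain t' where t': "poly_bounded t'" "\<And>x. run \<Pi> [x] e' (g x) (t' x)"
    using assms(2) by (rule computesE) blast
  have "poly_bounded (\<lambda>x. vsize (vbool (f x = g x)))"
    by (rule poly_bounded_mono[OF poly_bounded_const[of 3]]) (simp add: vbool_def)
  then show ?thesis
    by (intro computesI[OF _ run_Eq[OF t(2) t'(2)]] poly_bounded_intros t(1) t'(1))
qed

lemma computes_If:
  assumes "computes \<Pi> e f" and g: "computes \<Pi> e' g" and h: "computes \<Pi> e'' h"
  shows "computes \<Pi> (EIf e e' e'') (\<lambda>x. if f x \<noteq> Atom then g x else h x)" (is "computes \<Pi> ?e ?k")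
proof -
  obtain t where t: "poly_bounded t" "\<And>x. run \<Pi> [x] e (f x) (t x)"
    using assms(1) by (rule computesE) blast
  obtain t' where t': "poly_bounded t'" "\<And>x. run \<Pi> [x] e' (g x) (t' x)"
    using g by (rule computesE) blast
  obtain t'' where t'': "poly_bounded t''" "\<And>x. run \<Pi> [x] e'' (h x) (t'' x)"
    using h by (rule computesE) blast
  let ?s = "\<lambda>x. t x + (if f x \<noteq> Atom then t' x else t'' x) + 1 + vsize (?k x)"
  show ?thesis
  proof (rule computesI)
    show "poly_bounded ?s"
    proof (rule poly_bounded_mono)
      show "poly_bounded (\<lambda>x. t x + (t' x + t'' x) + 1 + (vsize (g x) + vsize (h x)))"
        by (intro poly_bounded_intros t(1) t'(1) t''(1) g[THEN computes_vsize]
            h[THEN computes_vsize])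
    qed auto
    show "run \<Pi> [x] ?e (?k x) (?s x)" for x
    proof (cases "f x = Atom")
      case True
      then show ?thesis using run_If_false[OF t(2)[of x, unfolded True] t''(2)] by simp
    next
      case False
      then show ?thesis using run_If_true[OF t(2) False t'(2)] by simp
    qed
  qed
qed

lemma run_Call_unary:
  "\<lbrakk> f < length \<Pi>; run \<Pi> \<rho> e v t; run \<Pi> [v] (\<Pi> ! f) w t' \<rbrakk>
    \<Longrightarrow> run \<Pi> \<rho> (Call f [e]) w (t + t' + 1 + vsize w)"
  using run_Call[of f \<Pi> \<rho> "[e]" "[v]" "t + 0"] runs_Cons[OF _ runs_Nil] by auto

lemma computes_Call:
  assumes "n < length \<Pi>" "computes \<Pi> (\<Pi> ! n) f" "computes \<Pi> e g"
  shows "computes \<Pi> (Call n [e]) (\<lambda>x. f (g x))"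
proof -
  note size_g = assms(3)[THEN computes_vsize]
  note size_fg = poly_bounded_comp[OF assms(2)[THEN computes_vsize] size_g]
  obtain t where t: "poly_bounded t" "\<And>x. run \<Pi> [x] (\<Pi> ! n) (f x) (t x)"
    using assms(2) by (rule computesE) blast
  obtain t' where t': "poly_bounded t'" "\<And>x. run \<Pi> [x] e (g x) (t' x)"
    using assms(3) by (rule computesE) blast
  show ?thesis
    by (rule computesI[OF _ run_Call_unary[OF assms(1) t'(2) t(2)]])
      (intro poly_bounded_intros t'(1) poly_bounded_comp[OF t(1)] size_g size_fg)
qed

primrec shift_calls :: "nat \<Rightarrow> expr \<Rightarrow> expr" where
  "shift_calls m (Arg n) = Arg n"
| "shift_calls m EAtom = EAtom"
| "shift_calls m (ECell e1 e2) = ECell (shift_calls m e1) (shift_calls m e2)"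
| "shift_calls m (EFst e) = EFst (shift_calls m e)"
| "shift_calls m (ESnd e) = ESnd (shift_calls m e)"
| "shift_calls m (EEq e1 e2) = EEq (shift_calls m e1) (shift_calls m e2)"
| "shift_calls m (EIf e0 e1 e2) = EIf (shift_calls m e0) (shift_calls m e1) (shift_calls m e2)"
| "shift_calls m (Call f es) = Call (m + f) (map (shift_calls m) es)"

lemma run_append:
  "run \<Pi> \<rho> e v t \<Longrightarrow> run (\<Pi> @ \<Pi>') \<rho> e v t"
  "runs \<Pi> \<rho> es vs t \<Longrightarrow> runs (\<Pi> @ \<Pi>') \<rho> es vs t"
proof (induction rule: run_runs.inducts)
  case (run_Call f \<rho> es vs t0 v t)
  then show ?case by (intro run_runs.run_Call) (simp_all add: nth_append)
qed (blast intro: run_runs.intros)+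

lemma run_shift_calls:
  fixes \<Pi> \<Pi>' :: prog
  defines "m \<equiv> length \<Pi>'"
  shows "run \<Pi> \<rho> e v t \<Longrightarrow> run (\<Pi>' @ map (shift_calls m) \<Pi>) \<rho> (shift_calls m e) v t"
    and "runs \<Pi> \<rho> es vs t
      \<Longrightarrow> runs (\<Pi>' @ map (shift_calls m) \<Pi>) \<rho> (map (shift_calls m) es) vs t"
proof (induction rule: run_runs.inducts)
  case (run_Call f \<rho> es vs t0 v t)
  then show ?case
    unfolding shift_calls.simps by (intro run_runs.run_Call) (simp_all add: nth_append m_def)
qed (simp_all only: shift_calls.simps list.map, (blast intro: run_runs.intros)+)

lemma computes_append: "computes \<Pi> e f \<Longrightarrow> computes (\<Pi> @ \<Pi>') e f"
  unfolding computes_def using run_append(1) by blast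

lemma computes_shift_calls:
  "computes \<Pi> e f
    \<Longrightarrow> computes (\<Pi>' @ map (shift_calls (length \<Pi>')) \<Pi>) (shift_calls (length \<Pi>') e) f"
  unfolding computes_def using run_shift_calls(1) by blast

definition ptime :: "(val \<Rightarrow> val) \<Rightarrow> bool" where
  "ptime f \<longleftrightarrow> (\<exists>\<Pi> e. computes \<Pi> e f)"

definition ptest :: "(val \<Rightarrow> bool) \<Rightarrow> bool" where
  "ptest P \<longleftrightarrow> ptime (\<lambda>x. vbool (P x))"

named_theorems ptime_intros

lemma ptimeI: "computes \<Pi> e f \<Longrightarrow> ptime f"
  unfolding ptime_def by blast

lemma ptime_vsize: "ptime f \<Longrightarrow> poly_bounded (\<lambda>x. vsize (f x))"
  unfolding ptime_def using computes_vsize by blast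

lemma ptime_common_prog:
  "\<forall>f\<in>set fs. ptime f \<Longrightarrow> \<exists>\<Pi>. \<forall>f\<in>set fs. \<exists>e. computes \<Pi> e f"
proof (induction fs)
  case (Cons f fs)
  obtain \<Pi> where \<Pi>: "\<forall>f\<in>set fs. \<exists>e. computes \<Pi> e f" using Cons by auto
  obtain \<Pi>' e where e: "computes \<Pi>' e f" using Cons.prems by (auto simp: ptime_def)
  show ?case
    using \<Pi> computes_append computes_shift_calls[OF e]
    by (intro exI[of _ "\<Pi> @ map (shift_calls (length \<Pi>)) \<Pi>'"]) (simp, blast)
qed simp

lemma ptime_id [ptime_intros]: "ptime (\<lambda>x. x)"
  by (rule ptimeI[OF computes_Arg])

lemma ptime_Cell [ptime_intros]:
  assumes "ptime f" "ptime g"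
  shows "ptime (\<lambda>x. Cell (f x) (g x))"
proof -
  obtain \<Pi> e e' where "computes \<Pi> e f" "computes \<Pi> e' g"
    using ptime_common_prog[of "[f, g]"] assms by auto
  then show ?thesis by (rule ptimeI[OF computes_Cell])
qed

lemma ptime_comp:
  assumes "ptime f" "ptime g"
  shows "ptime (\<lambda>x. f (g x))"
proof -
  obtain \<Pi> e e' where e: "computes \<Pi> e f" "computes \<Pi> e' g"
    using ptime_common_prog[of "[f, g]"] assms by auto
  then have "computes (\<Pi> @ [e]) (Call (length \<Pi>) [e']) (\<lambda>x. f (g x))"
    by (intro computes_Call) (simp_all add: computes_append)
  then show ?thesis by (rule ptimeI)
qed

lemma ptime_vfst [ptime_intros]: "ptime f \<Longrightarrow> ptime (\<lambda>x. vfst (f x))"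
  by (erule ptime_comp[rotated]) (rule ptimeI[OF computes_Fst[OF computes_Arg]])

lemma ptime_vsnd [ptime_intros]: "ptime f \<Longrightarrow> ptime (\<lambda>x. vsnd (f x))"
  by (erule ptime_comp[rotated]) (rule ptimeI[OF computes_Snd[OF computes_Arg]])

lemma ptime_const [ptime_intros]: "ptime (\<lambda>x. c)"
  by (induction c) (auto intro: ptimeI[OF computes_Atom] ptime_Cell)

lemma ptime_comp2: "ptime (uncurry2 f) \<Longrightarrow> ptime g \<Longrightarrow> ptime h \<Longrightarrow> ptime (\<lambda>x. f (g x) (h x))"
  using ptime_comp[of "uncurry2 f" "\<lambda>x. Cell (g x) (h x)"] ptime_Cell by simp

lemma ptime_comp3:
  "ptime (uncurry3 f) \<Longrightarrow> ptime g \<Longrightarrow> ptime h \<Longrightarrow> ptime k \<Longrightarrow> ptime (\<lambda>x. f (g x) (h x) (k x))"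
  using ptime_comp2[of "\<lambda>x. uncurry2 (f x)" g "\<lambda>x. Cell (h x) (k x)"] ptime_Cell by simp

lemma ptime_comp4:
  "ptime (uncurry4 f) \<Longrightarrow> ptime g \<Longrightarrow> ptime h \<Longrightarrow> ptime k \<Longrightarrow> ptime l
    \<Longrightarrow> ptime (\<lambda>x. f (g x) (h x) (k x) (l x))"
  using ptime_comp3[of "\<lambda>x y. uncurry2 (f x y)" g h "\<lambda>x. Cell (k x) (l x)"] ptime_Cell
  by simp

lemma ptime_vbool [ptime_intros]: "ptest P \<Longrightarrow> ptime (\<lambda>x. vbool (P x))"
  by (simp add: ptest_def)

lemma ptest_eq [ptime_intros]:
  assumes "ptime f" "ptime g"
  shows "ptest (\<lambda>x. f x = g x)"
proof -
  obtain \<Pi> e e' where "computes \<Pi> e f" "computes \<Pi> e' g"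
    using ptime_common_prog[of "[f, g]"] assms by auto
  then show ?thesis unfolding ptest_def by (rule ptimeI[OF computes_Eq])
qed

lemma vbool_eq_Atom [simp]: "vbool b = Atom \<longleftrightarrow> \<not> b" "Atom = vbool b \<longleftrightarrow> \<not> b"
  by (auto simp: vbool_def)

lemma ptime_if [ptime_intros]:
  assumes "ptest P" "ptime f" "ptime g"
  shows "ptime (\<lambda>x. if P x then f x else g x)"
proof -
  obtain \<Pi> e e' e'' where
    "computes \<Pi> e (\<lambda>x. vbool (P x))" "computes \<Pi> e' f" "computes \<Pi> e'' g"
    using ptime_common_prog[of "[\<lambda>x. vbool (P x), f, g]"] assms by (auto simp: ptest_def)
  then have "computes \<Pi> (EIf e e' e'') (\<lambda>x. if vbool (P x) \<noteq> Atom then f x else g x)"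
    by (rule computes_If)
  then show ?thesis by (intro ptimeI) simp
qed

lemma ptest_if: "ptest P \<Longrightarrow> ptest Q \<Longrightarrow> ptest R \<Longrightarrow> ptest (\<lambda>x. if P x then Q x else R x)"
  unfolding ptest_def if_distrib[of vbool] by (rule ptime_if) (simp_all add: ptest_def)

lemma ptest_const: "ptest (\<lambda>x. b)"
  unfolding ptest_def by (rule ptime_const)

lemma ptest_not [ptime_intros]: "ptest P \<Longrightarrow> ptest (\<lambda>x. \<not> P x)"
  using ptest_if[of P "\<lambda>x. False" "\<lambda>x. True"] ptest_const by (simp add: if_bool_eq_disj)

lemma ptest_conj [ptime_intros]: "ptest P \<Longrightarrow> ptest Q \<Longrightarrow> ptest (\<lambda>x. P x \<and> Q x)"
  using ptest_if[of P Q "\<lambda>x. False"] ptest_const by (simp add: if_bool_eq_disj)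

lemma ptest_disj [ptime_intros]: "ptest P \<Longrightarrow> ptest Q \<Longrightarrow> ptest (\<lambda>x. P x \<or> Q x)"
  using ptest_not[OF ptest_conj[OF ptest_not ptest_not], of P Q] by simp

lemma ptime_poly_time_on:
  assumes "ptime f"
  shows "poly_time_on D f"
proof -
  obtain \<Pi> e where "computes \<Pi> e f" using assms by (auto simp: ptime_def)
  then have "computes (\<Pi> @ [e]) (Call (length \<Pi>) [Arg 0]) f"
    using computes_Call[of "length \<Pi>" "\<Pi> @ [e]" f "Arg 0"] computes_Arg
    by (simp add: computes_append)
  then show ?thesis
    unfolding computes_def poly_bounded_def poly_time_on_def by blast
qed

section \<open>Structural recursion in polynomial time\<close>

text \<open>In a program whose functions \<open>m\<close> and \<open>m + 1\<close> compute the base case and the step of a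
  recursion, \<open>rec_body m\<close> as function \<open>m + 2\<close> computes the recursion. Its argument \<open>Cell e x\<close>
  consists of a parameter and the value recursed on; the step is evaluated once per node of \<open>x\<close>.\<close>

abbreviation rec_env :: expr where
  "rec_env \<equiv> EFst (Arg 0)"

abbreviation rec_left :: expr where
  "rec_left \<equiv> EFst (ESnd (Arg 0))"

abbreviation rec_right :: expr where
  "rec_right \<equiv> ESnd (ESnd (Arg 0))"

definition rec_call :: "nat \<Rightarrow> expr \<Rightarrow> expr" where
  "rec_call m e = Call (m + 2) [ECell rec_env e]"

definition rec_arg :: "nat \<Rightarrow> expr" where
  "rec_arg m = ECell rec_env (ECell rec_left (ECell rec_right
     (ECell (rec_call m rec_left) (rec_call m rec_right))))"

definition rec_body :: "nat \<Rightarrow> expr" where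
  "rec_body m = EIf (ESnd (Arg 0)) (Call (m + 1) [rec_arg m]) (Call m [rec_env])"

lemma run_rec_fields:
  fixes e v w :: val
  defines "z \<equiv> Cell e (Cell v w)"
  shows "\<exists>t \<le> 4 * vsize z. run \<Pi> [z] rec_env e t"
    and "\<exists>t \<le> 4 * vsize z. run \<Pi> [z] (ESnd (Arg 0)) (Cell v w) t"
    and "\<exists>t \<le> 4 * vsize z. run \<Pi> [z] rec_left v t"
    and "\<exists>t \<le> 4 * vsize z. run \<Pi> [z] rec_right w t"
proof -
  have z: "run \<Pi> [z] (Arg 0) (Cell e (Cell v w)) (1 + vsize z)"
    using run_Arg[of 0 "[z]"] by (simp add: z_def)
  note e = run_Fst[OF z, unfolded vfst.simps] and vw = run_Snd[OF z, unfolded vsnd.simps]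
  note v = run_Fst[OF vw, unfolded vfst.simps] and w = run_Snd[OF vw, unfolded vsnd.simps]
  show "\<exists>t \<le> 4 * vsize z. run \<Pi> [z] rec_env e t"
    by (rule exI, rule conjI[OF _ e]) (simp add: z_def)
  show "\<exists>t \<le> 4 * vsize z. run \<Pi> [z] (ESnd (Arg 0)) (Cell v w) t"
    by (rule exI, rule conjI[OF _ vw]) (simp add: z_def)
  show "\<exists>t \<le> 4 * vsize z. run \<Pi> [z] rec_left v t"
    by (rule exI, rule conjI[OF _ v]) (simp add: z_def)
  show "\<exists>t \<le> 4 * vsize z. run \<Pi> [z] rec_right w t"
    by (rule exI, rule conjI[OF _ w]) (simp add: z_def)
qed

context
  fixes \<Pi> :: prog and m :: nat
  assumes body: "m + 2 < length \<Pi>" "\<Pi> ! (m + 2) = rec_body m"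
begin

lemma run_rec_call:
  assumes "run \<Pi> [z] rec_env e t" "run \<Pi> [z] c x t'" "run \<Pi> [Cell e x] (rec_body m) y t''"
  shows "run \<Pi> [z] (rec_call m c) y (t + t' + 1 + vsize (Cell e x) + t'' + 1 + vsize y)"
  unfolding rec_call_def
  using run_Call_unary[OF body(1) run_Cell[OF assms(1,2)]] assms(3) body(2) by simp

lemma run_rec_body_Cell:
  fixes e v w hv hw r :: val
  defines "arg \<equiv> Cell e (Cell v (Cell w (Cell hv hw)))"
  assumes v: "run \<Pi> [Cell e v] (rec_body m) hv tv" and w: "run \<Pi> [Cell e w] (rec_body m) hw tw"
    and s: "run \<Pi> [arg] (\<Pi> ! (m + 1)) r ts"
  shows "\<exists>t \<le> tv + tw + (40 * vsize arg + ts + 2 * vsize r).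
    run \<Pi> [Cell e (Cell v w)] (rec_body m) r t"
proof -
  let ?z = "Cell e (Cell v w)"
  obtain te where te: "te \<le> 4 * vsize ?z" "run \<Pi> [?z] rec_env e te"
    using run_rec_fields(1) by blast
  obtain tvw where tvw: "tvw \<le> 4 * vsize ?z" "run \<Pi> [?z] (ESnd (Arg 0)) (Cell v w) tvw"
    using run_rec_fields(2) by blast
  obtain tl where tl: "tl \<le> 4 * vsize ?z" "run \<Pi> [?z] rec_left v tl"
    using run_rec_fields(3) by blast
  obtain tr where tr: "tr \<le> 4 * vsize ?z" "run \<Pi> [?z] rec_right w tr"
    using run_rec_fields(4) by blast
  note calls = run_Cell[OF run_rec_call[OF te(2) tl(2) v] run_rec_call[OF te(2) tr(2) w]]
  note arg = run_Cell[OF te(2) run_Cell[OF tl(2) run_Cell[OF tr(2) calls]],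
      folded rec_arg_def arg_def]
  have m1: "m + 1 < length \<Pi>" using body(1) by simp
  show ?thesis
    unfolding rec_body_def
    by (rule exI, rule conjI[OF _ run_If_true[OF tvw(2) val.distinct(2)
          run_Call_unary[OF m1 arg s]]])
      (use te(1) tvw(1) tl(1) tr(1) in \<open>simp add: arg_def\<close>)
qed

lemma run_rec_body_Atom:
  assumes "run \<Pi> [e] (\<Pi> ! m) y t"
  shows "\<exists>t' \<le> t + 20 * vsize e + 2 * vsize y. run \<Pi> [Cell e Atom] (rec_body m) y t'"
proof -
  let ?z = "Cell e Atom"
  have z: "run \<Pi> [?z] (Arg 0) ?z (1 + vsize ?z)" using run_Arg[of 0 "[?z]"] by simp
  have m: "m < length \<Pi>" using body(1) by simp
  show ?thesis
    unfolding rec_body_def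
    by (rule exI, rule conjI[OF _ run_If_false[OF run_Snd[OF z, unfolded vsnd.simps]
          run_Call_unary[OF m run_Fst[OF z, unfolded vfst.simps] assms]]])
      (use vsize_pos[of e] in simp)
qed

end

context
  fixes \<Pi> :: prog and m :: nat and s :: "val \<Rightarrow> val \<Rightarrow> val \<Rightarrow> val \<Rightarrow> val \<Rightarrow> val" and a h
  assumes body: "m + 2 < length \<Pi>" "\<Pi> ! (m + 2) = rec_body m"
    and a: "computes \<Pi> (\<Pi> ! m) a"
    and s: "computes \<Pi> (\<Pi> ! (m + 1)) (uncurry5 s)"
    and h_Atom: "\<And>e. h e Atom = a e"
    and h_Cell: "\<And>e v w. h e (Cell v w) = s e v w (h e v) (h e w)"
    and size: "poly_bounded (uncurry2 (\<lambda>e x. vsize (h e x)))"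
begin

lemma rec_cost_Atom:
  obtains t where "poly_bounded t"
    and "\<And>e. \<exists>t' \<le> t e. run \<Pi> [Cell e Atom] (rec_body m) (h e Atom) t'"
proof -
  obtain ta where ta: "poly_bounded ta" "\<And>x. run \<Pi> [x] (\<Pi> ! m) (a x) (ta x)"
    using a by (rule computesE) blast
  show thesis
  proof (rule that)
    show "poly_bounded (\<lambda>e. ta e + 20 * vsize e + 2 * vsize (a e))"
      by (intro poly_bounded_intros ta(1) a[THEN computes_vsize])
    show "\<exists>t' \<le> ta e + 20 * vsize e + 2 * vsize (a e).
        run \<Pi> [Cell e Atom] (rec_body m) (h e Atom) t'" for e
      unfolding h_Atom using body ta(2) by (rule run_rec_body_Atom)
  qed
qed

lemma rec_cost_Cell:
  obtains t where "poly_bounded t"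
    and "\<And>e v w tv tw. run \<Pi> [Cell e v] (rec_body m) (h e v) tv
      \<Longrightarrow> run \<Pi> [Cell e w] (rec_body m) (h e w) tw
      \<Longrightarrow> \<exists>t' \<le> tv + tw + t (Cell e (Cell v w)).
        run \<Pi> [Cell e (Cell v w)] (rec_body m) (h e (Cell v w)) t'"
proof -
  obtain ts where ts: "poly_bounded ts" "\<And>z. run \<Pi> [z] (\<Pi> ! (m + 1)) (uncurry5 s z) (ts z)"
    using s by (rule computesE) blast
  define arg where "arg = uncurry3 (\<lambda>e v w. Cell e (Cell v (Cell w (Cell (h e v) (h e w)))))"
  have arg: "poly_bounded (\<lambda>z. vsize (arg z))"
    unfolding arg_def by (intro poly_bounded_intros poly_bounded_comp2[OF size])
  show thesis
  proof (rule that)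
    show "poly_bounded (\<lambda>z. 40 * vsize (arg z) + ts (arg z) + 2 * uncurry2 (\<lambda>e x. vsize (h e x)) z)"
      by (intro poly_bounded_intros poly_bounded_comp[OF ts(1)] arg size)
    fix e v w tv tw
    let ?z = "Cell e (Cell v w)"
    assume "run \<Pi> [Cell e v] (rec_body m) (h e v) tv" "run \<Pi> [Cell e w] (rec_body m) (h e w) tw"
    then show "\<exists>t' \<le> tv + tw
        + (40 * vsize (arg ?z) + ts (arg ?z) + 2 * uncurry2 (\<lambda>e x. vsize (h e x)) ?z).
        run \<Pi> [?z] (rec_body m) (h e (Cell v w)) t'"
      using run_rec_body_Cell[OF body, of e v "h e v" tv w "h e w"] ts(2)[of "arg ?z"]
        h_Cell[of e v w]
      by (simp add: arg_def)
  qed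
qed

lemma rec_cost:
  obtains \<tau> where "poly_bounded (uncurry2 \<tau>)"
    and "\<And>e x. run \<Pi> [Cell e x] (rec_body m) (h e x) (\<tau> e x)"
proof -
  obtain t_Atom where t_Atom: "poly_bounded t_Atom"
    "\<And>e. \<exists>t \<le> t_Atom e. run \<Pi> [Cell e Atom] (rec_body m) (h e Atom) t"
    by (rule rec_cost_Atom) blast
  obtain t_Cell where t_Cell: "poly_bounded t_Cell"
    "\<And>e v w tv tw. run \<Pi> [Cell e v] (rec_body m) (h e v) tv
      \<Longrightarrow> run \<Pi> [Cell e w] (rec_body m) (h e w) tw
      \<Longrightarrow> \<exists>t \<le> tv + tw + t_Cell (Cell e (Cell v w)).
        run \<Pi> [Cell e (Cell v w)] (rec_body m) (h e (Cell v w)) t"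
    by (rule rec_cost_Cell) blast
  have "\<exists>t. run \<Pi> [Cell e x] (rec_body m) (h e x) t" for e x
    by (induction x) (use t_Atom(2) t_Cell(2) in blast)+
  then obtain \<tau> where \<tau>: "\<And>e x. run \<Pi> [Cell e x] (rec_body m) (h e x) (\<tau> e x)" by metis
  note \<tau>_unique = run_deterministic(1)[OF \<tau>]
  have "\<tau> e Atom \<le> t_Atom e" for e
    using t_Atom(2)[of e] \<tau>_unique[of e Atom] by blast
  moreover have "\<tau> e (Cell v w) \<le> \<tau> e v + \<tau> e w + t_Cell (Cell e (Cell v w))" for e v w
    using t_Cell(2)[OF \<tau> \<tau>, of e v w] \<tau>_unique[of e "Cell v w"] by blast
  ultimately have "poly_bounded (uncurry2 \<tau>)"
    by (rule poly_bounded_rec[OF t_Atom(1) _ t_Cell(1)])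
  then show thesis using \<tau> by (rule that)
qed

end

lemma ptime_rec:
  assumes a: "ptime a" and s: "ptime (uncurry5 s)"
    and h: "\<And>e. h e Atom = a e" "\<And>e v w. h e (Cell v w) = s e v w (h e v) (h e w)"
    and size: "poly_bounded (uncurry2 (\<lambda>e x. vsize (h e x)))"
  shows "ptime (uncurry2 h)"
proof -
  obtain \<Pi>0 ea es where prog: "computes \<Pi>0 ea a" "computes \<Pi>0 es (uncurry5 s)"
    using ptime_common_prog[of "[a, uncurry5 s]"] a s by auto
  define m where "m = length \<Pi>0"
  define \<Pi> where "\<Pi> = \<Pi>0 @ [ea, es, rec_body m]"
  have body: "m + 2 < length \<Pi>" "\<Pi> ! (m + 2) = rec_body m"
    and "\<Pi> ! m = ea" "\<Pi> ! (m + 1) = es"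
    by (auto simp: \<Pi>_def m_def nth_append)
  then have "computes \<Pi> (\<Pi> ! m) a" "computes \<Pi> (\<Pi> ! (m + 1)) (uncurry5 s)"
    using prog by (simp_all add: \<Pi>_def computes_append)
  then obtain \<tau> where \<tau>: "poly_bounded (uncurry2 \<tau>)"
    "\<And>e x. run \<Pi> [Cell e x] (rec_body m) (h e x) (\<tau> e x)"
    by (rule rec_cost[OF body, where a = a and s = s and h = h]) (use h size in blast)+
  obtain t where t: "poly_bounded t"
    "\<And>z. run \<Pi> [z] (ECell rec_env (ESnd (Arg 0))) (Cell (vfst z) (vsnd z)) (t z)"
    using computes_Cell[OF computes_Fst[OF computes_Arg] computes_Snd[OF computes_Arg]]
    by (rule computesE) blast
  have "run \<Pi> [z] (rec_call m (ESnd (Arg 0))) (uncurry2 h z)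
      (t z + uncurry2 \<tau> z + 1 + vsize (uncurry2 h z))" for z
    unfolding rec_call_def using run_Call_unary[OF body(1) t(2)] \<tau>(2) body(2) by simp
  then have "computes \<Pi> (rec_call m (ESnd (Arg 0))) (uncurry2 h)"
    by (rule computesI[rotated]) (intro poly_bounded_intros t(1) \<tau>(1) size)
  then show ?thesis by (rule ptimeI)
qed

text \<open>Here \<open>s\<close> is the step of a recursion and \<open>r\<close> the result of the recursive call: the sizes of
  the values then add up to a polynomial.\<close>

definition additive_growth :: "(val \<Rightarrow> val \<Rightarrow> val) \<Rightarrow> bool" where
  "additive_growth s \<longleftrightarrow> (\<exists>g. poly_bounded g \<and> (\<forall>z r. vsize (s z r) \<le> vsize r + g z))"

named_theorems growth_intros

lemma additive_growthI:
  "poly_bounded g \<Longrightarrow> (\<And>z r. vsize (s z r) \<le> vsize r + g z) \<Longrightarrow> additive_growth s"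
  unfolding additive_growth_def by blast

lemma additive_growthE:
  assumes "additive_growth s"
  obtains g where "poly_bounded g" "\<And>z r. vsize (s z r) \<le> vsize r + g z"
  using assms unfolding additive_growth_def by blast

lemma additive_growth_mono:
  assumes "additive_growth s" "\<And>z r. vsize (s' z r) \<le> vsize (s z r)"
  shows "additive_growth s'"
  using assms unfolding additive_growth_def by (meson le_trans)

lemma additive_growth_id [growth_intros]: "additive_growth (\<lambda>z r. r)"
  by (rule additive_growthI[OF poly_bounded_const]) simp

lemma additive_growth_ptime [growth_intros]: "ptime f \<Longrightarrow> additive_growth (\<lambda>z r. f z)"
  by (rule additive_growthI[OF ptime_vsize]) (assumption, rule le_add2)

lemma additive_growth_vfst [growth_intros]:
  "additive_growth s \<Longrightarrow> additive_growth (\<lambda>z r. vfst (s z r))"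
  by (erule additive_growth_mono) (rule vsize_vfst_le)

lemma additive_growth_vsnd [growth_intros]:
  "additive_growth s \<Longrightarrow> additive_growth (\<lambda>z r. vsnd (s z r))"
  by (erule additive_growth_mono) (rule vsize_vsnd_le)

lemma additive_growth_add:
  assumes "additive_growth s" "poly_bounded g" "\<And>z r. vsize (s' z r) \<le> vsize (s z r) + g z"
  shows "additive_growth s'"
proof -
  obtain f where f: "poly_bounded f" "\<And>z r. vsize (s z r) \<le> vsize r + f z"
    using assms(1) by (rule additive_growthE) blast
  have "vsize (s' z r) \<le> vsize r + (f z + g z)" for z r
    using assms(3)[of z r] f(2)[of z r] by simp
  then show ?thesis by (rule additive_growthI[rotated]) (intro poly_bounded_intros f(1) assms(2))
qed

lemma additive_growth_Cell [growth_intros]: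
  assumes "additive_growth s" "ptime f"
  shows "additive_growth (\<lambda>z r. Cell (f z) (s z r))" "additive_growth (\<lambda>z r. Cell (s z r) (f z))"
  by (rule additive_growth_add[OF assms(1), of "\<lambda>z. 1 + vsize (f z)"];
      (intro poly_bounded_intros ptime_vsize assms(2))?; simp)+

lemma additive_growth_if [growth_intros]:
  assumes "additive_growth s" "additive_growth s'"
  shows "additive_growth (\<lambda>z r. if P z r then s z r else s' z r)"
proof -
  obtain g where g: "poly_bounded g" "\<And>z r. vsize (s z r) \<le> vsize r + g z"
    using assms(1) by (rule additive_growthE) blast
  obtain g' where g': "poly_bounded g'" "\<And>z r. vsize (s' z r) \<le> vsize r + g' z"
    using assms(2) by (rule additive_growthE) blast
  show ?thesis
  proof (rule additive_growthI)
    show "poly_bounded (\<lambda>z. g z + g' z)" using g(1) g'(1) by (rule poly_bounded_add)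
    show "vsize (if P z r then s z r else s' z r) \<le> vsize r + (g z + g' z)" for z r
      using g(2)[of z r] g'(2)[of z r] by simp
  qed
qed

section \<open>Lists of values\<close>

primrec dec_list :: "val \<Rightarrow> val list" where
  "dec_list Atom = []"
| "dec_list (Cell v w) = v # dec_list w"

lemma enc_list_simps [simp]:
  "enc_list [] = Atom"
  "enc_list (v # vs) = Cell v (enc_list vs)"
  by (simp_all add: enc_list_def)

lemma dec_list_enc_list [simp]: "dec_list (enc_list vs) = vs"
  by (induction vs) auto

lemma enc_list_dec_list [simp]: "enc_list (dec_list v) = v"
  by (induction v) auto

lemma enc_list_eq_iff [simp]: "enc_list vs = enc_list ws \<longleftrightarrow> vs = ws"
  by (metis dec_list_enc_list)

lemma ptime_foldr:
  assumes z: "ptime z" and s: "ptime (uncurry3 s)"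
    and growth: "additive_growth (uncurry2 s)"
  shows "ptime (uncurry2 (\<lambda>e x. foldr (s e) (dec_list x) (z e)))"
proof (rule ptime_rec[OF z])
  show "ptime (uncurry5 (\<lambda>e v w rv rw. s e v rw))"
    using ptime_comp3[OF s, of vfst "\<lambda>z. vfst (vsnd z)" "\<lambda>z. vsnd (vsnd (vsnd (vsnd z)))"]
    by (simp add: ptime_vfst ptime_vsnd ptime_id)
  obtain g where g: "poly_bounded g" "\<And>z r. vsize (uncurry2 s z r) \<le> vsize r + g z"
    using growth by (rule additive_growthE) blast
  show "poly_bounded (uncurry2 (\<lambda>e x. vsize (foldr (s e) (dec_list x) (z e))))"
  proof (rule poly_bounded_rec)
    show "poly_bounded (\<lambda>e. vsize (z e))" using z by (rule ptime_vsize)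
    show "poly_bounded (\<lambda>z. g (Cell (vfst z) (vfst (vsnd z))))"
      by (rule poly_bounded_comp[OF g(1)]) (intro poly_bounded_intros)
    show "vsize (foldr (s e) (dec_list (Cell v w)) (z e))
        \<le> vsize (foldr (s e) (dec_list v) (z e)) + vsize (foldr (s e) (dec_list w) (z e))
          + g (Cell (vfst (Cell e (Cell v w))) (vfst (vsnd (Cell e (Cell v w)))))" for e v w
      using g(2)[of "Cell e v" "foldr (s e) (dec_list w) (z e)"] by simp
  qed simp
qed simp_all

definition vmap :: "(val \<Rightarrow> val) \<Rightarrow> val \<Rightarrow> val" where
  "vmap f v = foldr (\<lambda>x. Cell (f x)) (dec_list v) Atom"

definition vfilter :: "(val \<Rightarrow> bool) \<Rightarrow> val \<Rightarrow> val" where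
  "vfilter P v = foldr (\<lambda>x r. if P x then Cell x r else r) (dec_list v) Atom"

definition vappend :: "val \<Rightarrow> val \<Rightarrow> val" where
  "vappend v w = foldr Cell (dec_list v) w"

definition vrev :: "val \<Rightarrow> val" where
  "vrev v = foldr (\<lambda>x r. vappend r (Cell x Atom)) (dec_list v) Atom"

definition vex :: "(val \<Rightarrow> bool) \<Rightarrow> val \<Rightarrow> bool" where
  "vex P v \<longleftrightarrow> (\<exists>x \<in> set (dec_list v). P x)"

definition vmem :: "val \<Rightarrow> val \<Rightarrow> bool" where
  "vmem x v \<longleftrightarrow> x \<in> set (dec_list v)"

lemma dec_list_vmap [simp]: "dec_list (vmap f v) = map f (dec_list v)"
  by (induction v) (auto simp: vmap_def)

lemma dec_list_vfilter [simp]: "dec_list (vfilter P v) = filter P (dec_list v)"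
  by (induction v) (auto simp: vfilter_def)

lemma dec_list_vappend [simp]: "dec_list (vappend v w) = dec_list v @ dec_list w"
  by (induction v) (auto simp: vappend_def)

lemma dec_list_vrev [simp]: "dec_list (vrev v) = rev (dec_list v)"
  by (induction v) (auto simp: vrev_def)

lemma vmap_enc_list [simp]: "vmap f (enc_list vs) = enc_list (map f vs)"
  by (metis dec_list_enc_list dec_list_vmap enc_list_dec_list)

lemma vfilter_enc_list [simp]: "vfilter P (enc_list vs) = enc_list (filter P vs)"
  by (metis dec_list_enc_list dec_list_vfilter enc_list_dec_list)

lemma vappend_enc_list [simp]: "vappend (enc_list vs) (enc_list ws) = enc_list (vs @ ws)"
  by (metis dec_list_enc_list dec_list_vappend enc_list_dec_list)

lemma vrev_enc_list [simp]: "vrev (enc_list vs) = enc_list (rev vs)"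
  by (metis dec_list_enc_list dec_list_vrev enc_list_dec_list)

lemma vfst_vrev_enc_list: "vs \<noteq> [] \<Longrightarrow> vfst (vrev (enc_list vs)) = last vs"
  by (cases vs rule: rev_cases) auto

lemma vsize_vappend: "vsize (vappend v w) + 1 = vsize v + vsize w"
  by (induction v) (auto simp: vappend_def)

lemma vsize_vrev [simp]: "vsize (vrev v) = vsize v"
proof (induction v)
  case (Cell v w)
  then show ?case using vsize_vappend[of "vrev w" "Cell v Atom"] by (simp add: vrev_def)
qed (simp add: vrev_def)

lemma additive_growth_vappend [growth_intros]:
  assumes "additive_growth s" "ptime f"
  shows "additive_growth (\<lambda>z r. vappend (s z r) (f z))"
proof (rule additive_growth_add[OF assms(1) ptime_vsize[OF assms(2)]])
  show "vsize (vappend (s z r) (f z)) \<le> vsize (s z r) + vsize (f z)" for z r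
    using vsize_vappend[of "s z r" "f z"] by simp
qed

lemma additive_growth_vrev [growth_intros]:
  "additive_growth s \<Longrightarrow> additive_growth (\<lambda>z r. vrev (s z r))"
  by (erule additive_growth_mono) simp

lemma ptime_vmap [ptime_intros]:
  assumes f: "ptime (uncurry2 f)" and X: "ptime X"
  shows "ptime (\<lambda>e. vmap (f e) (X e))"
proof -
  have "ptime (uncurry2 (\<lambda>e. vmap (f e)))"
    unfolding vmap_def
  proof (rule ptime_foldr)
    show "ptime (uncurry3 (\<lambda>e x. Cell (f e x)))" by (intro ptime_intros ptime_comp2[OF f])
    show "additive_growth (uncurry2 (\<lambda>e x. Cell (f e x)))" by (intro growth_intros f)
  qed (rule ptime_const)
  then show ?thesis using ptime_id X by (rule ptime_comp2)
qed

lemma ptime_vfilter [ptime_intros]: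
  assumes P: "ptest (uncurry2 P)" and X: "ptime X"
  shows "ptime (\<lambda>e. vfilter (P e) (X e))"
proof -
  have "ptime (uncurry2 (\<lambda>e. vfilter (P e)))"
    unfolding vfilter_def
  proof (rule ptime_foldr)
    have "ptest (\<lambda>z. P (vfst z) (vfst (vsnd z)))"
      using ptime_comp2[OF P[unfolded ptest_def], of vfst "\<lambda>z. vfst (vsnd z)"]
      by (simp add: ptest_def ptime_id ptime_vfst ptime_vsnd)
    then show "ptime (uncurry3 (\<lambda>e x r. if P e x then Cell x r else r))" by (intro ptime_intros)
    show "additive_growth (uncurry2 (\<lambda>e x r. if P e x then Cell x r else r))"
      by (intro growth_intros ptime_intros)
  qed (rule ptime_const)
  then show ?thesis using ptime_id X by (rule ptime_comp2)
qed

lemma ptime_vappend [ptime_intros]: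
  assumes "ptime X" "ptime Y"
  shows "ptime (\<lambda>e. vappend (X e) (Y e))"
proof -
  have "ptime (uncurry2 (\<lambda>w v. vappend v w))"
    unfolding vappend_def by (intro ptime_foldr ptime_intros growth_intros)
  then show ?thesis using assms(2,1) by (rule ptime_comp2)
qed

lemma ptime_vrev [ptime_intros]:
  assumes "ptime X"
  shows "ptime (\<lambda>e. vrev (X e))"
proof -
  have "ptime (uncurry2 (\<lambda>e v. vrev v))"
    unfolding vrev_def by (intro ptime_foldr ptime_intros growth_intros)
  then show ?thesis using ptime_id assms by (rule ptime_comp2)
qed

lemma ptest_vex [ptime_intros]:
  assumes "ptest (uncurry2 P)" "ptime X"
  shows "ptest (\<lambda>e. vex (P e) (X e))"
proof -
  have "vfilter (P e) (X e) = Atom \<longleftrightarrow> dec_list (vfilter (P e) (X e)) = []" for e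
    by (metis dec_list_enc_list enc_list_dec_list enc_list_simps(1))
  then have "vex (P e) (X e) \<longleftrightarrow> \<not> (vfilter (P e) (X e) = Atom)" for e
    by (simp add: vex_def filter_empty_conv)
  then show ?thesis by (simp only:) (intro ptime_intros assms)
qed

lemma ptest_vmem [ptime_intros]:
  assumes f: "ptime f" and X: "ptime X"
  shows "ptest (\<lambda>e. vmem (f e) (X e))"
proof -
  have "vmem (f e) (X e) \<longleftrightarrow> vex (\<lambda>y. y = f e) (X e)" for e
    by (simp add: vex_def vmem_def)
  then show ?thesis by (simp only:) (intro ptime_intros ptime_comp[OF f] X)
qed

lemma vsize_vmap_Cell: "vsize (vmap (Cell c) v) = vsize v + length (dec_list v) * (1 + vsize c)"
  by (induction v) (auto simp: vmap_def)

lemma length_dec_list_le: "length (dec_list v) \<le> vsize v"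
  by (induction v) auto

primrec vprefixes :: "val \<Rightarrow> val" where
  "vprefixes Atom = Cell Atom Atom"
| "vprefixes (Cell v w) = Cell Atom (vmap (Cell v) (vprefixes w))"

lemma dec_list_vprefixes: "dec_list (vprefixes v) = map enc_list (prefixes (dec_list v))"
  by (induction v) auto

lemma ptime_vprefixes [ptime_intros]:
  assumes "ptime X"
  shows "ptime (\<lambda>e. vprefixes (X e))"
proof -
  have "ptime (uncurry2 (\<lambda>e. vprefixes))"
  proof (rule ptime_rec[OF ptime_const])
    show "ptime (uncurry5 (\<lambda>e v w rv rw. Cell Atom (vmap (Cell v) rw)))" by (intro ptime_intros)
    show "poly_bounded (\<lambda>z. vsize (vprefixes (vsnd z)))"
    proof (rule poly_bounded_rec[where r = "\<lambda>e x. vsize (vprefixes x)" and a = "\<lambda>e. 3"])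
      show "poly_bounded (\<lambda>z. 2 + vsize z * vsize z)" by (intro poly_bounded_intros)
      fix e v w
      have "length (dec_list (vprefixes w)) * (1 + vsize v)
          \<le> vsize (Cell e (Cell v w)) * vsize (Cell e (Cell v w))"
        using length_dec_list_le[of w] by (intro mult_le_mono) (simp_all add: dec_list_vprefixes)
      moreover have "vsize (vprefixes (Cell v w))
          = 2 + vsize (vprefixes w) + length (dec_list (vprefixes w)) * (1 + vsize v)"
        by (simp add: vsize_vmap_Cell)
      ultimately show "vsize (vprefixes (Cell v w)) \<le> vsize (vprefixes v) + vsize (vprefixes w)
          + (2 + vsize (Cell e (Cell v w)) * vsize (Cell e (Cell v w)))"
        by linarith
    qed (simp_all add: poly_bounded_const)
  qed simp_all
  then show ?thesis using ptime_id assms by (rule ptime_comp2)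
qed

section \<open>Recursion over codes of trees\<close>

fun fold_tree :: "('a \<Rightarrow> 'a list \<Rightarrow> 'b list \<Rightarrow> 'b) \<Rightarrow> 'a tree \<Rightarrow> 'b" where
  "fold_tree s (Node x ts) = s x (map root ts) (map (fold_tree s) ts)"

fun vtree :: "(val \<Rightarrow> val \<Rightarrow> val \<Rightarrow> val) \<Rightarrow> val \<Rightarrow> val"
  and vforest :: "(val \<Rightarrow> val \<Rightarrow> val \<Rightarrow> val) \<Rightarrow> val \<Rightarrow> val" where
  "vtree s Atom = Atom"
| "vtree s (Cell v w) = s v (vmap vfst w) (vforest s w)"
| "vforest s Atom = Atom"
| "vforest s (Cell v w) = Cell (vtree s v) (vforest s w)"

lemma vforest_enc_list: "vforest s (enc_list vs) = enc_list (map (vtree s) vs)"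
  by (induction vs) auto

lemma vtree_Cell_enc_list:
  "vtree s (Cell v (enc_list vs)) = s v (enc_list (map vfst vs)) (enc_list (map (vtree s) vs))"
  by (simp add: vforest_enc_list)

lemma encodes_tree_root: "encodes_tree E t v \<Longrightarrow> E (root t) (vfst v)"
  by (erule encodes_tree.cases) simp

lemma encodes_fold_tree:
  assumes step: "\<And>x ts v vs rs ws. \<lbrakk> Q (Node x ts); E x v; list_all2 E (map root ts) vs;
      list_all2 F rs ws; length rs = length ts \<rbrakk>
      \<Longrightarrow> F (s x (map root ts) rs) (s' v (enc_list vs) (enc_list ws))"
    and subtrees: "\<And>x ts t. Q (Node x ts) \<Longrightarrow> t \<in> set ts \<Longrightarrow> Q t"
  shows "Q t \<Longrightarrow> encodes_tree E t v \<Longrightarrow> F (fold_tree s t) (vtree s' v)"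
proof (induction t arbitrary: v)
  case (Node x ts)
  obtain w vs where v: "v = Cell w (enc_list vs)" "E x w" "list_all2 (encodes_tree E) ts vs"
    using Node.prems(2) by (cases rule: encodes_tree.cases) auto
  have "list_all2 E (map root ts) (map vfst vs)"
    using v(3) encodes_tree_root[of E]
    by (auto simp: list_all2_map1 list_all2_map2 elim!: list.rel_mono_strong)
  moreover have "list_all2 F (map (fold_tree s) ts) (map (vtree s') vs)"
    using v(3) Node.IH subtrees[OF Node.prems(1)]
    by (auto simp: list_all2_map1 list_all2_map2 elim!: list.rel_mono_strong)
  ultimately show ?case
    unfolding v(1) vtree_Cell_enc_list fold_tree.simps using Node.prems(1) v(2) by (intro step) auto
qed

lemma ptime_vtree:
  assumes s: "ptime (uncurry4 s)"
    and growth: "additive_growth (uncurry3 s)"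
  shows "ptime (uncurry2 (\<lambda>e. vtree (s e)))"
proof -
  \<comment> \<open>A subterm is a tree or a forest depending on where it stands: the recursion computes the
    result for both readings.\<close>
  define h where "h e x = Cell (vtree (s e) x) (vforest (s e) x)" for e x
  obtain g where g: "poly_bounded g"
    "\<And>z r. vsize (uncurry3 s z r) \<le> vsize r + g z"
    using growth by (rule additive_growthE) blast
  define arg where "arg = uncurry3 (\<lambda>e v w. Cell e (Cell v (vmap vfst w)))"
  define max_size where "max_size e x = max (vsize (vtree (s e) x)) (vsize (vforest (s e) x))"
    for e x
  have "poly_bounded (uncurry2 max_size)"
  proof (rule poly_bounded_rec[where a = "\<lambda>e. 1"])
    have "ptime arg" unfolding arg_def by (intro ptime_intros)
    then show "poly_bounded (\<lambda>z. 1 + g (arg z))"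
      by (intro poly_bounded_intros poly_bounded_comp[OF g(1)] ptime_vsize)
    show "max_size e (Cell v w) \<le> max_size e v + max_size e w + (1 + g (arg (Cell e (Cell v w))))"
      for e v w
      unfolding max_size_def using g(2)[of "arg (Cell e (Cell v w))" "vforest (s e) w"]
      by (intro max.boundedI; simp add: arg_def; linarith)
  qed (simp_all add: poly_bounded_const max_size_def)
  then have size: "poly_bounded (uncurry2 (\<lambda>e x. vsize (h e x)))"
    unfolding h_def by (intro poly_bounded_vsize_Cell) (auto elim!: poly_bounded_mono
        simp: max_size_def)
  have "ptime (uncurry2 h)"
  proof (rule ptime_rec[OF _ _ _ _ size])
    show "ptime (\<lambda>_. Cell Atom Atom)" by (rule ptime_const)
    have "ptime (uncurry5 (\<lambda>e v w rv rw. s e v (vmap vfst w) (vsnd rw)))"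
      by (rule ptime_comp4[OF s, where h = "\<lambda>z. vfst (vsnd z)"
            and k = "\<lambda>z. vmap vfst (vfst (vsnd (vsnd z)))"]; intro ptime_intros)
    then show "ptime (uncurry5 (\<lambda>e v w rv rw. Cell (s e v (vmap vfst w) (vsnd rw))
        (Cell (vfst rv) (vsnd rw))))"
      by (intro ptime_intros)
  qed (simp_all add: h_def)
  from ptime_vfst[OF this] show ?thesis by (simp add: h_def)
qed

section \<open>Derivation trees\<close>

fun derivation :: "qcbf \<Rightarrow> judgement tree \<Rightarrow> bool" where
  "derivation \<psi> (Node J ts) \<longleftrightarrow>
     is_judgement \<psi> J \<and> derived \<psi> J (map root ts) \<and> (\<forall>t\<in>set ts. derivation \<psi> t)"

lemma derivation_root: "derivation \<psi> P \<Longrightarrow> is_judgement \<psi> (root P)"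
  by (cases P) auto

lemma induced_tree_derivation:
  assumes "is_proof \<psi> \<pi>" "induced_tree \<pi> k P"
  shows "derivation \<psi> P \<and> root P = fst (\<pi> ! k)"
  using assms(2)
proof (induction rule: induced_tree.induct)
  case (1 k J ps ts)
  have "map root ts = map (\<lambda>p. fst (\<pi> ! p)) ps"
    using 1(3) by (induction ps ts rule: list_all2_induct) auto
  moreover have "\<forall>t\<in>set ts. derivation \<psi> t"
    using 1(3) by (induction ps ts rule: list_all2_induct) auto
  ultimately show ?case using 1(1,2) assms(1) by (auto simp: is_proof_def)
qed

lemma is_proof_Nil: "is_proof \<psi> []"
  by (simp add: is_proof_def)

lemma is_proof_snoc:
  "is_proof \<psi> (\<pi> @ [(J, ps)]) \<longleftrightarrow> is_proof \<psi> \<pi> \<and> is_judgement \<psi> J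
     \<and> (\<forall>p\<in>set ps. p < length \<pi>) \<and> derived \<psi> J (map (\<lambda>p. fst (\<pi> ! p)) ps)"
proof -
  let ?\<pi>' = "\<pi> @ [(J, ps)]"
  have old: "map (\<lambda>p. fst (?\<pi>' ! p)) qs = map (\<lambda>p. fst (\<pi> ! p)) qs"
    if "\<forall>p\<in>set qs. p < k" "k \<le> length \<pi>" for qs k
    using that by (auto simp: nth_append)
  have "(case ?\<pi>' ! k of (K, qs) \<Rightarrow> is_judgement \<psi> K \<and> (\<forall>p\<in>set qs. p < k)
        \<and> derived \<psi> K (map (\<lambda>p. fst (?\<pi>' ! p)) qs))
      \<longleftrightarrow> (case \<pi> ! k of (K, qs) \<Rightarrow> is_judgement \<psi> K \<and> (\<forall>p\<in>set qs. p < k)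
        \<and> derived \<psi> K (map (\<lambda>p. fst (\<pi> ! p)) qs))" if "k < length \<pi>" for k
  proof (cases "\<pi> ! k")
    case (Pair K qs)
    then have "?\<pi>' ! k = (K, qs)" using that by (simp add: nth_append)
    then show ?thesis using old[of qs k] that Pair by (simp del: map_eq_conv cong: conj_cong)
  qed
  then show ?thesis
    using old[of ps "length \<pi>"]
    by (auto simp: is_proof_def All_less_Suc simp del: map_eq_conv)
qed

lemma card_successors_le_1:
  assumes "distinct (concat (map snd \<pi>))"
  shows "card {k. k < length \<pi> \<and> p \<in> set (snd (\<pi> ! k))} \<le> 1"
  using assms
proof (induction \<pi> rule: rev_induct)
  case (snoc x \<pi>)
  let ?A = "\<lambda>\<pi>. {k. k < length \<pi> \<and> p \<in> set (snd (\<pi> ! k))}"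
  show ?case
  proof (cases "p \<in> set (snd x)")
    case True
    then have "p \<notin> set (snd (\<pi> ! k))" if "k < length \<pi>" for k
      using snoc.prems that nth_mem by (fastforce simp: disjoint_iff)
    then have "?A (\<pi> @ [x]) \<subseteq> {length \<pi>}" by (auto simp: nth_append less_Suc_eq)
    then show ?thesis using card_mono[of "{length \<pi>}"] by fastforce
  next
    case False
    then have "?A (\<pi> @ [x]) = ?A \<pi>" by (auto simp: nth_append less_Suc_eq)
    then show ?thesis using snoc by simp
  qed
qed simp

definition shift_preds :: "nat \<Rightarrow> judgement_seq \<Rightarrow> judgement_seq" where
  "shift_preds n \<pi> = map (\<lambda>(J, ps). (J, map ((+) n) ps)) \<pi>"

lemma is_proof_append_shift:
  "is_proof \<psi> \<pi> \<Longrightarrow> is_proof \<psi> \<pi>' \<Longrightarrow> is_proof \<psi> (\<pi> @ shift_preds (length \<pi>) \<pi>')"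
proof (induction \<pi>' rule: rev_induct)
  case (snoc x \<pi>')
  obtain J ps where x: "x = (J, ps)" by fastforce
  let ?\<pi> = "\<pi> @ shift_preds (length \<pi>) \<pi>'"
  have x': "is_judgement \<psi> J" "\<forall>p\<in>set ps. p < length \<pi>'" "derived \<psi> J (map (\<lambda>p. fst (\<pi>' ! p)) ps)"
    and "is_proof \<psi> \<pi>'"
    using snoc.prems(2) by (simp_all add: x is_proof_snoc)
  then have "is_proof \<psi> ?\<pi>" using snoc by simp
  moreover have "map (\<lambda>p. fst (?\<pi> ! p)) (map ((+) (length \<pi>)) ps) = map (\<lambda>p. fst (\<pi>' ! p)) ps"
    using x'(2) by (auto simp: nth_append shift_preds_def split: prod.splits)
  ultimately have "is_proof \<psi> (?\<pi> @ [(J, map ((+) (length \<pi>)) ps)])"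
    unfolding is_proof_snoc using x' by (auto simp: shift_preds_def simp del: map_map map_eq_conv)
  then show ?case by (simp add: shift_preds_def x)
qed (simp add: shift_preds_def)

lemma is_proof_preds_less: "is_proof \<psi> \<pi> \<Longrightarrow> p \<in> set (concat (map snd \<pi>)) \<Longrightarrow> p < length \<pi>"
proof (induction \<pi> rule: rev_induct)
  case (snoc x \<pi>)
  then show ?case by (cases x) (auto simp: is_proof_snoc less_Suc_eq simp del: set_concat)
qed simp

lemma induced_tree_append: "induced_tree \<pi> k P \<Longrightarrow> induced_tree (\<pi> @ \<pi>') k P"
proof (induction rule: induced_tree.induct)
  case (1 k J ps ts)
  then show ?case
    by (intro induced_tree.intros[of _ _ _ ps]) (auto simp: nth_append elim: list.rel_mono_strong)
qed

lemma induced_tree_shift: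
  "induced_tree \<pi> k P \<Longrightarrow> induced_tree (\<pi>' @ shift_preds (length \<pi>') \<pi>) (length \<pi>' + k) P"
proof (induction rule: induced_tree.induct)
  case (1 k J ps ts)
  have "list_all2 (induced_tree (\<pi>' @ shift_preds (length \<pi>') \<pi>)) (map ((+) (length \<pi>')) ps) ts"
    using 1(3) by (auto simp: list_all2_map1 elim: list.rel_mono_strong)
  then show ?case using 1(1,2)
    by (intro induced_tree.intros) (auto simp: nth_append shift_preds_def)
qed

text \<open>The positions \<open>ps\<close> of the roots have no successors yet.\<close>

definition linearises :: "qcbf \<Rightarrow> judgement_seq \<Rightarrow> nat list \<Rightarrow> judgement tree list \<Rightarrow> bool" where
  "linearises \<psi> \<pi> ps ts \<longleftrightarrow> is_proof \<psi> \<pi> \<and> distinct (concat (map snd \<pi>) @ ps)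
     \<and> (\<forall>p\<in>set ps. p < length \<pi>) \<and> list_all2 (induced_tree \<pi>) ps ts"

lemma linearises_Nil: "linearises \<psi> [] [] []"
  by (simp add: linearises_def is_proof_Nil)

lemma linearises_append:
  assumes l: "linearises \<psi> \<pi> ps ts" and l': "linearises \<psi> \<pi>' ps' ts'"
  defines "n \<equiv> length \<pi>"
  shows "linearises \<psi> (\<pi> @ shift_preds n \<pi>') (ps @ map ((+) n) ps') (ts @ ts')"
proof -
  let ?\<pi> = "\<pi> @ shift_preds n \<pi>'"
  have "list_all2 (induced_tree ?\<pi>) ps ts" "list_all2 (induced_tree ?\<pi>) (map ((+) n) ps') ts'"
    using l l' induced_tree_append induced_tree_shift
    by (auto simp: linearises_def n_def list_all2_map1 elim!: list.rel_mono_strong)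
  then have "list_all2 (induced_tree ?\<pi>) (ps @ map ((+) n) ps') (ts @ ts')"
    by (rule list_all2_appendI)
  moreover have "distinct (concat (map snd ?\<pi>) @ ps @ map ((+) n) ps')"
  proof -
    let ?used = "concat (map snd \<pi>) @ ps" and ?used' = "concat (map snd \<pi>') @ ps'"
    have "\<forall>p\<in>set ?used. p < n"
      using l is_proof_preds_less[of \<psi> \<pi>] by (auto simp: linearises_def n_def simp del: set_concat)
    then have "set ?used \<inter> set (map ((+) n) ?used') = {}"
      unfolding set_map by (auto simp del: set_concat set_append)
    moreover have "distinct ?used" "distinct (map ((+) n) ?used')"
      using l l' by (auto simp: linearises_def distinct_map)
    ultimately have "distinct (?used @ map ((+) n) ?used')" by (simp only: distinct_append)
    moreover have "concat (map snd (shift_preds n \<pi>')) = map ((+) n) (concat (map snd \<pi>'))"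
      by (simp add: shift_preds_def map_concat o_def case_prod_beta)
    ultimately show ?thesis by (auto simp del: set_concat)
  qed
  ultimately show ?thesis
    using l l' is_proof_append_shift[of \<psi> \<pi> \<pi>'] unfolding linearises_def n_def
    by (auto simp: shift_preds_def)
qed

lemma linearises_Node:
  assumes l: "linearises \<psi> \<pi> ps ts" and J: "is_judgement \<psi> J" "derived \<psi> J (map root ts)"
  shows "linearises \<psi> (\<pi> @ [(J, ps)]) [length \<pi>] [Node J ts]"
proof -
  have ps: "\<forall>p\<in>set ps. p < length \<pi>" and ts: "list_all2 (induced_tree \<pi>) ps ts"
    and \<pi>: "is_proof \<psi> \<pi>"
    using l by (simp_all add: linearises_def)
  have "map root ts = map (\<lambda>p. fst (\<pi> ! p)) ps"
    using ts induced_tree_derivation[OF \<pi>] by (induction ps ts rule: list_all2_induct) auto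
  then have "is_proof \<psi> (\<pi> @ [(J, ps)])" using \<pi> J ps by (simp add: is_proof_snoc)
  moreover have "length \<pi> \<notin> set (concat (map snd \<pi>) @ ps)"
    using is_proof_preds_less[OF \<pi>] ps by (auto simp del: set_concat)
  moreover have "list_all2 (induced_tree (\<pi> @ [(J, ps)])) ps ts"
    using ts by (auto elim!: list.rel_mono_strong intro: induced_tree_append)
  then have "induced_tree (\<pi> @ [(J, ps)]) (length \<pi>) (Node J ts)"
    by (intro induced_tree.intros) auto
  ultimately show ?thesis using l by (simp add: linearises_def)
qed

lemma derivation_linearises: "derivation \<psi> P \<Longrightarrow> \<exists>\<pi> k. linearises \<psi> \<pi> [k] [P]"
proof (induction P)
  case (Node J ts)
  have "\<exists>\<pi> ps. linearises \<psi> \<pi> ps us" if "set us \<subseteq> set ts" for us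
    using that
  proof (induction us)
    case Nil
    then show ?case using linearises_Nil by blast
  next
    case (Cons u us)
    then obtain \<pi> ps where "linearises \<psi> \<pi> ps us" by auto
    moreover obtain \<pi>' k where "linearises \<psi> \<pi>' [k] [u]"
      using Node.IH[of u] Node.prems Cons.prems by auto
    ultimately show ?case using linearises_append[of \<psi> \<pi>' "[k]" "[u]"] by fastforce
  qed
  then obtain \<pi> ps where "linearises \<psi> \<pi> ps ts" by blast
  then show ?case using linearises_Node Node.prems by fastforce
qed

lemma tree_like_empty_clause_proof_iff:
  "tree_like_empty_clause_proof \<psi> P \<longleftrightarrow> derivation \<psi> P \<and> snd (root P) = {}"
proof
  assume "tree_like_empty_clause_proof \<psi> P"
  then show "derivation \<psi> P \<and> snd (root P) = {}"
    unfolding tree_like_empty_clause_proof_def using induced_tree_derivation by fastforce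
next
  assume P: "derivation \<psi> P \<and> snd (root P) = {}"
  then obtain \<pi> k where "linearises \<psi> \<pi> [k] [P]" using derivation_linearises by blast
  then have \<pi>: "is_proof \<psi> \<pi>" "tree_like \<pi>" "k < length \<pi>" "induced_tree \<pi> k P"
    by (auto simp: linearises_def tree_like_def card_successors_le_1[simplified])
  obtain i \<alpha> ps where k: "\<pi> ! k = ((i, \<alpha>), ps)" by (metis surj_pair)
  have "\<alpha> = {}" using induced_tree_derivation[OF \<pi>(1,4)] k P by simp
  then show "tree_like_empty_clause_proof \<psi> P"
    unfolding tree_like_empty_clause_proof_def using \<pi> k by blast
qed

section \<open>Located variables\<close>

lemma sub_at_append:
  "sub_at \<psi> (i @ j) = (case sub_at \<psi> i of None \<Rightarrow> None | Some \<phi> \<Rightarrow> sub_at \<phi> j)"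
  by (induction \<psi> i rule: sub_at.induct) auto

lemma indices_prefix: "prefix i j \<Longrightarrow> j \<in> indices \<psi> \<Longrightarrow> i \<in> indices \<psi>"
  by (auto simp: indices_def prefix_def sub_at_append split: option.splits)

lemma Nil_in_indices: "[] \<in> indices \<psi>"
  by (auto simp: indices_def)

lemma length_index_le_size: "i \<in> indices \<psi> \<Longrightarrow> length i \<le> size \<psi>"
  unfolding indices_def dom_def mem_Collect_eq
proof (induction \<psi> i rule: sub_at.induct)
  case (2 \<psi> k i)
  then have "k < length (children \<psi>)" "length i \<le> size (children \<psi> ! k)"
    by (auto split: if_splits)
  then show ?case by (cases \<psi>) (auto simp: less_Suc_eq)
qed simp

lemma located_var_iff:
  "located_var \<psi> (k, u) \<longleftrightarrow> (\<exists>\<phi>. sub_at \<psi> k = Some (All u \<phi>) \<or> sub_at \<psi> k = Some (Exi u \<phi>))"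
  by (auto simp: located_var_def forall_located_def)

lemma located_var_index: "located_var \<psi> (k, u) \<Longrightarrow> k \<in> indices \<psi>"
  by (auto simp: located_var_iff indices_def)

lemma located_var_unique: "located_var \<psi> (k, u) \<Longrightarrow> located_var \<psi> (k, v) \<Longrightarrow> u = v"
  by (auto simp: located_var_iff)

lemma located_var_child:
  assumes "located_var \<psi> (k, u)"
  shows "k @ [0] \<in> indices \<psi>" "free_at \<psi> k = free_at \<psi> (k @ [0]) - {u}"
  using assms by (auto simp: located_var_iff indices_def sub_at_append free_at_def)

lemma strict_prefix_located_iff:
  assumes "located_var \<psi> (k, u)" "j \<in> indices \<psi>"
  shows "strict_prefix k j \<longleftrightarrow> prefix (k @ [0]) j"
proof
  assume "strict_prefix k j"
  then obtain c r where j: "j = k @ c # r" by (metis strict_prefixE')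
  have "c = 0"
    using assms by (auto simp: j located_var_iff indices_def sub_at_append split: if_splits)
  then show "prefix (k @ [0]) j" by (simp add: j)
next
  assume "prefix (k @ [0]) j"
  then show "strict_prefix k j" by (auto simp: prefix_def strict_prefix_def)
qed

lemma follows_located_iff:
  assumes "located_var \<psi> (k, u)"
  shows "follows \<psi> j (k, u) \<longleftrightarrow> j \<in> indices \<psi> \<and> prefix (k @ [0]) j
    \<and> (\<forall>m. prefix (k @ [0]) m \<and> prefix m j \<longrightarrow> u \<in> free_at \<psi> m)"
  unfolding follows_def
  using strict_prefix_located_iff[OF assms] indices_prefix by auto

lemma follows_free: "follows \<psi> i (k, u) \<Longrightarrow> u \<in> free_at \<psi> i"
  by (auto simp: follows_def)

lemma follows_strict_prefix: "follows \<psi> i l \<Longrightarrow> strict_prefix (fst l) i"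
  by (auto simp: follows_def split: prod.splits)

lemma follows_prefix:
  assumes "follows \<psi> i l" "strict_prefix (fst l) j" "prefix j i"
  shows "follows \<psi> j l"
  using assms indices_prefix[of j i \<psi>] by (auto simp: follows_def split: prod.splits)

lemma follows_snoc:
  assumes "follows \<psi> i (k, u) \<or> i = k" "i @ [c] \<in> indices \<psi>" "u \<in> free_at \<psi> (i @ [c])"
  shows "follows \<psi> (i @ [c]) (k, u)"
proof -
  have "prefix k i" using assms(1) by (auto simp: follows_def)
  then have "strict_prefix k (i @ [c])" by (auto simp: prefix_def strict_prefix_def)
  moreover have "u \<in> free_at \<psi> m" if "strict_prefix k m" "prefix m (i @ [c])" for m
    using assms(1,3) that by (auto simp: follows_def prefix_snoc)
  ultimately show ?thesis using assms(2) by (simp add: follows_def)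
qed

lemma located_not_follows: "located_var \<psi> (k', u) \<Longrightarrow> \<not> follows \<psi> k' (k, u)"
  using follows_free located_var_child(2) by fastforce

lemma follows_comparable:
  assumes "follows \<psi> i l" "follows \<psi> i m" "located_var \<psi> l" "located_var \<psi> m" "l \<noteq> m"
  shows "follows \<psi> (fst l) m \<or> follows \<psi> (fst m) l"
proof -
  have p: "prefix (fst l) i" "prefix (fst m) i"
    using assms(1,2)[THEN follows_strict_prefix] by simp_all
  have "fst l \<noteq> fst m" using assms(3-5) located_var_unique by (metis prod.collapse)
  then have "strict_prefix (fst l) (fst m) \<or> strict_prefix (fst m) (fst l)"
    using p prefix_same_cases strict_prefixI by metis
  then show ?thesis using follows_prefix assms(1,2) p by blast
qed

definition coherent_located :: "qcbf \<Rightarrow> located set \<Rightarrow> bool" where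
  "coherent_located \<psi> S \<longleftrightarrow> (\<forall>l\<in>S. located_var \<psi> l) \<and> coherent \<psi> S"

lemma coherent_located_if_follows_set:
  assumes "\<And>l. l \<in> S \<Longrightarrow> located_var \<psi> l" "follows_set \<psi> i S"
  shows "coherent_located \<psi> S"
  using assms follows_comparable[of \<psi> i]
  unfolding coherent_located_def coherent_def follows_set_def by blast

lemma coherent_located_subset: "coherent_located \<psi> T \<Longrightarrow> S \<subseteq> T \<Longrightarrow> coherent_located \<psi> S"
  unfolding coherent_located_def coherent_def by blast

section \<open>Binders\<close>

definition binder_of :: "qcbf \<Rightarrow> index \<Rightarrow> nat \<Rightarrow> index" where
  "binder_of \<psi> i u = last (filter (\<lambda>k. k \<noteq> i \<and> located_var \<psi> (k, u)) (prefixes i))"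

lemma ex_binder:
  assumes "free \<psi> = {}" "i \<in> indices \<psi>" "u \<in> free_at \<psi> i"
  shows "\<exists>k. located_var \<psi> (k, u) \<and> follows \<psi> i (k, u)"
  using assms(2,3)
proof (induction i rule: rev_induct)
  case Nil
  then show ?case using assms(1) by (simp add: free_at_def)
next
  case (snoc c i)
  have i: "i \<in> indices \<psi>" using snoc.prems(1) by (rule indices_prefix[rotated]) simp
  then obtain \<phi> where \<phi>: "sub_at \<psi> i = Some \<phi>" by (auto simp: indices_def)
  show ?case
  proof (cases "located_var \<psi> (i, u)")
    case True
    then show ?thesis using follows_snoc snoc.prems by blast
  next
    case False
    have "c < length (children \<phi>)" "u \<in> free (children \<phi> ! c)"
      using snoc.prems \<phi> by (auto simp: indices_def sub_at_append free_at_def split: if_splits)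
    then have "u \<in> free_at \<psi> i"
      using False \<phi> by (cases \<phi>) (auto simp: free_at_def located_var_iff less_Suc_eq)
    then obtain k where "located_var \<psi> (k, u)" "follows \<psi> i (k, u)" using snoc.IH i by blast
    then show ?thesis using follows_snoc snoc.prems by blast
  qed
qed

lemma binder_of_eqI:
  assumes "located_var \<psi> (k, u)" "follows \<psi> i (k, u)"
  shows "binder_of \<psi> i u = k"
proof -
  let ?P = "\<lambda>k. k \<noteq> i \<and> located_var \<psi> (k, u)"
  obtain c r where i: "i = k @ c # r"
    using follows_strict_prefix[OF assms(2)] by (auto elim: strict_prefixE')
  have "\<not> ?P (k @ c # j)" if "prefix j r" for j
  proof -
    have "follows \<psi> (k @ c # j) (k, u)"
      using that by (intro follows_prefix[OF assms(2)]) (auto simp: i strict_prefix_def)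
    then show ?thesis using located_not_follows by blast
  qed
  then have "filter ?P (map ((@) k) (tl (prefixes (c # r)))) = []"
    by (auto simp: filter_empty_conv)
  moreover have "prefixes i = prefixes k @ map ((@) k) (tl (prefixes (c # r)))"
    unfolding i by (rule prefixes_append)
  moreover obtain js where "prefixes k = js @ [k]"
    by (metis append_butlast_last_id last_prefixes prefixes_not_Nil)
  ultimately show ?thesis using assms(1) i unfolding binder_of_def by simp
qed

lemma binder_of_props:
  assumes "free \<psi> = {}" "i \<in> indices \<psi>" "u \<in> free_at \<psi> i"
  shows "located_var \<psi> (binder_of \<psi> i u, u)" "follows \<psi> i (binder_of \<psi> i u, u)"
  using ex_binder[OF assms] binder_of_eqI by metis+

lemma binder_of_parent:
  assumes "free \<psi> = {}" "is_parent \<psi> i j" "u \<in> free_at \<psi> i" "u \<in> free_at \<psi> j"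
  shows "binder_of \<psi> i u = binder_of \<psi> j u"
proof -
  obtain c where j: "j = i @ [c]" "j \<in> indices \<psi>" using assms(2) by (auto simp: is_parent_def)
  then have "i \<in> indices \<psi>" using indices_prefix[of i j] by simp
  then have "located_var \<psi> (binder_of \<psi> i u, u)" "follows \<psi> i (binder_of \<psi> i u, u)"
    using binder_of_props assms(1,3) by auto
  then show ?thesis using follows_snoc j assms(4) binder_of_eqI by metis
qed

section \<open>Anchors\<close>

text \<open>The indices that can follow a coherent set lie below its anchor, the child of its innermost
  quantifier.\<close>

definition anchors :: "located set \<Rightarrow> index set" where
  "anchors S = insert [] ((\<lambda>l. fst l @ [0]) ` S)"

definition anchor :: "located set \<Rightarrow> index" where
  "anchor S = (ARG_MAX length k. k \<in> anchors S)"

lemma anchors_indices: "coherent_located \<psi> S \<Longrightarrow> k \<in> anchors S \<Longrightarrow> k \<in> indices \<psi>"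
  using located_var_child(1) Nil_in_indices by (auto simp: anchors_def coherent_located_def)

lemma anchors_chain:
  assumes S: "coherent_located \<psi> S" and "i \<in> anchors S" "j \<in> anchors S"
  shows "prefix i j \<or> prefix j i"
proof -
  have below: "prefix (fst l @ [0]) (fst m @ [0])" if "follows \<psi> (fst m) l" "l \<in> S" for l m
  proof -
    have "prefix (fst l @ [0]) (fst m)"
      using that S follows_located_iff[of \<psi> "fst l" "snd l"] by (simp add: coherent_located_def)
    then show ?thesis by (simp add: prefix_snoc)
  qed
  show ?thesis
  proof (cases "i = [] \<or> j = []")
    case False
    then obtain l m where "l \<in> S" "m \<in> S" and ij: "i = fst l @ [0]" "j = fst m @ [0]"
      using assms(2,3) by (auto simp: anchors_def)
    then have "l = m \<or> follows \<psi> (fst l) m \<or> follows \<psi> (fst m) l"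
      using S unfolding coherent_located_def coherent_def by blast
    then show ?thesis using below \<open>l \<in> S\<close> \<open>m \<in> S\<close> unfolding ij by blast
  qed auto
qed

lemma anchor_greatest:
  assumes "coherent_located \<psi> S"
  shows "anchor S \<in> anchors S" "k \<in> anchors S \<Longrightarrow> prefix k (anchor S)"
proof -
  have "length k < Suc (size \<psi>)" if "k \<in> anchors S" for k
    using length_index_le_size anchors_indices[OF assms that] by (simp add: less_Suc_eq_le)
  moreover have "[] \<in> anchors S" by (simp add: anchors_def)
  ultimately have *: "anchor S \<in> anchors S \<and> (\<forall>k. k \<in> anchors S \<longrightarrow> length k \<le> length (anchor S))"
    unfolding anchor_def by (intro arg_max_nat_lemma) auto
  then show "anchor S \<in> anchors S" by blast
  assume k: "k \<in> anchors S"
  then have "length k \<le> length (anchor S)" using * by blast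
  then show "prefix k (anchor S)"
    using anchors_chain[OF assms k] * prefix_length_prefix by blast
qed

lemma anchor_eqI:
  assumes "coherent_located \<psi> S" "k \<in> anchors S" "\<And>k'. k' \<in> anchors S \<Longrightarrow> prefix k' k"
  shows "anchor S = k"
  using assms anchor_greatest[OF assms(1)] by (meson prefix_order.antisym)

lemma anchor_index: "coherent_located \<psi> S \<Longrightarrow> anchor S \<in> indices \<psi>"
  using anchors_indices anchor_greatest(1) by blast

lemma anchor_empty: "anchor {} = []"
  by (rule anchor_eqI) (auto simp: anchors_def coherent_located_def coherent_def)

lemma anchor_mono:
  assumes "coherent_located \<psi> T" "S \<subseteq> T"
  shows "prefix (anchor S) (anchor T)"
proof -
  have "anchor S \<in> anchors S" using coherent_located_subset[OF assms] by (rule anchor_greatest)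
  then have "anchor S \<in> anchors T" using assms(2) by (auto simp: anchors_def)
  then show ?thesis using assms(1) by (rule anchor_greatest[rotated])
qed

lemma anchor_insert:
  assumes S: "coherent_located \<psi> (insert l S)"
  shows "anchor (insert l S) = (if prefix (anchor S) (fst l @ [0]) then fst l @ [0] else anchor S)"
proof (rule anchor_eqI[OF S])
  have S': "coherent_located \<psi> S" using S by (rule coherent_located_subset) blast
  have anchors: "anchors (insert l S) = insert (fst l @ [0]) (anchors S)"
    by (auto simp: anchors_def)
  note greatest = anchor_greatest[OF S']
  show "(if prefix (anchor S) (fst l @ [0]) then fst l @ [0] else anchor S) \<in> anchors (insert l S)"
    using greatest(1) by (simp add: anchors)
  have "prefix (anchor S) (fst l @ [0]) \<or> prefix (fst l @ [0]) (anchor S)"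
    using anchors_chain[OF S] greatest(1) unfolding anchors by blast
  then show "prefix k (if prefix (anchor S) (fst l @ [0]) then fst l @ [0] else anchor S)"
    if "k \<in> anchors (insert l S)" for k
    using that greatest(2)[of k] prefix_order.trans[of k "anchor S"] by (auto simp: anchors)
qed

lemma anchor_prefix:
  assumes "coherent_located \<psi> S" "follows_set \<psi> i S"
  shows "prefix (anchor S) i"
proof -
  have "prefix k i" if "k \<in> anchors S" for k
    using that assms follows_located_iff
    by (fastforce simp: anchors_def coherent_located_def follows_set_def)
  then show ?thesis using anchor_greatest(1)[OF assms(1)] by blast
qed

lemma free_at_below_anchor:
  assumes S: "coherent_located \<psi> S" and i: "follows_set \<psi> i S"
    and k: "prefix (anchor S) k" "prefix k i"
  shows "lvars S \<subseteq> free_at \<psi> k"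
proof -
  have "snd l \<in> free_at \<psi> k" if l: "l \<in> S" for l
  proof -
    have "fst l @ [0] \<in> anchors S" using l by (simp add: anchors_def)
    then have "prefix (fst l @ [0]) k"
      using anchor_greatest(2)[OF S] k(1) prefix_order.trans by blast
    moreover have "located_var \<psi> (fst l, snd l)" "follows \<psi> i (fst l, snd l)"
      using S i l by (simp_all add: coherent_located_def follows_set_def)
    ultimately show ?thesis using follows_located_iff k(2) by blast
  qed
  then show ?thesis by (auto simp: lvars_def)
qed

lemma follows_anchor:
  assumes T: "coherent_located \<psi> T" and l: "l \<in> T"
    and free: "fst l @ [0] = anchor T \<Longrightarrow> snd l \<in> free_at \<psi> (anchor T)"
  shows "follows \<psi> (anchor T) l"
proof -
  have below: "prefix (fst l @ [0]) (anchor T)"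
    using l by (intro anchor_greatest(2)[OF T]) (simp add: anchors_def)
  moreover have "anchor T \<in> anchors T" using T by (rule anchor_greatest)
  ultimately obtain m where m: "m \<in> T" "anchor T = fst m @ [0]"
    by (auto simp: anchors_def)
  have child: "fst m @ [0] \<in> indices \<psi>" using anchor_index[OF T] m(2) by simp
  show ?thesis
  proof (cases "l = m")
    case True
    then show ?thesis
      using follows_snoc[of \<psi> "fst m" "fst l" "snd l", OF _ child] free m(2) by simp
  next
    case False
    have "\<not> follows \<psi> (fst l) m"
      using below m(2) prefix_length_less[OF follows_strict_prefix] prefix_length_le by fastforce
    then have "follows \<psi> (fst m) (fst l, snd l)"
      using False T l m(1) by (auto simp: coherent_located_def coherent_def)
    moreover have "located_var \<psi> (fst m, snd m)" using T m(1) by (simp add: coherent_located_def)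
    then have "snd l \<in> free_at \<psi> (fst m @ [0])"
      using follows_free[OF calculation] located_var_child(2) by blast
    ultimately show ?thesis
      using follows_snoc[of \<psi> "fst m" "fst l" "snd l", OF _ child] m(2) by simp
  qed
qed

lemma follows_set_anchor:
  assumes T: "coherent_located \<psi> T" and S: "S \<subseteq> T" and free: "lvars S \<subseteq> free_at \<psi> (anchor S)"
  shows "follows_set \<psi> (anchor T) S"
proof -
  have "follows \<psi> (anchor T) l" if l: "l \<in> S" for l
  proof (rule follows_anchor[OF T])
    show "l \<in> T" using l S by blast
    assume eq: "fst l @ [0] = anchor T"
    have "prefix (fst l @ [0]) (anchor S)"
      using l coherent_located_subset[OF T S]
      by (intro anchor_greatest(2)) (simp_all add: anchors_def)
    then have "anchor S = anchor T"
      using anchor_mono[OF T S] unfolding eq by (rule prefix_order.antisym[rotated])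
    then show "snd l \<in> free_at \<psi> (anchor T)" using free l by (auto simp: lvars_def)
  qed
  then show ?thesis using anchor_index[OF T] by (simp add: follows_set_def)
qed

section \<open>Clauses and assignments\<close>

definition falsifier :: "lit set \<Rightarrow> assignment" where
  "falsifier \<alpha> = (\<lambda>u. if Pos u \<in> \<alpha> then Some False else if Neg u \<in> \<alpha> then Some True else None)"

definition falsified_clause :: "assignment \<Rightarrow> lit set" where
  "falsified_clause a = {L. lit_false a L}"

lemma in_cvars_iff: "u \<in> cvars \<alpha> \<longleftrightarrow> Pos u \<in> \<alpha> \<or> Neg u \<in> \<alpha>"
  unfolding cvars_def image_iff by (metis lit.exhaust var_of.simps)

lemma is_clause_iff: "is_clause \<alpha> \<longleftrightarrow> finite \<alpha> \<and> (\<forall>u. Pos u \<in> \<alpha> \<longrightarrow> Neg u \<notin> \<alpha>)"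
proof -
  have "inj_on var_of \<alpha> \<longleftrightarrow> (\<forall>u. Pos u \<in> \<alpha> \<longrightarrow> Neg u \<notin> \<alpha>)"
    unfolding inj_on_def by (metis lit.distinct(1) lit.exhaust var_of.simps)
  then show ?thesis by (simp add: is_clause_def)
qed

lemma cvars_simps [simp]:
  "cvars {} = {}" "cvars (insert L \<alpha>) = insert (var_of L) (cvars \<alpha>)"
  "cvars (\<alpha> \<union> \<beta>) = cvars \<alpha> \<union> cvars \<beta>" "cvars (\<alpha> - {Pos y, Neg y}) = cvars \<alpha> - {y}"
  by (cases L; auto simp: in_cvars_iff)+

lemma is_clause_subset: "is_clause \<alpha> \<Longrightarrow> \<beta> \<subseteq> \<alpha> \<Longrightarrow> is_clause \<beta>"
  by (auto simp: is_clause_iff intro: finite_subset)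

lemma dom_falsifier: "dom (falsifier \<alpha>) = cvars \<alpha>"
  by (auto simp: falsifier_def in_cvars_iff dom_def)

lemma lit_false_falsifier_iff: "is_clause \<alpha> \<Longrightarrow> lit_false (falsifier \<alpha>) L \<longleftrightarrow> L \<in> \<alpha>"
  by (cases L) (auto simp: falsifier_def is_clause_iff)

lemma falsified_clause_falsifier: "is_clause \<alpha> \<Longrightarrow> falsified_clause (falsifier \<alpha>) = \<alpha>"
  by (simp add: falsified_clause_def lit_false_falsifier_iff)

lemma falsifier_falsified_clause: "falsifier (falsified_clause a) = a"
proof
  show "falsifier (falsified_clause a) u = a u" for u
    by (cases "a u") (auto simp: falsifier_def falsified_clause_def)
qed

lemma cvars_falsified_clause: "cvars (falsified_clause a) = dom a"
  using dom_falsifier[of "falsified_clause a"] by (simp add: falsifier_falsified_clause)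

lemma falsified_falsifier: "is_clause \<alpha> \<Longrightarrow> falsified \<alpha> (falsifier \<alpha>)"
  by (simp add: falsified_def dom_falsifier lit_false_falsifier_iff)

lemma eq_falsified_clause_if_falsified:
  assumes "falsified \<alpha> a" "cvars \<alpha> = dom a"
  shows "\<alpha> = falsified_clause a"
proof
  show "\<alpha> \<subseteq> falsified_clause a"
    using assms(1) by (auto simp: falsified_def falsified_clause_def)
  show "falsified_clause a \<subseteq> \<alpha>"
  proof
    fix L assume L: "L \<in> falsified_clause a"
    then have "var_of L \<in> cvars \<alpha>"
      using assms(2) cvars_falsified_clause by (metis cvars_def imageI)
    then obtain M where M: "M \<in> \<alpha>" "var_of M = var_of L" by (auto simp: cvars_def)
    then have "lit_false a M" using assms(1) by (auto simp: falsified_def)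
    then have "M = L" using L M(2) by (cases L; cases M) (auto simp: falsified_clause_def)
    then show "L \<in> \<alpha>" using M by simp
  qed
qed

lemma falsifier_restrict:
  assumes "is_clause \<gamma>" "\<delta> \<subseteq> \<gamma>"
  shows "falsifier \<gamma> |` cvars \<delta> = falsifier \<delta>"
proof
  show "(falsifier \<gamma> |` cvars \<delta>) u = falsifier \<delta> u" for u
    using assms by (auto simp: restrict_map_def falsifier_def in_cvars_iff is_clause_iff)
qed

lemma falsifier_insert:
  assumes "u \<notin> cvars \<delta>"
  shows "falsifier (insert (Pos u) \<delta>) = (falsifier \<delta>)(u \<mapsto> False)"
    and "falsifier (insert (Neg u) \<delta>) = (falsifier \<delta>)(u \<mapsto> True)"
  using assms by (auto simp: falsifier_def in_cvars_iff fun_eq_iff)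

lemma falsified_clause_update:
  assumes "u \<notin> dom a"
  shows "falsified_clause (a(u \<mapsto> False)) = insert (Pos u) (falsified_clause a)"
    and "falsified_clause (a(u \<mapsto> True)) = insert (Neg u) (falsified_clause a)"
proof -
  have "lit_false (a(u \<mapsto> False)) M \<longleftrightarrow> M = Pos u \<or> lit_false a M"
    "lit_false (a(u \<mapsto> True)) M \<longleftrightarrow> M = Neg u \<or> lit_false a M" for M
    using assms by (cases M; auto)+
  then show "falsified_clause (a(u \<mapsto> False)) = insert (Pos u) (falsified_clause a)"
    "falsified_clause (a(u \<mapsto> True)) = insert (Neg u) (falsified_clause a)"
    by (auto simp: falsified_clause_def)
qed

lemma falsified_clause_restrict:
  "falsified_clause (a |` X) = {L \<in> falsified_clause a. var_of L \<in> X}"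
proof -
  have "lit_false (a |` X) M \<longleftrightarrow> lit_false a M \<and> var_of M \<in> X" for M
    by (cases M) (auto simp: restrict_map_def)
  then show ?thesis by (simp add: falsified_clause_def)
qed

section \<open>From proofs to traces\<close>

definition adjacent :: "qcbf \<Rightarrow> index \<Rightarrow> index \<Rightarrow> bool" where
  "adjacent \<psi> i j \<longleftrightarrow> is_parent \<psi> i j \<or> is_parent \<psi> j i"

lemma flow_iff:
  "upward_flow \<psi> J Js \<or> downward_flow \<psi> J Js \<longleftrightarrow>
    (\<exists>i j \<alpha>. J = (i, \<alpha>) \<and> Js = [(j, \<alpha>)] \<and> adjacent \<psi> i j)"
  by (auto simp: upward_flow_def downward_flow_def adjacent_def)

lemma resolve_ruleE:
  assumes "resolve_rule \<psi> J Js" "\<forall>K\<in>set Js. is_judgement \<psi> K"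
  obtains i u \<alpha> \<beta> where "J = (i, \<alpha> \<union> \<beta>)" "u \<notin> cvars (\<alpha> \<union> \<beta>)"
    and "Js = [(i, insert (Pos u) \<alpha>), (i, insert (Neg u) \<beta>)]
      \<or> Js = [(i, insert (Neg u) \<beta>), (i, insert (Pos u) \<alpha>)]"
proof -
  obtain i \<alpha>' \<beta>' L where J: "Js = [(i, \<alpha>'), (i, \<beta>')]" "J = (i, (\<alpha>' - {L}) \<union> (\<beta>' - {compl L}))"
    and L: "L \<in> \<alpha>'" "compl L \<in> \<beta>'"
    using assms(1) by (auto simp: resolve_rule_def resolvent_def)
  have "is_clause \<alpha>'" "is_clause \<beta>'" using assms(2) by (auto simp: J(1) is_judgement_def)
  then have fresh: "var_of L \<notin> cvars ((\<alpha>' - {L}) \<union> (\<beta>' - {compl L}))"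
    using L by (cases L) (auto simp: in_cvars_iff is_clause_iff)
  have "insert L (\<alpha>' - {L}) = \<alpha>'" "insert (compl L) (\<beta>' - {compl L}) = \<beta>'"
    using L by auto
  then show thesis
    using that[of i "\<alpha>' - {L}" "\<beta>' - {compl L}" "var_of L"]
      that[of i "\<beta>' - {compl L}" "\<alpha>' - {L}" "var_of L"] J fresh
    by (cases L) (auto simp: Un_commute)
qed

lemma derived_cases [consumes 2, case_names clause flow forall_removal resolve]:
  assumes "derived \<psi> J Js" "\<forall>K\<in>set Js. is_judgement \<psi> K"
  obtains i \<alpha> where "J = (i, \<alpha>)" "Js = []" "sub_at \<psi> i = Some (Clause \<alpha>)"
  | i j \<alpha> where "J = (i, \<alpha>)" "Js = [(j, \<alpha>)]" "adjacent \<psi> i j"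
  | i y j \<alpha> where "J = (i, \<alpha> - {Pos y, Neg y})" "Js = [(j, \<alpha>)]" "is_parent \<psi> i j"
      "forall_located \<psi> (i, y)" "y \<in> cvars \<alpha>"
  | i u \<alpha> \<beta> where "J = (i, \<alpha> \<union> \<beta>)" "u \<notin> cvars (\<alpha> \<union> \<beta>)"
      "Js = [(i, insert (Pos u) \<alpha>), (i, insert (Neg u) \<beta>)]
        \<or> Js = [(i, insert (Neg u) \<beta>), (i, insert (Pos u) \<alpha>)]"
proof -
  consider (clause) "clause_rule \<psi> J Js" | (resolve) "resolve_rule \<psi> J Js"
    | (flow) "upward_flow \<psi> J Js \<or> downward_flow \<psi> J Js"
    | (forall_removal) "forall_removal \<psi> J Js"
    using assms(1) unfolding derived_def by blast
  then show thesis
  proof cases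
    case clause
    then show ?thesis using that(1) by (auto simp: clause_rule_def)
  next
    case resolve
    then show ?thesis using assms(2) that(4) by (rule resolve_ruleE)
  next
    case flow
    then show ?thesis using that(2) by (auto simp: flow_iff)
  next
    case forall_removal
    then obtain i j y \<alpha> \<phi> where J: "J = (i, \<alpha> - {Pos y, Neg y})" "Js = [(j, \<alpha>)]" "is_parent \<psi> i j"
      "sub_at \<psi> i = Some (All y \<phi>)"
      by (auto simp: forall_removal_def)
    show ?thesis
    proof (cases "y \<in> cvars \<alpha>")
      case True
      then show ?thesis using that(3)[OF J(1-3)] J(4) by (simp add: forall_located_def)
    next
      case False
      then have "J = (i, \<alpha>)" using J(1) by (simp add: in_cvars_iff)
      then show ?thesis using that(2) J(2,3) by (simp add: adjacent_def)
    qed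
  qed
qed

definition derives :: "qcbf \<Rightarrow> judgement tree \<Rightarrow> judgement \<Rightarrow> nat \<Rightarrow> bool" where
  "derives \<psi> P J n \<longleftrightarrow> derivation \<psi> P \<and> root P = J \<and> num_nonflow \<psi> P = n"

lemma derives_judgement: "derives \<psi> P J n \<Longrightarrow> is_judgement \<psi> J"
  using derivation_root by (auto simp: derives_def)

definition traces :: "qcbf \<Rightarrow> label tree \<Rightarrow> label \<Rightarrow> nat \<Rightarrow> bool" where
  "traces \<psi> T L n \<longleftrightarrow> is_trace \<psi> T \<and> root T = L \<and> num_nodes T = n"

lemma traces_leaf: "trace_label \<psi> L \<Longrightarrow> leaf_node \<psi> L \<Longrightarrow> traces \<psi> (Node L []) L 1"
  by (simp add: traces_def)

lemma traces_unary:
  "trace_label \<psi> L \<Longrightarrow> unary_node \<psi> L L' \<Longrightarrow> traces \<psi> T L' n \<Longrightarrow> traces \<psi> (Node L [T]) L (1 + n)"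
  by (simp add: traces_def)

lemma traces_binary:
  "trace_label \<psi> L \<Longrightarrow> binary_node \<psi> L L0 L1 \<Longrightarrow> traces \<psi> T0 L0 m \<Longrightarrow> traces \<psi> T1 L1 n
    \<Longrightarrow> traces \<psi> (Node L [T0, T1]) L (1 + (m + n))"
  by (simp add: traces_def)

definition binders :: "qcbf \<Rightarrow> index \<Rightarrow> nat set \<Rightarrow> located set" where
  "binders \<psi> i X = (\<lambda>u. (binder_of \<psi> i u, u)) ` X"

fun label :: "qcbf \<Rightarrow> judgement \<Rightarrow> label" where
  "label \<psi> (i, \<alpha>) = (binders \<psi> i (cvars \<alpha>), falsifier \<alpha>)"

lemma lvars_binders [simp]: "lvars (binders \<psi> i X) = X"
  by (force simp: lvars_def binders_def)

context
  fixes \<psi> :: qcbf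
  assumes closed: "free \<psi> = {}"
begin

lemma binders_located:
  "i \<in> indices \<psi> \<Longrightarrow> X \<subseteq> free_at \<psi> i \<Longrightarrow> l \<in> binders \<psi> i X \<Longrightarrow> located_var \<psi> l"
  using binder_of_props(1)[OF closed] by (auto simp: binders_def)

lemma follows_set_binders:
  "i \<in> indices \<psi> \<Longrightarrow> X \<subseteq> free_at \<psi> i \<Longrightarrow> follows_set \<psi> i (binders \<psi> i X)"
  using binder_of_props(2)[OF closed] by (auto simp: binders_def follows_set_def)

lemma coherent_located_binders:
  "i \<in> indices \<psi> \<Longrightarrow> X \<subseteq> free_at \<psi> i \<Longrightarrow> coherent_located \<psi> (binders \<psi> i X)"
  using binders_located follows_set_binders by (rule coherent_located_if_follows_set)

lemma binders_adjacent:
  assumes "adjacent \<psi> i j" "X \<subseteq> free_at \<psi> i" "X \<subseteq> free_at \<psi> j"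
  shows "binders \<psi> i X = binders \<psi> j X"
  unfolding binders_def
proof (rule image_cong[OF refl])
  fix u assume "u \<in> X"
  then show "(binder_of \<psi> i u, u) = (binder_of \<psi> j u, u)"
    using binder_of_parent[OF closed] assms unfolding adjacent_def by (metis subsetD)
qed

lemma trace_label_label: "is_judgement \<psi> J \<Longrightarrow> trace_label \<psi> (label \<psi> J)"
  using coherent_located_binders
  by (cases J) (auto simp: trace_label_def is_judgement_def dom_falsifier coherent_located_def)

lemma label_flow:
  "adjacent \<psi> i j \<Longrightarrow> is_judgement \<psi> (i, \<alpha>) \<Longrightarrow> is_judgement \<psi> (j, \<alpha>) \<Longrightarrow> label \<psi> (i, \<alpha>) = label \<psi> (j, \<alpha>)"
  using binders_adjacent by (simp add: is_judgement_def)

lemma leaf_node_label: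
  assumes "is_judgement \<psi> (i, \<alpha>)" "sub_at \<psi> i = Some (Clause \<alpha>)"
  shows "leaf_node \<psi> (label \<psi> (i, \<alpha>))"
  using assms follows_set_binders[of i "cvars \<alpha>"] falsified_falsifier[of \<alpha>]
  by (auto simp: leaf_node_def is_judgement_def)

lemma unary_node_label:
  assumes i: "is_judgement \<psi> (i, \<alpha> - {Pos y, Neg y})" and j: "is_judgement \<psi> (j, \<alpha>)"
    and parent: "is_parent \<psi> i j" and y: "forall_located \<psi> (i, y)" "y \<in> cvars \<alpha>"
  shows "unary_node \<psi> (label \<psi> (i, \<alpha> - {Pos y, Neg y})) (label \<psi> (j, \<alpha>))"
proof -
  let ?\<beta> = "\<alpha> - {Pos y, Neg y}"
  obtain c where c: "j = i @ [c]" "j \<in> indices \<psi>" using parent by (auto simp: is_parent_def)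
  have "y \<in> free_at \<psi> j" using j y(2) by (auto simp: is_judgement_def)
  then have "binder_of \<psi> j y = i"
    using y(1) c follows_snoc[of \<psi> i i y c] by (intro binder_of_eqI) (auto simp: located_var_def)
  moreover have "binders \<psi> i (cvars ?\<beta>) = binders \<psi> j (cvars ?\<beta>)"
    using i j parent by (intro binders_adjacent) (auto simp: adjacent_def is_judgement_def)
  ultimately have "binders \<psi> j (cvars \<alpha>) = binders \<psi> i (cvars ?\<beta>) \<union> {(i, y)}"
    using y(2) by (auto simp: binders_def)
  moreover have "\<exists>b. falsifier \<alpha> = (falsifier ?\<beta>)(y \<mapsto> b)"
  proof -
    have "is_clause \<alpha>" using j by (simp add: is_judgement_def)
    then have "\<alpha> = insert (Pos y) ?\<beta> \<or> \<alpha> = insert (Neg y) ?\<beta>"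
      using y(2) by (auto simp: is_clause_iff in_cvars_iff)
    then show ?thesis using falsifier_insert[of y ?\<beta>] by (metis cvars_simps(4) DiffE insertI1)
  qed
  moreover have "follows_set \<psi> i (binders \<psi> i (cvars ?\<beta>))"
    using i by (intro follows_set_binders) (simp_all add: is_judgement_def)
  ultimately show ?thesis using y(1) unfolding unary_node_def by auto
qed

lemma binary_node_label:
  assumes \<gamma>: "is_judgement \<psi> (i, \<alpha> \<union> \<beta>)" and \<alpha>: "is_judgement \<psi> (i, insert (Pos u) \<alpha>)"
    and u: "u \<notin> cvars (\<alpha> \<union> \<beta>)"
  shows "binary_node \<psi> (label \<psi> (i, \<alpha> \<union> \<beta>)) (label \<psi> (i, insert (Pos u) \<alpha>))
    (label \<psi> (i, insert (Neg u) \<beta>))"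
proof -
  let ?l = "(binder_of \<psi> i u, u)"
  have "insert u (cvars (\<alpha> \<union> \<beta>)) \<subseteq> free_at \<psi> i" "i \<in> indices \<psi>"
    using \<gamma> \<alpha> by (auto simp: is_judgement_def)
  then have coh: "coherent_located \<psi> (binders \<psi> i (insert u (cvars (\<alpha> \<union> \<beta>))))"
    by (rule coherent_located_binders[rotated])
  have ins: "binders \<psi> i (insert u X) = binders \<psi> i X \<union> {?l}" for X by (auto simp: binders_def)
  have cl: "is_clause (\<alpha> \<union> \<beta>)" using \<gamma> by (simp add: is_judgement_def)
  have "binders \<psi> i (cvars (\<alpha> \<union> \<beta>)) = binders \<psi> i (cvars \<alpha>) \<union> binders \<psi> i (cvars \<beta>)"
    by (auto simp: binders_def)
  moreover have "?l \<notin> binders \<psi> i (cvars (\<alpha> \<union> \<beta>))" using u by (auto simp: binders_def)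
  moreover have "located_var \<psi> ?l" "coherent \<psi> (binders \<psi> i (cvars (\<alpha> \<union> \<beta>)) \<union> {?l})"
    using coh unfolding ins coherent_located_def by auto
  moreover have "label \<psi> (i, insert (Pos u) \<alpha>) = (binders \<psi> i (cvars \<alpha>) \<union> {?l},
      (falsifier (\<alpha> \<union> \<beta>) |` lvars (binders \<psi> i (cvars \<alpha>)))(u \<mapsto> False))"
    using falsifier_restrict[OF cl, of \<alpha>] falsifier_insert(1)[of u \<alpha>] u by (simp add: ins)
  moreover have "label \<psi> (i, insert (Neg u) \<beta>) = (binders \<psi> i (cvars \<beta>) \<union> {?l},
      (falsifier (\<alpha> \<union> \<beta>) |` lvars (binders \<psi> i (cvars \<beta>)))(u \<mapsto> True))"
    using falsifier_restrict[OF cl, of \<beta>] falsifier_insert(2)[of u \<beta>] u by (simp add: ins)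
  ultimately show ?thesis
    unfolding binary_node_def label.simps prod.case by blast
qed

end

fun trace_step :: "qcbf \<Rightarrow> judgement \<Rightarrow> judgement list \<Rightarrow> label tree list \<Rightarrow> label tree" where
  "trace_step \<psi> J [K] [T] = (if snd K \<subseteq> snd J then T else Node (label \<psi> J) [T])"
| "trace_step \<psi> J [K, _] [T, T'] =
     Node (label \<psi> J) (if \<exists>u. Neg u \<in> snd K - snd J then [T', T] else [T, T'])"
| "trace_step \<psi> J _ _ = Node (label \<psi> J) []"

definition trace_of :: "qcbf \<Rightarrow> judgement tree \<Rightarrow> label tree" where
  "trace_of \<psi> = fold_tree (trace_step \<psi>)"

lemma trace_of_Node: "trace_of \<psi> (Node J ts) = trace_step \<psi> J (map root ts) (map (trace_of \<psi>) ts)"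
  by (simp add: trace_of_def)

lemma traces_trace_step_forall_removal:
  assumes closed: "free \<psi> = {}"
    and J: "is_judgement \<psi> (i, \<alpha> - {Pos y, Neg y})" and K: "is_judgement \<psi> (j, \<alpha>)"
    and y: "is_parent \<psi> i j" "forall_located \<psi> (i, y)" "y \<in> cvars \<alpha>"
    and T: "traces \<psi> T (label \<psi> (j, \<alpha>)) n"
  defines "J \<equiv> (i, \<alpha> - {Pos y, Neg y})"
  shows "traces \<psi> (trace_step \<psi> J [(j, \<alpha>)] [T]) (label \<psi> J) (1 + n)"
proof -
  have "\<not> \<alpha> \<subseteq> \<alpha> - {Pos y, Neg y}" using y(3) by (auto simp: in_cvars_iff)
  then have "trace_step \<psi> J [(j, \<alpha>)] [T] = Node (label \<psi> J) [T]" by (simp add: J_def)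
  moreover have "traces \<psi> (Node (label \<psi> J) [T]) (label \<psi> J) (1 + n)"
    unfolding J_def
    by (rule traces_unary[OF trace_label_label[OF closed J] unary_node_label[OF closed J K y] T])
  ultimately show ?thesis by simp
qed

lemma traces_trace_step_resolve:
  assumes closed: "free \<psi> = {}"
    and J: "is_judgement \<psi> (i, \<alpha> \<union> \<beta>)" and K: "is_judgement \<psi> (i, insert (Pos u) \<alpha>)"
    and u: "u \<notin> cvars (\<alpha> \<union> \<beta>)"
    and T: "traces \<psi> T (label \<psi> (i, insert (Pos u) \<alpha>)) m"
    and T': "traces \<psi> T' (label \<psi> (i, insert (Neg u) \<beta>)) n"
  defines "J \<equiv> (i, \<alpha> \<union> \<beta>)" and "K \<equiv> (i, insert (Pos u) \<alpha>)" and "K' \<equiv> (i, insert (Neg u) \<beta>)"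
  shows "traces \<psi> (trace_step \<psi> J [K, K'] [T, T']) (label \<psi> J) (1 + (m + n))"
    and "traces \<psi> (trace_step \<psi> J [K', K] [T', T]) (label \<psi> J) (1 + (m + n))"
proof -
  have "\<not> (\<exists>v. Neg v \<in> snd K - snd J)" "Neg u \<in> snd K' - snd J"
    using u by (auto simp: J_def K_def K'_def in_cvars_iff)
  then have "trace_step \<psi> J [K, K'] [T, T'] = Node (label \<psi> J) [T, T']"
    "trace_step \<psi> J [K', K] [T', T] = Node (label \<psi> J) [T, T']"
    by auto
  moreover have "traces \<psi> (Node (label \<psi> J) [T, T']) (label \<psi> J) (1 + (m + n))"
    unfolding J_def
    by (rule traces_binary[OF trace_label_label[OF closed J]
          binary_node_label[OF closed J K u] T T'])
  ultimately show "traces \<psi> (trace_step \<psi> J [K, K'] [T, T']) (label \<psi> J) (1 + (m + n))"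
    "traces \<psi> (trace_step \<psi> J [K', K] [T', T]) (label \<psi> J) (1 + (m + n))"
    by simp_all
qed

theorem traces_trace_of:
  assumes closed: "free \<psi> = {}"
  shows "derivation \<psi> P \<Longrightarrow> traces \<psi> (trace_of \<psi> P) (label \<psi> (root P)) (num_nonflow \<psi> P)"
proof (induction P)
  case (Node J ts)
  have J: "is_judgement \<psi> J" and "derived \<psi> J (map root ts)"
    and children: "\<forall>K\<in>set (map root ts). is_judgement \<psi> K"
    using Node.prems derivation_root by auto
  have IH: "traces \<psi> (trace_of \<psi> t) (label \<psi> (root t)) (num_nonflow \<psi> t)" if "t \<in> set ts" for t
    using Node that by simp
  from \<open>derived \<psi> J (map root ts)\<close> children show ?case
  proof (cases rule: derived_cases)
    case (clause i \<alpha>)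
    then show ?thesis
      using traces_leaf[OF trace_label_label[OF closed J]] leaf_node_label[OF closed] J
      by (simp add: trace_of_Node upward_flow_def downward_flow_def)
  next
    case (flow i j \<alpha>)
    then obtain t where t: "ts = [t]" "root t = (j, \<alpha>)" by (auto simp: map_eq_Cons_conv)
    have "label \<psi> (i, \<alpha>) = label \<psi> (j, \<alpha>)"
      using flow J children t by (intro label_flow[OF closed]) auto
    then show ?thesis
      using IH[of t] flow t flow_iff[of \<psi> J "[(j, \<alpha>)]"] by (simp add: trace_of_Node)
  next
    case (forall_removal i y j \<alpha>)
    then obtain t where t: "ts = [t]" "root t = (j, \<alpha>)" by (auto simp: map_eq_Cons_conv)
    have "num_nonflow \<psi> (Node J ts) = 1 + num_nonflow \<psi> t"
      using forall_removal flow_iff[of \<psi> J "[(j, \<alpha>)]"] t by (auto simp: in_cvars_iff)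
    then show ?thesis
      using traces_trace_step_forall_removal[OF closed _ _ forall_removal(3-5)]
        IH[of t] forall_removal(1) J children t by (simp add: trace_of_Node)
  next
    case (resolve i u \<alpha> \<beta>)
    then obtain t t' where roots: "root t = (i, insert (Pos u) \<alpha>)" "root t' = (i, insert (Neg u) \<beta>)"
      and ts: "ts = [t, t'] \<or> ts = [t', t]"
      by (auto simp: map_eq_Cons_conv)
    have "num_nonflow \<psi> (Node J ts) = 1 + (num_nonflow \<psi> t + num_nonflow \<psi> t')"
      using ts by (auto simp: upward_flow_def downward_flow_def)
    then show ?thesis
      using traces_trace_step_resolve[OF closed _ _ resolve(2), of i "trace_of \<psi> t"
          _ "trace_of \<psi> t'"]
        IH[of t] IH[of t'] resolve(1) J children roots ts by (auto simp: trace_of_Node)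
  qed
qed

section \<open>Flow along a branch\<close>

definition branch :: "index \<Rightarrow> index \<Rightarrow> index list" where
  "branch t i = filter (prefix t) (prefixes i)"

lemma branch_append: "branch t (t @ d) = map ((@) t) (prefixes d)"
proof (induction d rule: rev_induct)
  case Nil
  have "filter (prefix t) (prefixes t) = [t]"
    by (cases t rule: rev_cases) (auto simp: filter_empty_conv dest!: prefix_length_le)
  then show ?case by (simp add: branch_def)
next
  case (snoc c d)
  then show ?case
    unfolding branch_def append_assoc[symmetric] prefixes_snoc by simp
qed

lemma branch_simps:
  assumes "prefix t i"
  shows "branch t i \<noteq> []" "hd (branch t i) = t" "last (branch t i) = i"
    and "set (branch t i) = {k. prefix t k \<and> prefix k i}"
proof -
  obtain d where "i = t @ d" using assms by (auto simp: prefix_def)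
  then show "branch t i \<noteq> []" "hd (branch t i) = t" "last (branch t i) = i"
    by (simp_all add: branch_append hd_map last_map)
  show "set (branch t i) = {k. prefix t k \<and> prefix k i}" by (auto simp: branch_def)
qed

lemma successively_is_parent_branch:
  assumes "prefix t i" "i \<in> indices \<psi>"
  shows "successively (is_parent \<psi>) (branch t i)"
proof -
  obtain d where d: "i = t @ d" using assms(1) by (auto simp: prefix_def)
  have "successively (is_parent \<psi>) (map ((@) t) (prefixes d))"
    using assms(2) unfolding d
  proof (induction d rule: rev_induct)
    case (snoc c d)
    then have "t @ d \<in> indices \<psi>" using indices_prefix[of "t @ d" "t @ d @ [c]"] by simp
    then show ?case
      using snoc by (simp add: successively_append_iff last_map is_parent_def)
  qed simp
  then show ?thesis by (simp add: d branch_append)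
qed

definition carry :: "index list \<Rightarrow> lit set \<Rightarrow> judgement tree \<Rightarrow> judgement tree" where
  "carry ks \<alpha> P = foldr (\<lambda>k Q. Node (k, \<alpha>) [Q]) ks P"

lemma derives_flow:
  assumes "derives \<psi> P (j, \<alpha>) n" "adjacent \<psi> i j" "cvars \<alpha> \<subseteq> free_at \<psi> i"
  shows "derives \<psi> (Node (i, \<alpha>) [P]) (i, \<alpha>) n"
proof -
  have flow: "upward_flow \<psi> (i, \<alpha>) [(j, \<alpha>)] \<or> downward_flow \<psi> (i, \<alpha>) [(j, \<alpha>)]"
    using assms(2) by (auto simp: flow_iff)
  have "is_judgement \<psi> (j, \<alpha>)" using assms(1) by (rule derives_judgement)
  moreover have "i \<in> indices \<psi>"
    using assms(2) indices_prefix[of i j] by (auto simp: adjacent_def is_parent_def)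
  ultimately have "is_judgement \<psi> (i, \<alpha>)" using assms(3) by (simp add: is_judgement_def)
  then show ?thesis using assms(1) flow by (auto simp: derives_def derived_def)
qed

lemma derives_carry:
  assumes "derives \<psi> P (i, \<alpha>) n" "successively (adjacent \<psi>) (ks @ [i])"
    and "\<And>k. k \<in> set ks \<Longrightarrow> cvars \<alpha> \<subseteq> free_at \<psi> k"
  shows "derives \<psi> (carry ks \<alpha> P) (hd (ks @ [i]), \<alpha>) n"
  using assms(2,3)
proof (induction ks)
  case Nil
  then show ?case using assms(1) by (simp add: carry_def)
next
  case (Cons k ks)
  then have "derives \<psi> (carry ks \<alpha> P) (hd (ks @ [i]), \<alpha>) n" "adjacent \<psi> k (hd (ks @ [i]))"
    by (auto simp: successively_Cons)
  then show ?case using derives_flow[of \<psi> "carry ks \<alpha> P"] Cons.prems(2) by (simp add: carry_def)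
qed

definition climb :: "index \<Rightarrow> index \<Rightarrow> index list" where
  "climb t i = butlast (branch t i)"

definition descent :: "index \<Rightarrow> index \<Rightarrow> index list" where
  "descent t i = rev (tl (branch t i))"

lemma derives_climb:
  assumes P: "derives \<psi> P (i, \<alpha>) n" and t: "prefix t i"
    and free: "\<And>k. prefix t k \<Longrightarrow> prefix k i \<Longrightarrow> cvars \<alpha> \<subseteq> free_at \<psi> k"
  shows "derives \<psi> (carry (climb t i) \<alpha> P) (t, \<alpha>) n"
proof -
  note branch = branch_simps[OF t]
  have eq: "climb t i @ [i] = branch t i"
    using branch(1,3) append_butlast_last_id by (force simp: climb_def)
  have "i \<in> indices \<psi>" using derives_judgement[OF P] by (simp add: is_judgement_def)
  from successively_is_parent_branch[OF t this] have "successively (adjacent \<psi>) (branch t i)"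
    by (rule successively_mono) (simp add: adjacent_def)
  moreover have "cvars \<alpha> \<subseteq> free_at \<psi> k" if "k \<in> set (climb t i)" for k
    using that free branch(4) in_set_butlastD by (fastforce simp: climb_def)
  ultimately show ?thesis using derives_carry[OF P, of "climb t i"] by (simp add: eq branch(2))
qed

lemma derives_descent:
  assumes P: "derives \<psi> P (t, \<alpha>) n" and t: "prefix t i" and i: "i \<in> indices \<psi>"
    and free: "\<And>k. prefix t k \<Longrightarrow> prefix k i \<Longrightarrow> cvars \<alpha> \<subseteq> free_at \<psi> k"
  shows "derives \<psi> (carry (descent t i) \<alpha> P) (i, \<alpha>) n"
proof -
  note branch = branch_simps[OF t]
  have eq: "descent t i @ [t] = rev (branch t i)"
    using branch(1,2) by (cases "branch t i") (simp_all add: descent_def)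
  have "successively (\<lambda>j k. adjacent \<psi> k j) (branch t i)"
    using successively_is_parent_branch[OF t i] by (rule successively_mono) (simp add: adjacent_def)
  moreover have "cvars \<alpha> \<subseteq> free_at \<psi> k" if "k \<in> set (descent t i)" for k
    using that free branch(4) list.set_sel(2)[OF branch(1)] by (fastforce simp: descent_def)
  ultimately show ?thesis
    using derives_carry[OF P, of "descent t i"] branch(1,3) by (simp add: eq hd_rev)
qed

section \<open>From traces to proofs\<close>

lemma wf_qcbf_sub_at: "wf_qcbf \<psi> \<Longrightarrow> sub_at \<psi> i = Some \<phi> \<Longrightarrow> wf_qcbf \<phi>"
proof (induction \<psi> i rule: sub_at.induct)
  case (2 \<psi> k i)
  then show ?case by (cases \<psi>) (auto simp: less_Suc_eq split: if_splits)
qed simp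

lemma clause_judgement:
  assumes "wf_qcbf \<psi>" "sub_at \<psi> i = Some (Clause \<alpha>)"
  shows "is_judgement \<psi> (i, \<alpha>)"
  using wf_qcbf_sub_at[OF assms] assms(2) by (auto simp: is_judgement_def indices_def free_at_def)

lemma derives_clause:
  assumes "wf_qcbf \<psi>" "sub_at \<psi> i = Some (Clause \<alpha>)"
  shows "derives \<psi> (Node (i, \<alpha>) []) (i, \<alpha>) 1"
  using assms clause_judgement[OF assms]
  by (auto simp: derives_def derived_def clause_rule_def upward_flow_def downward_flow_def)

lemma derives_forall_removal:
  assumes P: "derives \<psi> P (i @ [0], \<alpha>) n" and y: "forall_located \<psi> (i, y)" "y \<in> cvars \<alpha>"
  defines "\<beta> \<equiv> \<alpha> - {Pos y, Neg y}"
  shows "derives \<psi> (Node (i, \<beta>) [P]) (i, \<beta>) (1 + n)"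
proof -
  have "is_judgement \<psi> (i @ [0], \<alpha>)" using P by (rule derives_judgement)
  moreover have "located_var \<psi> (i, y)" using y(1) by (simp add: located_var_def)
  then have i: "i \<in> indices \<psi>" "i @ [0] \<in> indices \<psi>" "free_at \<psi> i = free_at \<psi> (i @ [0]) - {y}"
    using located_var_index located_var_child by blast+
  ultimately have "is_judgement \<psi> (i, \<beta>)"
    using is_clause_subset[of \<alpha> \<beta>] by (auto simp: is_judgement_def \<beta>_def)
  moreover have "forall_removal \<psi> (i, \<beta>) [(i @ [0], \<alpha>)]"
    using y(1) i(2) by (auto simp: forall_removal_def forall_located_def is_parent_def \<beta>_def)
  moreover have "\<beta> \<noteq> \<alpha>" using y(2) by (auto simp: \<beta>_def in_cvars_iff)
  ultimately show ?thesis using P by (auto simp: derives_def derived_def flow_iff)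
qed

lemma derives_resolve:
  assumes P: "derives \<psi> P (i, insert (Pos u) \<alpha>) m" and Q: "derives \<psi> Q (i, insert (Neg u) \<beta>) n"
    and u: "u \<notin> cvars (\<alpha> \<union> \<beta>)" and \<gamma>: "is_clause (\<alpha> \<union> \<beta>)"
  shows "derives \<psi> (Node (i, \<alpha> \<union> \<beta>) [P, Q]) (i, \<alpha> \<union> \<beta>) (1 + (m + n))"
proof -
  have "is_judgement \<psi> (i, insert (Pos u) \<alpha>)" "is_judgement \<psi> (i, insert (Neg u) \<beta>)"
    using P Q by (auto dest: derives_judgement)
  then have "is_judgement \<psi> (i, \<alpha> \<union> \<beta>)" using \<gamma> by (auto simp: is_judgement_def)
  moreover have "resolvent (insert (Pos u) \<alpha>) (insert (Neg u) \<beta>) (\<alpha> \<union> \<beta>)"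
    unfolding resolvent_def using u \<gamma>
    by (intro bexI[of _ "Pos u"]) (auto simp: in_cvars_iff)
  ultimately show ?thesis
    using P Q
    by (auto simp: derives_def derived_def resolve_rule_def upward_flow_def downward_flow_def)
qed

fun clause_paths :: "qcbf \<Rightarrow> index list" where
  "clause_paths (Clause \<alpha>) = [[]]"
| "clause_paths (Conj \<phi> \<chi>) = map ((#) 0) (clause_paths \<phi>) @ map ((#) 1) (clause_paths \<chi>)"
| "clause_paths (All v \<phi>) = map ((#) 0) (clause_paths \<phi>)"
| "clause_paths (Exi v \<phi>) = map ((#) 0) (clause_paths \<phi>)"

lemma set_clause_paths: "i \<in> set (clause_paths \<psi>) \<longleftrightarrow> (\<exists>\<alpha>. sub_at \<psi> i = Some (Clause \<alpha>))"
proof (induction \<psi> arbitrary: i)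
  case (Conj \<phi> \<chi>)
  then show ?case by (cases i) (auto simp: less_Suc_eq)
next
  case (Clause \<beta>)
  then show ?case by (cases i) auto
qed (case_tac i; auto)+

definition leaf_index :: "qcbf \<Rightarrow> label \<Rightarrow> index" where
  "leaf_index \<psi> L =
     hd (filter (\<lambda>i. \<exists>\<alpha>. sub_at \<psi> i = Some (Clause \<alpha>) \<and> label \<psi> (i, \<alpha>) = L) (clause_paths \<psi>))"

lemma leaf_node_is_label:
  assumes "trace_label \<psi> L" "leaf_node \<psi> L"
  shows "\<exists>i \<alpha>. sub_at \<psi> i = Some (Clause \<alpha>) \<and> label \<psi> (i, \<alpha>) = L"
proof -
  obtain S a where L: "L = (S, a)" by fastforce
  obtain i \<alpha> where i: "follows_set \<psi> i S" "sub_at \<psi> i = Some (Clause \<alpha>)"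
    "falsified \<alpha> a" "cvars \<alpha> = lvars S"
    using assms(2) by (auto simp: leaf_node_def L)
  have S: "\<And>l. l \<in> S \<Longrightarrow> located_var \<psi> l" "dom a = lvars S"
    using assms(1) by (auto simp: trace_label_def L)
  have "\<alpha> = falsified_clause a" using eq_falsified_clause_if_falsified i(3,4) S(2) by simp
  then have "falsifier \<alpha> = a" by (simp add: falsifier_falsified_clause)
  moreover have "binder_of \<psi> i u = k" if "(k, u) \<in> S" for k u
    using that S(1) i(1) by (intro binder_of_eqI) (auto simp: follows_set_def)
  then have "binders \<psi> i (cvars \<alpha>) = S"
    unfolding i(4) lvars_def binders_def by (force simp: image_image)
  ultimately show ?thesis using i(2) by (auto simp: L)
qed

lemma label_leaf_index:
  assumes "trace_label \<psi> L" "leaf_node \<psi> L"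
  obtains \<alpha> where "sub_at \<psi> (leaf_index \<psi> L) = Some (Clause \<alpha>)" "label \<psi> (leaf_index \<psi> L, \<alpha>) = L"
proof -
  let ?P = "\<lambda>i. \<exists>\<alpha>. sub_at \<psi> i = Some (Clause \<alpha>) \<and> label \<psi> (i, \<alpha>) = L"
  have "filter ?P (clause_paths \<psi>) \<noteq> []"
    using leaf_node_is_label[OF assms] by (auto simp: filter_empty_conv set_clause_paths)
  then have "leaf_index \<psi> L \<in> set (filter ?P (clause_paths \<psi>))"
    unfolding leaf_index_def by (rule hd_in_set)
  then show thesis using that by auto
qed

definition conclude :: "index \<Rightarrow> label \<Rightarrow> judgement tree list \<Rightarrow> judgement tree" where
  "conclude i L Ps = (let \<alpha> = falsified_clause (snd L) in
     carry (climb (anchor (fst L)) i) \<alpha> (Node (i, \<alpha>) Ps))"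

definition lower :: "index \<Rightarrow> label \<Rightarrow> judgement tree \<Rightarrow> judgement tree" where
  "lower i L P = carry (descent (anchor (fst L)) i) (falsified_clause (snd L)) P"

fun proof_step :: "qcbf \<Rightarrow> label \<Rightarrow> label list \<Rightarrow> judgement tree list \<Rightarrow> judgement tree" where
  "proof_step \<psi> L [L'] [P] = conclude (butlast (anchor (fst L'))) L [P]"
| "proof_step \<psi> L [L0, L1] [P0, P1] = (let i = anchor (fst L0 \<union> fst L1) in
     conclude i L [lower i L0 P0, lower i L1 P1])"
| "proof_step \<psi> L _ _ = conclude (leaf_index \<psi> L) L []"

definition proof_of :: "qcbf \<Rightarrow> label tree \<Rightarrow> judgement tree" where
  "proof_of \<psi> = fold_tree (proof_step \<psi>)"

lemma proof_of_Node: "proof_of \<psi> (Node L ts) = proof_step \<psi> L (map root ts) (map (proof_of \<psi>) ts)"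
  by (simp add: proof_of_def)

definition anchored :: "label \<Rightarrow> judgement" where
  "anchored L = (anchor (fst L), falsified_clause (snd L))"

lemma derives_conclude:
  assumes L: "trace_label \<psi> (S, a)" and i: "follows_set \<psi> i S"
    and P: "derives \<psi> (Node (i, falsified_clause a) Ps) (i, falsified_clause a) n"
  shows "derives \<psi> (conclude i (S, a) Ps) (anchored (S, a)) n"
proof -
  have S: "coherent_located \<psi> S" using L by (simp add: trace_label_def coherent_located_def)
  have "cvars (falsified_clause a) = lvars S"
    using L by (simp add: trace_label_def cvars_falsified_clause)
  then show ?thesis
    using derives_climb[OF P anchor_prefix[OF S i]] free_at_below_anchor[OF S i]
    by (simp add: conclude_def anchored_def Let_def)
qed

lemma derives_lower:
  assumes P: "derives \<psi> P (anchored L) n" and L: "trace_label \<psi> L"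
    and T: "coherent_located \<psi> T" "fst L \<subseteq> T"
  shows "follows_set \<psi> (anchor T) (fst L)"
    and "derives \<psi> (lower (anchor T) L P) (anchor T, falsified_clause (snd L)) n"
proof -
  have vars: "cvars (falsified_clause (snd L)) = lvars (fst L)"
    using L by (simp add: trace_label_def cvars_falsified_clause split: prod.splits)
  have "lvars (fst L) \<subseteq> free_at \<psi> (anchor (fst L))"
    using derives_judgement[OF P] by (simp add: anchored_def is_judgement_def vars)
  then show follows: "follows_set \<psi> (anchor T) (fst L)" by (rule follows_set_anchor[OF T])
  show "derives \<psi> (lower (anchor T) L P) (anchor T, falsified_clause (snd L)) n"
    unfolding lower_def
    using free_at_below_anchor[OF coherent_located_subset[OF T] follows]
    by (intro derives_descent P[unfolded anchored_def] anchor_mono[OF T] anchor_index[OF T(1)])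
      (simp add: vars)
qed

lemma derives_leaf_node:
  assumes "qcbf_instance \<psi>" and L: "trace_label \<psi> L" "leaf_node \<psi> L"
  shows "derives \<psi> (conclude (leaf_index \<psi> L) L []) (anchored L) 1"
proof -
  obtain S a where Sa: "L = (S, a)" by fastforce
  have wf: "wf_qcbf \<psi>" "free \<psi> = {}" using assms(1) by (simp_all add: qcbf_instance_def)
  obtain \<alpha> where \<alpha>: "sub_at \<psi> (leaf_index \<psi> L) = Some (Clause \<alpha>)" "label \<psi> (leaf_index \<psi> L, \<alpha>) = L"
    using L by (rule label_leaf_index)
  have j: "is_judgement \<psi> (leaf_index \<psi> L, \<alpha>)" using wf(1) \<alpha>(1) by (rule clause_judgement)
  have "falsified_clause a = \<alpha>"
    using \<alpha>(2) j by (auto simp: Sa is_judgement_def falsified_clause_falsifier)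
  moreover have "follows_set \<psi> (leaf_index \<psi> L) S"
    using follows_set_binders[OF wf(2), of "leaf_index \<psi> L" "cvars \<alpha>"] j \<alpha>(2)
    by (simp add: Sa is_judgement_def)
  ultimately show ?thesis
    using derives_clause[OF wf(1) \<alpha>(1)] L(1) derives_conclude unfolding Sa by blast
qed

lemma derives_unary_node:
  assumes L: "trace_label \<psi> L" "trace_label \<psi> L'" "unary_node \<psi> L L'"
    and P: "derives \<psi> P (anchored L') n"
  shows "derives \<psi> (conclude (butlast (anchor (fst L'))) L [P]) (anchored L) (1 + n)"
proof -
  obtain S a where Sa: "L = (S, a)" by fastforce
  obtain i y b where y: "forall_located \<psi> (i, y)" and i: "follows_set \<psi> i S"
    and L': "L' = (S \<union> {(i, y)}, a(y \<mapsto> b))"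
    using L(3) by (auto simp: unary_node_def Sa)
  have S: "coherent_located \<psi> (insert (i, y) S)"
    using L(2) by (simp add: trace_label_def coherent_located_def L')
  have S': "coherent_located \<psi> S" using S by (rule coherent_located_subset) blast
  have "prefix (anchor S) (i @ [0])" using anchor_prefix[OF S' i] by (simp add: prefix_snoc)
  then have anchor: "anchor (insert (i, y) S) = i @ [0]" using anchor_insert[OF S] by simp
  have "y \<notin> lvars S"
  proof
    assume "y \<in> lvars S"
    then obtain k where "follows \<psi> i (k, y)" using i by (auto simp: lvars_def follows_set_def)
    then show False using y located_not_follows by (auto simp: located_var_def)
  qed
  then have fresh: "y \<notin> dom a" using L(1) by (simp add: Sa trace_label_def)
  have "y \<in> cvars (falsified_clause (a(y \<mapsto> b)))" by (simp add: cvars_falsified_clause)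
  moreover have "falsified_clause (a(y \<mapsto> b)) - {Pos y, Neg y} = falsified_clause a"
    using falsified_clause_update[OF fresh] fresh cvars_falsified_clause[of a]
    by (cases b) (auto simp: in_cvars_iff set_eq_iff)
  moreover have "derives \<psi> P (i @ [0], falsified_clause (a(y \<mapsto> b))) n"
    using P by (simp add: anchored_def L' anchor)
  ultimately have "derives \<psi> (Node (i, falsified_clause a) [P]) (i, falsified_clause a) (1 + n)"
    using derives_forall_removal[OF _ y] by metis
  then show ?thesis using derives_conclude L(1) i unfolding Sa by (simp add: L' anchor)
qed

lemma binary_nodeE:
  assumes L: "trace_label \<psi> (S, a)" and node: "binary_node \<psi> (S, a) L0 L1"
  obtains u \<alpha> \<beta> where "falsified_clause a = \<alpha> \<union> \<beta>" "u \<notin> cvars (\<alpha> \<union> \<beta>)"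
    and "falsified_clause (snd L0) = insert (Pos u) \<alpha>"
      "falsified_clause (snd L1) = insert (Neg u) \<beta>"
    and "coherent_located \<psi> (fst L0 \<union> fst L1)" "S \<subseteq> fst L0 \<union> fst L1"
proof -
  obtain l S0 S1 where l: "located_var \<psi> l" "l \<notin> S" "coherent \<psi> (S \<union> {l})" and S: "S0 \<union> S1 = S"
    and L0: "L0 = (S0 \<union> {l}, (a |` lvars S0)(snd l \<mapsto> False))"
    and L1: "L1 = (S1 \<union> {l}, (a |` lvars S1)(snd l \<mapsto> True))"
    using node by (fastforce simp: binary_node_def)
  have T: "fst L0 \<union> fst L1 = S \<union> {l}" using S by (auto simp: L0 L1)
  have dom: "dom a = lvars S" and S_loc: "\<forall>l\<in>S. located_var \<psi> l"
    using L by (auto simp: trace_label_def)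
  have fresh: "snd l \<notin> lvars S"
  proof
    assume "snd l \<in> lvars S"
    then obtain k where k: "(k, snd l) \<in> S" by (auto simp: lvars_def)
    then have "follows \<psi> k l \<or> follows \<psi> (fst l) (k, snd l)"
      using l(2,3) unfolding coherent_def by (metis UnI1 UnI2 fst_conv singletonI)
    then show False using located_not_follows l(1) S_loc k by (metis prod.collapse)
  qed
  let ?\<alpha> = "falsified_clause (a |` lvars S0)" and ?\<beta> = "falsified_clause (a |` lvars S1)"
  have "lvars S = lvars S0 \<union> lvars S1" using S by (auto simp: lvars_def)
  moreover have "var_of M \<in> lvars S" if "M \<in> falsified_clause a" for M
    using that cvars_falsified_clause[of a] dom by (force simp: cvars_def)
  ultimately have union: "falsified_clause a = ?\<alpha> \<union> ?\<beta>"
    by (auto simp: falsified_clause_restrict)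
  show thesis
  proof (rule that[OF union])
    show "snd l \<notin> cvars (?\<alpha> \<union> ?\<beta>)"
      unfolding union[symmetric] using fresh dom by (simp add: cvars_falsified_clause)
    show "falsified_clause (snd L0) = insert (Pos (snd l)) ?\<alpha>"
      "falsified_clause (snd L1) = insert (Neg (snd l)) ?\<beta>"
      using fresh dom falsified_clause_update[of "snd l"] by (simp_all add: L0 L1)
    show "coherent_located \<psi> (fst L0 \<union> fst L1)"
      unfolding T using l S_loc by (simp add: coherent_located_def)
    show "S \<subseteq> fst L0 \<union> fst L1" unfolding T by blast
  qed
qed

lemma derives_binary_node:
  assumes L: "trace_label \<psi> L" "trace_label \<psi> L0" "trace_label \<psi> L1" "binary_node \<psi> L L0 L1"
    and P: "derives \<psi> P (anchored L0) m" and Q: "derives \<psi> Q (anchored L1) n"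
  defines "i \<equiv> anchor (fst L0 \<union> fst L1)"
  shows "derives \<psi> (conclude i L [lower i L0 P, lower i L1 Q]) (anchored L) (1 + (m + n))"
proof -
  obtain S a where Sa: "L = (S, a)" by fastforce
  obtain u \<alpha> \<beta> where a: "falsified_clause a = \<alpha> \<union> \<beta>" and u: "u \<notin> cvars (\<alpha> \<union> \<beta>)"
    and clauses: "falsified_clause (snd L0) = insert (Pos u) \<alpha>"
      "falsified_clause (snd L1) = insert (Neg u) \<beta>"
    and T: "coherent_located \<psi> (fst L0 \<union> fst L1)" "S \<subseteq> fst L0 \<union> fst L1"
    using L(1,4) unfolding Sa by (rule binary_nodeE)
  note lower = derives_lower[OF P L(2) T(1), folded i_def, unfolded clauses]
    derives_lower[OF Q L(3) T(1), folded i_def, unfolded clauses]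
  have "finite (\<alpha> \<union> \<beta>)"
    using lower(2,4) derives_judgement by (force simp: is_judgement_def is_clause_iff)
  then have "is_clause (\<alpha> \<union> \<beta>)" unfolding a[symmetric]
    by (auto simp: is_clause_iff falsified_clause_def)
  then have "derives \<psi> (Node (i, falsified_clause a) [lower i L0 P, lower i L1 Q])
      (i, falsified_clause a) (1 + (m + n))"
    unfolding a using lower(2,4) u by (intro derives_resolve) auto
  moreover have "follows_set \<psi> i S" using lower(1,3) T(2) by (auto simp: follows_set_def)
  ultimately show ?thesis using derives_conclude L(1) unfolding Sa by blast
qed

theorem derives_proof_of:
  assumes "qcbf_instance \<psi>"
  shows "is_trace \<psi> T \<Longrightarrow> derives \<psi> (proof_of \<psi> T) (anchored (root T)) (num_nodes T)"
proof (induction T)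
  case (Node L ts)
  have L: "trace_label \<psi> L" and node: "trace_node \<psi> L (map root ts)" using Node.prems by auto
  have IH: "derives \<psi> (proof_of \<psi> t) (anchored (root t)) (num_nodes t)" "trace_label \<psi> (root t)"
    if "t \<in> set ts" for t
    using Node that by (auto, cases t, auto)
  consider (leaf) "ts = []" | (unary) t where "ts = [t]" | (binary) t t' where "ts = [t, t']"
    using node by (cases "(\<psi>, L, map root ts)" rule: trace_node.cases) (auto simp: map_eq_Cons_conv)
  then show ?case
  proof cases
    case leaf
    then show ?thesis using derives_leaf_node[OF assms L] node by (simp add: proof_of_Node)
  next
    case (unary t)
    then show ?thesis
      using derives_unary_node[OF L IH(2)[of t] _ IH(1)[of t]] node by (simp add: proof_of_Node)
  next
    case (binary t t')
    then show ?thesis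
      using derives_binary_node[OF L IH(2)[of t] IH(2)[of t'] _ IH(1)[of t] IH(1)[of t']] node
      by (simp add: proof_of_Node Let_def)
  qed
qed

section \<open>Codes\<close>

lemma vbool_eq_iff [simp]: "vbool b = vbool c \<longleftrightarrow> b = c"
  by (auto simp: vbool_def)

lemma enc_nat_0 [simp]: "enc_nat 0 = Atom"
  by (simp add: enc_nat.simps)

lemma enc_nat_eq_Atom [simp]: "enc_nat n = Atom \<longleftrightarrow> n = 0" "Atom = enc_nat n \<longleftrightarrow> n = 0"
  by (subst enc_nat.simps, simp)+

lemma enc_nat_eq_iff [simp]: "enc_nat m = enc_nat n \<longleftrightarrow> m = n"
proof
  show "enc_nat m = enc_nat n \<Longrightarrow> m = n"
  proof (induction m arbitrary: n rule: less_induct)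
    case (less m)
    show ?case
    proof (cases "m = 0 \<or> n = 0")
      case False
      then have "odd m = odd n" "enc_nat (m div 2) = enc_nat (n div 2)"
        using less.prems by (simp_all add: enc_nat.simps[of m] enc_nat.simps[of n])
      then have "odd m = odd n" "m div 2 = n div 2"
        using less.IH[of "m div 2" "n div 2"] False by auto
      then show ?thesis by (metis dvd_mult_div_cancel odd_two_times_div_two_succ)
    qed (use less.prems in auto)
  qed
qed simp

definition enc_index :: "index \<Rightarrow> val" where
  "enc_index i = enc_list (map enc_nat i)"

fun enc_lit :: "lit \<Rightarrow> val" where
  "enc_lit (Pos u) = Cell (vbool True) (enc_nat u)"
| "enc_lit (Neg u) = Cell (vbool False) (enc_nat u)"

definition enc_located :: "located \<Rightarrow> val" where
  "enc_located l = Cell (enc_index (fst l)) (enc_nat (snd l))"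

definition enc_binding :: "nat \<times> bool \<Rightarrow> val" where
  "enc_binding p = Cell (enc_nat (fst p)) (vbool (snd p))"

lemma enc_index_eq_iff [simp]: "enc_index i = enc_index j \<longleftrightarrow> i = j"
  by (simp add: enc_index_def inj_map_eq_map inj_def)

lemma enc_index_simps [simp]:
  "enc_index [] = Atom" "enc_index (k # i) = Cell (enc_nat k) (enc_index i)"
  by (simp_all add: enc_index_def)

lemma inj_enc_lit: "inj enc_lit"
proof (rule injI)
  show "enc_lit L = enc_lit M \<Longrightarrow> L = M" for L M by (cases L; cases M) auto
qed

lemma inj_enc_located: "inj enc_located"
  by (auto intro!: injI simp: enc_located_def prod_eq_iff)

lemma inj_enc_binding: "inj enc_binding"
  by (auto intro!: injI simp: enc_binding_def prod_eq_iff)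

definition enumerates :: "val \<Rightarrow> val set \<Rightarrow> bool" where
  "enumerates v A \<longleftrightarrow> distinct (dec_list v) \<and> set (dec_list v) = A"

lemma enumerates_vmap:
  assumes v: "enumerates v (e ` A)" and f: "\<And>x. x \<in> A \<Longrightarrow> f (e x) = g x" and g: "inj_on g A"
  shows "enumerates (vmap f v) (g ` A)"
proof -
  have "f ` e ` A = g ` A" using f by (force simp: image_image)
  moreover have "inj_on f (e ` A)" using f g by (auto simp: inj_on_def)
  ultimately show ?thesis using v by (auto simp: enumerates_def distinct_map)
qed

lemma vmem_enumerates: "enumerates v A \<Longrightarrow> vmem x v \<longleftrightarrow> x \<in> A"
  by (auto simp: enumerates_def vmem_def)

lemma vex_enumerates: "enumerates v A \<Longrightarrow> vex P v \<longleftrightarrow> (\<exists>x\<in>A. P x)"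
  by (auto simp: enumerates_def vex_def)

lemma encodes_list_iff:
  assumes "\<And>x v. E x v \<longleftrightarrow> v = e x"
  shows "encodes_list E xs v \<longleftrightarrow> v = enc_list (map e xs)"
proof -
  have "list_all2 E xs vs \<longleftrightarrow> vs = map e xs" for vs
    by (induction xs arbitrary: vs) (auto simp: list_all2_Cons1 assms)
  then show ?thesis by (auto simp: encodes_list_def)
qed

lemma encodes_set_iff:
  assumes E: "\<And>x v. E x v \<longleftrightarrow> v = e x" and e: "inj e"
  shows "encodes_set E A v \<longleftrightarrow> enumerates v (e ` A)"
proof
  assume "encodes_set E A v"
  then show "enumerates v (e ` A)"
    using e by (auto simp: encodes_set_def encodes_list_iff[OF E] enumerates_def distinct_map
      intro: inj_on_subset[OF _ subset_UNIV])
next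
  assume v: "enumerates v (e ` A)"
  let ?xs = "map (inv e) (dec_list v)"
  have "map e ?xs = dec_list v"
    using v unfolding map_map by (intro map_idI) (auto simp: enumerates_def f_inv_into_f)
  then have "encodes_list E ?xs v" by (simp add: encodes_list_iff[OF E] del: map_map)
  moreover have "distinct ?xs" "set ?xs = A"
    using v e by (auto simp: enumerates_def distinct_map image_image intro!: inj_onI)
  ultimately show "encodes_set E A v" unfolding encodes_set_def by blast
qed

lemma encodes_index_iff: "encodes_index i v \<longleftrightarrow> v = enc_index i"
  unfolding encodes_index_def enc_index_def by (rule encodes_list_iff) (simp add: encodes_nat_def)

lemma encodes_lit_iff: "encodes_lit L v \<longleftrightarrow> v = enc_lit L"
  by (cases L) auto

lemma encodes_clause_iff: "encodes_clause \<alpha> v \<longleftrightarrow> enumerates v (enc_lit ` \<alpha>)"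
  unfolding encodes_clause_def by (intro encodes_set_iff encodes_lit_iff inj_enc_lit)

lemma encodes_located_set_iff:
  "encodes_set (encodes_prod encodes_index encodes_nat) S v \<longleftrightarrow> enumerates v (enc_located ` S)"
  by (intro encodes_set_iff inj_enc_located)
    (simp add: encodes_prod_def encodes_index_iff encodes_nat_def enc_located_def)

lemma encodes_assignment_iff: "encodes_assignment a v \<longleftrightarrow> enumerates v (enc_binding ` Map.graph a)"
  unfolding encodes_assignment_def by (intro encodes_set_iff inj_enc_binding)
    (simp add: encodes_prod_def encodes_bool_def encodes_nat_def enc_binding_def)

lemma encodes_label_iff:
  "encodes_label (S, a) v \<longleftrightarrow>
     (\<exists>vS va. v = Cell vS va \<and> enumerates vS (enc_located ` S) \<and> encodes_assignment a va)"
  unfolding encodes_label_def encodes_prod_def[of "encodes_set _"] encodes_located_set_iff by simp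

abbreviation encodes_judgement :: "judgement enc" where
  "encodes_judgement \<equiv> encodes_prod encodes_index encodes_clause"

lemma encodes_judgement_iff:
  "encodes_judgement (i, \<alpha>) v \<longleftrightarrow> (\<exists>w. v = Cell (enc_index i) w \<and> encodes_clause \<alpha> w)"
  by (auto simp: encodes_prod_def encodes_index_iff)

definition vsubset :: "val \<Rightarrow> val \<Rightarrow> bool" where
  "vsubset v w \<longleftrightarrow> \<not> vex (\<lambda>x. \<not> vmem x w) v"

lemma vsubset_enumerates:
  assumes "enumerates v A" "enumerates w B"
  shows "vsubset v w \<longleftrightarrow> A \<subseteq> B"
  unfolding vsubset_def vex_enumerates[OF assms(1)] vmem_enumerates[OF assms(2)] by blast

lemma ptest_vsubset [ptime_intros]:
  assumes "ptime f" "ptime g"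
  shows "ptest (\<lambda>e. vsubset (f e) (g e))"
  unfolding vsubset_def by (intro ptime_intros assms assms[THEN ptime_comp])

definition vlabel_eq :: "val \<Rightarrow> val \<Rightarrow> bool" where
  "vlabel_eq l m \<longleftrightarrow> vsubset (vfst l) (vfst m) \<and> vsubset (vfst m) (vfst l)
     \<and> vsubset (vsnd l) (vsnd m) \<and> vsubset (vsnd m) (vsnd l)"

lemma ptest_vlabel_eq [ptime_intros]:
  assumes "ptime f" "ptime g"
  shows "ptest (\<lambda>e. vlabel_eq (f e) (g e))"
  unfolding vlabel_eq_def by (intro ptime_intros assms)

lemma graph_eq_iff: "Map.graph a = Map.graph b \<longleftrightarrow> a = b"
proof
  assume eq: "Map.graph a = Map.graph b"
  have "a u = b u" for u
    using eq in_graphI[of a u] in_graphI[of b u] in_graphD[of u _ a] in_graphD[of u _ b]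
    by (metis option.exhaust)
  then show "a = b" by (rule ext)
qed simp

lemma vlabel_eq_iff:
  assumes "encodes_label L l" "encodes_label M m"
  shows "vlabel_eq l m \<longleftrightarrow> L = M"
proof -
  obtain S a T b where L: "L = (S, a)" "M = (T, b)" by (metis surj_pair)
  have "vlabel_eq l m \<longleftrightarrow> S = T \<and> Map.graph a = Map.graph b"
    using assms unfolding L encodes_label_iff encodes_assignment_iff
    by (auto simp: vlabel_eq_def vsubset_enumerates inj_image_subset_iff[OF inj_enc_located]
        inj_image_subset_iff[OF inj_enc_binding])
  then show ?thesis by (simp add: L graph_eq_iff)
qed

fun falsifying_binding :: "lit \<Rightarrow> nat \<times> bool" where
  "falsifying_binding (Pos u) = (u, False)"
| "falsifying_binding (Neg u) = (u, True)"

lemma graph_eq_falsifying_binding: "Map.graph a = falsifying_binding ` falsified_clause a"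
proof (intro set_eqI iffI)
  fix p assume "p \<in> Map.graph a"
  then have "a (fst p) = Some (snd p)" by (auto simp: graph_def)
  then show "p \<in> falsifying_binding ` falsified_clause a"
    by (intro image_eqI[of _ _ "if snd p then Neg (fst p) else Pos (fst p)"])
      (auto simp: falsified_clause_def prod_eq_iff)
next
  fix p assume "p \<in> falsifying_binding ` falsified_clause a"
  then obtain L where "lit_false a L" "p = falsifying_binding L"
    by (auto simp: falsified_clause_def)
  then show "p \<in> Map.graph a" by (cases L) (auto simp: graph_def)
qed

definition vbinding :: "val \<Rightarrow> val" where
  "vbinding l = Cell (vsnd l) (vbool (vfst l = Atom))"

definition vlit :: "val \<Rightarrow> val" where
  "vlit p = Cell (vbool (vsnd p = Atom)) (vfst p)"

lemma vbinding_enc_lit: "vbinding (enc_lit L) = enc_binding (falsifying_binding L)"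
  by (cases L) (auto simp: vbinding_def enc_binding_def)

lemma vlit_enc_binding: "vlit (enc_binding (falsifying_binding L)) = enc_lit L"
  by (cases L) (auto simp: vlit_def enc_binding_def)

lemma inj_enc_falsifying_binding: "inj (\<lambda>L. enc_binding (falsifying_binding L))"
proof (rule inj_on_imageI2[of vlit])
  show "inj (vlit \<circ> (\<lambda>L. enc_binding (falsifying_binding L)))"
    using inj_enc_lit by (simp add: o_def vlit_enc_binding)
qed

lemma encodes_assignment_vmap_vbinding:
  "encodes_clause (falsified_clause a) v \<Longrightarrow> encodes_assignment a (vmap vbinding v)"
  unfolding encodes_clause_iff encodes_assignment_iff graph_eq_falsifying_binding image_image
  by (erule enumerates_vmap)
    (simp_all add: vbinding_enc_lit inj_on_subset[OF inj_enc_falsifying_binding subset_UNIV])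

lemma encodes_clause_vmap_vlit:
  "encodes_assignment a v \<Longrightarrow> encodes_clause (falsified_clause a) (vmap vlit v)"
  unfolding encodes_clause_iff encodes_assignment_iff graph_eq_falsifying_binding image_image
  by (erule enumerates_vmap)
    (simp_all add: vlit_enc_binding inj_on_subset[OF inj_enc_lit subset_UNIV])

section \<open>Programs on codes of formulas and labels\<close>

lemma prefixes_map: "prefixes (map f xs) = map (map f) (prefixes xs)"
  by (induction xs) auto

lemma vprefixes_enc_index: "vprefixes (enc_index i) = enc_list (map enc_index (prefixes i))"
proof -
  have "dec_list (vprefixes (enc_index i)) = map enc_index (prefixes i)"
    by (simp add: dec_list_vprefixes enc_index_def[abs_def] prefixes_map)
  then show ?thesis by (metis enc_list_dec_list)
qed

lemma vmem_vprefixes: "vmem (enc_index t) (vprefixes (enc_index k)) \<longleftrightarrow> prefix t k"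
  by (auto simp: vprefixes_enc_index vmem_def)

lemma vfilter_enc_index:
  assumes "\<And>i. i \<in> set is \<Longrightarrow> P (enc_index i) \<longleftrightarrow> Q i"
  shows "vfilter P (enc_list (map enc_index is)) = enc_list (map enc_index (filter Q is))"
  using assms by (auto simp: filter_map o_def intro!: arg_cong[of _ _ "map enc_index"] filter_cong)

definition vchild :: "val \<Rightarrow> val \<Rightarrow> val" where
  "vchild x k = (if vfst x = enc_nat 1 \<and> k = Atom then vfst (vsnd x) else vsnd (vsnd x))"

definition vsub_at :: "val \<Rightarrow> val \<Rightarrow> val" where
  "vsub_at x i = foldr (\<lambda>k y. vchild y k) (dec_list (vrev i)) x"

lemma ptime_vsub_at [ptime_intros]:
  assumes "ptime f" "ptime g"
  shows "ptime (\<lambda>e. vsub_at (f e) (g e))"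
proof -
  have "ptime (uncurry2 (\<lambda>x i. foldr (\<lambda>k y. vchild y k) (dec_list i) x))"
    unfolding vchild_def by (intro ptime_foldr ptime_intros growth_intros)
  then show ?thesis
    unfolding vsub_at_def by (rule ptime_comp2) (intro ptime_intros assms)+
qed

lemma vsub_at_simps [simp]:
  "vsub_at x Atom = x"
  "vsub_at x (Cell k i) = vsub_at (vchild x k) i"
  by (simp_all add: vsub_at_def)

lemma encodes_qcbf_vsub_at:
  "encodes_qcbf \<psi> x \<Longrightarrow> sub_at \<psi> i = Some \<phi> \<Longrightarrow> encodes_qcbf \<phi> (vsub_at x (enc_index i))"
proof (induction \<psi> i arbitrary: x rule: sub_at.induct)
  case (2 \<psi> k i)
  then have k: "k < length (children \<psi>)" "sub_at (children \<psi> ! k) i = Some \<phi>"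
    by (auto split: if_splits)
  have "encodes_qcbf (children \<psi> ! k) (vchild x (enc_nat k))"
    using k(1) 2(2) by (cases \<psi>) (auto simp: vchild_def less_Suc_eq)
  then show ?case using 2(1)[OF k(1) _ k(2)] by simp
qed simp

definition vbinds :: "val \<Rightarrow> val \<Rightarrow> bool" where
  "vbinds x u \<longleftrightarrow> vfst x \<noteq> Atom \<and> vfst x \<noteq> enc_nat 1 \<and> vfst (vsnd x) = u"

lemma vbinds_iff:
  assumes "encodes_qcbf \<psi> x" "k \<in> indices \<psi>"
  shows "vbinds (vsub_at x (enc_index k)) (enc_nat u) \<longleftrightarrow> located_var \<psi> (k, u)"
proof -
  obtain \<phi> where \<phi>: "sub_at \<psi> k = Some \<phi>" using assms(2) by (auto simp: indices_def)
  have "encodes_qcbf \<phi> (vsub_at x (enc_index k))" using assms(1) \<phi> by (rule encodes_qcbf_vsub_at)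
  then show ?thesis using \<phi> by (cases \<phi>) (auto simp: vbinds_def located_var_iff)
qed

definition vbinder :: "val \<Rightarrow> val \<Rightarrow> val \<Rightarrow> val" where
  "vbinder x i u = vfst (vrev (vfilter (\<lambda>k. k \<noteq> i \<and> vbinds (vsub_at x k) u) (vprefixes i)))"

lemma ptime_vbinder [ptime_intros]:
  assumes "ptime f" "ptime g" "ptime h"
  shows "ptime (\<lambda>e. vbinder (f e) (g e) (h e))"
  unfolding vbinder_def vbinds_def by (intro ptime_intros assms assms[THEN ptime_comp])

lemma vbinder_eq:
  assumes "encodes_qcbf \<psi> x" "free \<psi> = {}" "i \<in> indices \<psi>" "u \<in> free_at \<psi> i"
  shows "vbinder x (enc_index i) (enc_nat u) = enc_index (binder_of \<psi> i u)"
proof -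
  let ?ks = "filter (\<lambda>k. k \<noteq> i \<and> located_var \<psi> (k, u)) (prefixes i)"
  have "vfilter (\<lambda>k. k \<noteq> enc_index i \<and> vbinds (vsub_at x k) (enc_nat u)) (vprefixes (enc_index i))
      = enc_list (map enc_index ?ks)"
    unfolding vprefixes_enc_index
    using vbinds_iff[OF assms(1) indices_prefix[OF _ assms(3)]] by (intro vfilter_enc_index) auto
  moreover have "binder_of \<psi> i u \<in> set ?ks"
    using binder_of_props[OF assms(2-4)] by (auto simp: follows_def)
  then have "?ks \<noteq> []" by (metis empty_iff list.set(1))
  ultimately show ?thesis
    unfolding vbinder_def binder_of_def
    by (simp add: vfst_vrev_enc_list last_map del: vrev_enc_list)
qed

definition vlabel :: "val \<Rightarrow> val \<Rightarrow> val \<Rightarrow> val" where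
  "vlabel x i \<alpha> = Cell (vmap (\<lambda>l. Cell (vbinder x i (vsnd l)) (vsnd l)) \<alpha>) (vmap vbinding \<alpha>)"

lemma ptime_vlabel [ptime_intros]:
  assumes "ptime f" "ptime g" "ptime h"
  shows "ptime (\<lambda>e. vlabel (f e) (g e) (h e))"
  unfolding vlabel_def vbinding_def by (intro ptime_intros assms assms[THEN ptime_comp])

lemma encodes_label_vlabel:
  assumes x: "encodes_qcbf \<psi> x" "free \<psi> = {}" and j: "is_judgement \<psi> (i, \<alpha>)"
    and w: "encodes_clause \<alpha> w"
  shows "encodes_label (label \<psi> (i, \<alpha>)) (vlabel x (enc_index i) w)"
proof -
  let ?f = "\<lambda>l. Cell (vbinder x (enc_index i) (vsnd l)) (vsnd l)"
    and ?g = "\<lambda>L. enc_located (binder_of \<psi> i (var_of L), var_of L)"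
  have \<alpha>: "i \<in> indices \<psi>" "is_clause \<alpha>" "cvars \<alpha> \<subseteq> free_at \<psi> i"
    using j by (auto simp: is_judgement_def)
  have "enumerates (vmap ?f w) (?g ` \<alpha>)"
  proof (rule enumerates_vmap[OF w[unfolded encodes_clause_iff]])
    show "?f (enc_lit L) = ?g L" if "L \<in> \<alpha>" for L
    proof -
      have "vsnd (enc_lit L) = enc_nat (var_of L)" by (cases L) auto
      moreover have "var_of L \<in> free_at \<psi> i" using that \<alpha>(3) by (auto simp: cvars_def)
      ultimately show ?thesis using vbinder_eq[OF x \<alpha>(1)] by (simp add: enc_located_def)
    qed
    show "inj_on ?g \<alpha>" using \<alpha>(2) by (auto simp: is_clause_def inj_on_def enc_located_def)
  qed
  moreover have "?g ` \<alpha> = enc_located ` binders \<psi> i (cvars \<alpha>)"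
    by (simp add: binders_def cvars_def image_image)
  moreover have "encodes_assignment (falsifier \<alpha>) (vmap vbinding w)"
    using w \<alpha>(2) by (intro encodes_assignment_vmap_vbinding) (simp add: falsified_clause_falsifier)
  ultimately show ?thesis by (simp add: encodes_label_iff vlabel_def)
qed

fun vclause_paths :: "val \<Rightarrow> val" where
  "vclause_paths (Cell t (Cell v w)) =
     (if t = Atom then Cell Atom Atom
      else if t = enc_nat 1
        then vappend (vmap (Cell Atom) (vclause_paths v))
          (vmap (Cell (enc_nat 1)) (vclause_paths w))
      else vmap (Cell Atom) (vclause_paths w))"
| "vclause_paths _ = Cell Atom Atom"

lemma vclause_paths_eq:
  "encodes_qcbf \<phi> x \<Longrightarrow> vclause_paths x = enc_list (map enc_index (clause_paths \<phi>))"
proof (induction \<phi> arbitrary: x)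
  case (Clause \<alpha>)
  then obtain w where "x = Cell Atom w" by auto
  then show ?case by (cases w) auto
qed auto

lemma length_vclause_paths: "length (dec_list (vclause_paths x)) \<le> vsize x"
  by (induction x rule: vclause_paths.induct) auto

lemma vsize_vclause_paths_step:
  "vsize (vclause_paths (Cell t b))
    \<le> vsize (vclause_paths (vfst b)) + vsize (vclause_paths (vsnd b))
     + (1 + vsize (enc_nat 1)) * vsize b + 3"
proof (cases b)
  case (Cell v w)
  let ?c = "1 + vsize (enc_nat 1)"
  have prepend: "vsize (vmap (Cell c) (vclause_paths y)) \<le> vsize (vclause_paths y) + ?c * vsize y"
    if "c = Atom \<or> c = enc_nat 1" for c y
  proof -
    have "length (dec_list (vclause_paths y)) * (1 + vsize c) \<le> vsize y * ?c"
      using that vsize_pos by (intro mult_le_mono length_vclause_paths) auto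
    then show ?thesis by (simp add: vsize_vmap_Cell mult.commute)
  qed
  show ?thesis
    using prepend[of Atom v] prepend[of "enc_nat 1" w] prepend[of Atom w]
      vsize_vappend[of "vmap (Cell Atom) (vclause_paths v)"
        "vmap (Cell (enc_nat 1)) (vclause_paths w)"]
    by (simp add: Cell distrib_left del: enc_nat_eq_iff)
qed simp

lemma ptime_vclause_paths [ptime_intros]:
  assumes "ptime f"
  shows "ptime (\<lambda>e. vclause_paths (f e))"
proof -
  \<comment> \<open>The code of a compound formula has its immediate subformulas two levels below its root.\<close>
  define h where
    "h e x = Cell (vclause_paths x) (Cell (vclause_paths (vfst x)) (vclause_paths (vsnd x)))"
    for e x :: val
  let ?s = "\<lambda>e t b ht hb. Cell
     (if t = Atom \<or> b = Atom then Cell Atom Atom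
      else if t = enc_nat 1
        then vappend (vmap (Cell Atom) (vfst (vsnd hb))) (vmap (Cell (enc_nat 1)) (vsnd (vsnd hb)))
      else vmap (Cell Atom) (vsnd (vsnd hb))) (Cell (vfst ht) (vfst hb))"
  have size: "poly_bounded (uncurry2 (\<lambda>e x. vsize (h e x)))"
  proof (rule poly_bounded_rec[where r = "\<lambda>e x. vsize (h e x)"])
    show "poly_bounded (\<lambda>e. 11)" by (rule poly_bounded_const)
    show "poly_bounded (\<lambda>z. (1 + vsize (enc_nat 1)) * vsize (vsnd (vsnd z)) + 5)"
      by (intro poly_bounded_intros)
    show "vsize (h e (Cell t b)) \<le> vsize (h e t) + vsize (h e b)
        + ((1 + vsize (enc_nat 1)) * vsize (vsnd (vsnd (Cell e (Cell t b)))) + 5)" for e t b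
      using vsize_vclause_paths_step[of t b] by (simp add: h_def)
  qed (simp add: h_def)
  have "ptime (uncurry2 h)"
  proof (rule ptime_rec[OF ptime_const _ _ _ size])
    show "ptime (uncurry5 ?s)" by (intro ptime_intros)
    show "h e Atom = Cell (Cell Atom Atom) (Cell (Cell Atom Atom) (Cell Atom Atom))" for e
      by (simp add: h_def)
    show "h e (Cell t b) = ?s e t b (h e t) (h e b)" for e t b
      by (cases b) (simp_all add: h_def)
  qed
  then have "ptime (\<lambda>e. h e (f e))" using ptime_id assms by (rule ptime_comp2)
  from ptime_vfst[OF this] show ?thesis by (simp add: h_def)
qed

definition vanchor :: "val \<Rightarrow> val" where
  "vanchor S = foldr (\<lambda>l r. let k = vappend (vfst l) (Cell Atom Atom) in
     if vmem r (vprefixes k) then k else r) (dec_list S) Atom"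

lemma ptime_vanchor [ptime_intros]:
  assumes "ptime f"
  shows "ptime (\<lambda>e. vanchor (f e))"
proof -
  have "ptime (uncurry2 (\<lambda>e S. vanchor S))"
    unfolding vanchor_def Let_def by (intro ptime_foldr ptime_intros growth_intros)
  then show ?thesis using ptime_id assms by (rule ptime_comp2)
qed

lemma vanchor_enc_list:
  "coherent_located \<psi> (set ls)
    \<Longrightarrow> vanchor (enc_list (map enc_located ls)) = enc_index (anchor (set ls))"
proof (induction ls)
  case Nil
  then show ?case by (simp add: vanchor_def anchor_empty)
next
  case (Cons l ls)
  then have IH: "vanchor (enc_list (map enc_located ls)) = enc_index (anchor (set ls))"
    using coherent_located_subset[of \<psi> "set (l # ls)" "set ls"] by auto
  have k: "vappend (vfst (enc_located l)) (Cell Atom Atom) = enc_index (fst l @ [0])"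
    using vappend_enc_list[of "map enc_nat (fst l)" "[Atom]"]
    by (simp add: enc_located_def enc_index_def del: vappend_enc_list)
  have "vanchor (enc_list (map enc_located (l # ls))) =
      (if vmem (vanchor (enc_list (map enc_located ls))) (vprefixes (enc_index (fst l @ [0])))
       then enc_index (fst l @ [0]) else vanchor (enc_list (map enc_located ls)))"
    by (simp add: vanchor_def k Let_def)
  also have "\<dots> = enc_index (anchor (insert l (set ls)))"
    unfolding IH vmem_vprefixes using anchor_insert[of \<psi> l "set ls"] Cons.prems by simp
  finally show ?case by simp
qed

lemma vanchor_eq:
  assumes "coherent_located \<psi> S" "set (dec_list v) = enc_located ` S"
  shows "vanchor v = enc_index (anchor S)"
proof -
  let ?ls = "map (inv enc_located) (dec_list v)"
  have "map enc_located ?ls = dec_list v"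
    using assms(2) unfolding map_map by (intro map_idI) (auto simp: f_inv_into_f)
  moreover have "set ?ls = S" using assms(2) inj_enc_located by (simp add: image_image)
  ultimately show ?thesis
    using vanchor_enc_list[of \<psi> ?ls] assms(1) by (metis enc_list_dec_list)
qed

section \<open>Translating proofs in polynomial time\<close>

lemma poly_time_translationI:
  assumes "ptime (uncurry2 f)"
    and "\<And>\<psi> x u v. qcbf_instance \<psi> \<Longrightarrow> A \<psi> x \<Longrightarrow> encodes_qcbf \<psi> u \<Longrightarrow> E x v
      \<Longrightarrow> B \<psi> x (g \<psi> x) \<and> F (g \<psi> x) (f u v)"
  shows "poly_time_translation E F A B"
  unfolding poly_time_translation_def
  using ptime_poly_time_on[OF assms(1)] assms(2)
  by (intro exI[of _ "uncurry2 f"]) (fastforce simp: encodes_prod_def)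

definition vtrace_step :: "val \<Rightarrow> val \<Rightarrow> val \<Rightarrow> val \<Rightarrow> val" where
  "vtrace_step x J Js Ts = (let L = vlabel x (vfst J) (vsnd J); \<alpha> = vsnd (vfst Js) in
     if Js = Atom then Cell L Atom
     else if vsnd Js = Atom then (if vsubset \<alpha> (vsnd J) then vfst Ts else Cell L Ts)
     else Cell L (if vex (\<lambda>l. vfst l = Atom \<and> \<not> vmem l (vsnd J)) \<alpha> then vrev Ts else Ts))"

definition vtrace :: "val \<Rightarrow> val \<Rightarrow> val" where
  "vtrace x = vtree (vtrace_step x)"

lemma ptime_vtrace: "ptime (uncurry2 vtrace)"
  unfolding vtrace_def
proof (rule ptime_vtree)
  show "ptime (uncurry4 vtrace_step)"
    unfolding vtrace_step_def Let_def by (intro ptime_intros)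
  show "additive_growth (uncurry3 vtrace_step)"
    unfolding vtrace_step_def Let_def by (intro growth_intros ptime_intros)
qed

lemma encodes_trace_Node_iff:
  "encodes_trace (Node L Ts) v \<longleftrightarrow>
     (\<exists>l ts. v = Cell l (enc_list ts) \<and> encodes_label L l \<and> list_all2 encodes_trace Ts ts)"
  unfolding encodes_trace_def by (subst encodes_tree.simps) auto

lemma vsubset_clause_iff:
  "encodes_clause \<alpha> v \<Longrightarrow> encodes_clause \<beta> w \<Longrightarrow> vsubset v w \<longleftrightarrow> \<alpha> \<subseteq> \<beta>"
  by (simp add: encodes_clause_iff vsubset_enumerates inj_image_subset_iff[OF inj_enc_lit])

lemma vex_Neg_iff:
  assumes "encodes_clause \<alpha> v" "encodes_clause \<beta> w"
  shows "vex (\<lambda>l. vfst l = Atom \<and> \<not> vmem l w) v \<longleftrightarrow> (\<exists>u. Neg u \<in> \<alpha> - \<beta>)"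
proof -
  have "vfst (enc_lit L) = Atom \<longleftrightarrow> (\<exists>u. L = Neg u)" for L by (cases L) auto
  moreover have "vmem (enc_lit L) w \<longleftrightarrow> L \<in> \<beta>" for L
    using assms(2) inj_enc_lit by (simp add: encodes_clause_iff vmem_enumerates inj_image_mem_iff)
  ultimately show ?thesis
    using assms(1) by (auto simp: encodes_clause_iff vex_enumerates)
qed

lemma derived_length_le_2: "derived \<psi> J Js \<Longrightarrow> length Js \<le> 2"
  by (auto simp: derived_def clause_rule_def resolve_rule_def upward_flow_def forall_removal_def
      downward_flow_def)

lemma encodes_trace_step:
  assumes x: "encodes_qcbf \<psi> x" "free \<psi> = {}" and J: "is_judgement \<psi> J" "derived \<psi> J Js"
    and j: "encodes_judgement J j" and js: "list_all2 encodes_judgement Js js"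
    and ts: "list_all2 encodes_trace Ts ts" and len: "length Ts = length Js"
  shows "encodes_trace (trace_step \<psi> J Js Ts) (vtrace_step x j (enc_list js) (enc_list ts))"
proof -
  obtain i \<alpha> a where i: "J = (i, \<alpha>)" "j = Cell (enc_index i) a" "encodes_clause \<alpha> a"
    using j by (cases J) (auto simp: encodes_judgement_iff)
  have "encodes_label (label \<psi> J) (vlabel x (vfst j) (vsnd j))"
    using encodes_label_vlabel[OF x] J(1) i by simp
  then have node: "encodes_trace (Node (label \<psi> J) Us)
      (Cell (vlabel x (vfst j) (vsnd j)) (enc_list us))"
    if "list_all2 encodes_trace Us us" for Us us
    using that by (auto simp: encodes_trace_Node_iff)
  consider (leaf) "Js = []" | (unary) K where "Js = [K]" | (binary) K K' where "Js = [K, K']"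
    using derived_length_le_2[OF J(2)] by (cases Js rule: remdups_adj.cases) auto
  then show ?thesis
  proof cases
    case leaf
    then show ?thesis using node[of "[]" "[]"] js len by (simp add: vtrace_step_def Let_def)
  next
    case (unary K)
    then obtain T t k where t: "Ts = [T]" "ts = [t]" "encodes_trace T t"
      and k: "js = [k]" "encodes_clause (snd K) (vsnd k)"
      using js ts len
      by (cases K) (auto simp: list_all2_Cons1 length_Suc_conv encodes_judgement_iff)
    show ?thesis
      using unary t k(1) i node[of Ts ts] vsubset_clause_iff[OF k(2) i(3)]
      by (simp add: vtrace_step_def Let_def)
  next
    case (binary K K')
    then obtain T T' t t' k k' where t: "Ts = [T, T']" "ts = [t, t']"
        "encodes_trace T t" "encodes_trace T' t'"
      and k: "js = [k, k']" "encodes_clause (snd K) (vsnd k)"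
      using js ts len
      by (cases K) (auto simp: list_all2_Cons1 length_Suc_conv encodes_judgement_iff)
    have "vrev (Cell t (Cell t' Atom)) = Cell t' (Cell t Atom)"
      using vrev_enc_list[of "[t, t']"] by simp
    then show ?thesis
      using binary t k(1) i node[of "[T, T']" "[t, t']"] node[of "[T', T]" "[t', t]"]
        vex_Neg_iff[OF k(2) i(3)]
      by (auto simp: vtrace_step_def Let_def)
  qed
qed

lemma encodes_trace_vtrace:
  assumes "encodes_qcbf \<psi> x" "free \<psi> = {}" "derivation \<psi> P" "encodes_proof_tree P v"
  shows "encodes_trace (trace_of \<psi> P) (vtrace x v)"
  unfolding trace_of_def vtrace_def
proof (rule encodes_fold_tree[where Q = "derivation \<psi>" and E = encodes_judgement])
  show "encodes_tree encodes_judgement P v" using assms(4) by (simp add: encodes_proof_tree_def)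
  show "encodes_trace (trace_step \<psi> J (map root Ps) Ts)
      (vtrace_step x j (enc_list js) (enc_list ts))"
    if "derivation \<psi> (Node J Ps)" "encodes_judgement J j"
      "list_all2 encodes_judgement (map root Ps) js"
      "list_all2 encodes_trace Ts ts" "length Ts = length Ps" for J Ps j js Ts ts
    using that by (intro encodes_trace_step assms(1,2)) auto
qed (use assms(3) in auto)

section \<open>Translating traces in polynomial time\<close>

definition vbranch :: "val \<Rightarrow> val \<Rightarrow> val" where
  "vbranch t i = vfilter (\<lambda>k. vmem t (vprefixes k)) (vprefixes i)"

definition vbutlast :: "val \<Rightarrow> val" where
  "vbutlast v = vrev (vsnd (vrev v))"

definition vcarry :: "val \<Rightarrow> val \<Rightarrow> val \<Rightarrow> val" where
  "vcarry ks \<alpha> P = foldr (\<lambda>k Q. Cell (Cell k \<alpha>) (Cell Q Atom)) (dec_list ks) P"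

definition vconclude :: "val \<Rightarrow> val \<Rightarrow> val \<Rightarrow> val" where
  "vconclude i L Ps = (let \<alpha> = vmap vlit (vsnd L) in
     vcarry (vbutlast (vbranch (vanchor (vfst L)) i)) \<alpha> (Cell (Cell i \<alpha>) Ps))"

definition vlower :: "val \<Rightarrow> val \<Rightarrow> val \<Rightarrow> val" where
  "vlower i L P = vcarry (vrev (vsnd (vbranch (vanchor (vfst L)) i))) (vmap vlit (vsnd L)) P"

definition vleaf_index :: "val \<Rightarrow> val \<Rightarrow> val" where
  "vleaf_index x L =
     vfst (vfilter (\<lambda>i. vlabel_eq (vlabel x i (vsnd (vsub_at x i))) L) (vclause_paths x))"

definition vproof_step :: "val \<Rightarrow> val \<Rightarrow> val \<Rightarrow> val \<Rightarrow> val" where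
  "vproof_step x L Ls Ps = (let L0 = vfst Ls; L1 = vfst (vsnd Ls) in
     if Ls = Atom then vconclude (vleaf_index x L) L Atom
     else if vsnd Ls = Atom then vconclude (vbutlast (vanchor (vfst L0))) L Ps
     else let i = vanchor (vappend (vfst L0) (vfst L1)) in
       vconclude i L (Cell (vlower i L0 (vfst Ps)) (Cell (vlower i L1 (vfst (vsnd Ps))) Atom)))"

definition vproof :: "val \<Rightarrow> val \<Rightarrow> val" where
  "vproof x = vtree (vproof_step x)"

lemma ptime_vbranch [ptime_intros]:
  assumes "ptime f" "ptime g"
  shows "ptime (\<lambda>e. vbranch (f e) (g e))"
  unfolding vbranch_def by (intro ptime_intros assms assms[THEN ptime_comp])

lemma ptime_vbutlast [ptime_intros]: "ptime f \<Longrightarrow> ptime (\<lambda>e. vbutlast (f e))"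
  unfolding vbutlast_def by (intro ptime_intros)

lemma ptime_vmap_vlit [ptime_intros]: "ptime f \<Longrightarrow> ptime (\<lambda>e. vmap vlit (f e))"
  unfolding vlit_def by (intro ptime_intros)

lemma ptime_vcarry [ptime_intros]:
  assumes "ptime f" "ptime g" "ptime h"
  shows "ptime (\<lambda>e. vcarry (f e) (g e) (h e))"
proof -
  have "ptime (uncurry2 (\<lambda>e ks. vcarry ks (vfst e) (vsnd e)))"
    unfolding vcarry_def by (intro ptime_foldr ptime_intros growth_intros)
  from ptime_comp2[OF this ptime_Cell[OF assms(2,3)] assms(1)] show ?thesis by simp
qed

lemma ptime_vconclude [ptime_intros]:
  "ptime f \<Longrightarrow> ptime g \<Longrightarrow> ptime h \<Longrightarrow> ptime (\<lambda>e. vconclude (f e) (g e) (h e))"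
  unfolding vconclude_def Let_def by (intro ptime_intros)

lemma ptime_vlower [ptime_intros]:
  "ptime f \<Longrightarrow> ptime g \<Longrightarrow> ptime h \<Longrightarrow> ptime (\<lambda>e. vlower (f e) (g e) (h e))"
  unfolding vlower_def by (intro ptime_intros)

lemma ptime_vleaf_index [ptime_intros]:
  assumes "ptime f" "ptime g"
  shows "ptime (\<lambda>e. vleaf_index (f e) (g e))"
  unfolding vleaf_index_def by (intro ptime_intros assms assms[THEN ptime_comp])

lemma vsize_vcarry: "vsize (vcarry ks \<alpha> P) \<le> vsize P + vsize ks * (vsize \<alpha> + 4)"
  unfolding vcarry_def by (induction ks) (auto simp: algebra_simps)

lemma additive_growth_vcarry [growth_intros]:
  assumes "additive_growth s" "ptime f" "ptime g"
  shows "additive_growth (\<lambda>z r. vcarry (f z) (g z) (s z r))"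
  by (rule additive_growth_add[OF assms(1) _ vsize_vcarry])
    (intro poly_bounded_intros ptime_vsize assms(2,3))

lemma additive_growth_vconclude [growth_intros]:
  "additive_growth s \<Longrightarrow> ptime f \<Longrightarrow> ptime g \<Longrightarrow> additive_growth (\<lambda>z r. vconclude (f z) (g z) (s z r))"
  unfolding vconclude_def Let_def by (intro growth_intros ptime_intros)

lemma additive_growth_pair:
  assumes "additive_growth s" "additive_growth t"
  shows "additive_growth (\<lambda>z r. Cell (s z (vfst r)) (Cell (t z (vfst (vsnd r))) Atom))"
proof -
  obtain f where f: "poly_bounded f" "\<And>z r. vsize (s z r) \<le> vsize r + f z"
    using assms(1) by (rule additive_growthE) blast
  obtain g where g: "poly_bounded g" "\<And>z r. vsize (t z r) \<le> vsize r + g z"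
    using assms(2) by (rule additive_growthE) blast
  show ?thesis
  proof (rule additive_growthI)
    show "poly_bounded (\<lambda>z. f z + g z + 4)" by (intro poly_bounded_intros f(1) g(1))
    fix z r
    have "vsize (vfst r) + vsize (vfst (vsnd r)) \<le> vsize r + 1"
      using vsize_vfst_le[of "vsnd r"] by (cases r) auto
    then show "vsize (Cell (s z (vfst r)) (Cell (t z (vfst (vsnd r))) Atom))
        \<le> vsize r + (f z + g z + 4)"
      using f(2)[of z "vfst r"] g(2)[of z "vfst (vsnd r)"] by simp
  qed
qed

lemma ptime_vproof: "ptime (uncurry2 vproof)"
  unfolding vproof_def
proof (rule ptime_vtree)
  show "ptime (uncurry4 vproof_step)"
    unfolding vproof_step_def Let_def by (intro ptime_intros)
  have lower: "additive_growth (\<lambda>z. vlower (f z) (g z))" if "ptime f" "ptime g" for f g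
    unfolding vlower_def by (intro growth_intros ptime_intros that)
  show "additive_growth (uncurry3 vproof_step)"
    unfolding vproof_step_def Let_def
    by (intro additive_growth_if additive_growth_vconclude additive_growth_id additive_growth_ptime
        additive_growth_pair lower ptime_intros)
qed

lemma vbranch_eq: "vbranch (enc_index t) (enc_index i) = enc_list (map enc_index (branch t i))"
  unfolding vbranch_def branch_def vprefixes_enc_index[of i]
  by (intro vfilter_enc_index) (simp add: vmem_vprefixes)

lemma vsnd_enc_list: "vsnd (enc_list vs) = enc_list (tl vs)"
  by (cases vs) auto

lemma vbutlast_enc_list: "vbutlast (enc_list vs) = enc_list (butlast vs)"
  by (simp add: vbutlast_def vsnd_enc_list butlast_rev[symmetric])

lemma encodes_proof_tree_Node_iff:
  "encodes_proof_tree (Node J Ps) v \<longleftrightarrow>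
     (\<exists>j ps. v = Cell j (enc_list ps) \<and> encodes_judgement J j \<and> list_all2 encodes_proof_tree Ps ps)"
  unfolding encodes_proof_tree_def by (subst encodes_tree.simps) auto

lemma encodes_carry:
  assumes "encodes_clause \<alpha> a" "encodes_proof_tree P p"
  shows "encodes_proof_tree (carry ks \<alpha> P) (vcarry (enc_list (map enc_index ks)) a p)"
proof (induction ks)
  case Nil
  then show ?case using assms by (simp add: carry_def vcarry_def)
next
  case (Cons k ks)
  then have "encodes_proof_tree (Node (k, \<alpha>) [carry ks \<alpha> P])
      (Cell (Cell (enc_index k) a) (enc_list [vcarry (enc_list (map enc_index ks)) a p]))"
    using assms(1) unfolding encodes_proof_tree_Node_iff by (fastforce simp: encodes_judgement_iff)
  then show ?case by (simp add: carry_def vcarry_def)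
qed

context
  fixes \<psi> L l
  assumes L: "trace_label \<psi> L" and l: "encodes_label L l"
begin

lemma vanchor_label: "vanchor (vfst l) = enc_index (anchor (fst L))"
  using L l by (cases L) (auto simp: encodes_label_iff enumerates_def trace_label_def
      coherent_located_def intro!: vanchor_eq)

lemma encodes_clause_label: "encodes_clause (falsified_clause (snd L)) (vmap vlit (vsnd l))"
  using l by (cases L) (auto simp: encodes_label_iff intro: encodes_clause_vmap_vlit)

lemma encodes_conclude:
  assumes "list_all2 encodes_proof_tree Ps ps"
  shows "encodes_proof_tree (conclude i L Ps) (vconclude (enc_index i) l (enc_list ps))"
proof -
  have "encodes_proof_tree (Node (i, falsified_clause (snd L)) Ps)
      (Cell (Cell (enc_index i) (vmap vlit (vsnd l))) (enc_list ps))"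
    using assms encodes_clause_label unfolding encodes_proof_tree_Node_iff
    by (fastforce simp: encodes_judgement_iff)
  then show ?thesis
    unfolding conclude_def vconclude_def Let_def vanchor_label vbranch_eq
      vbutlast_enc_list climb_def map_butlast[symmetric]
    by (intro encodes_carry encodes_clause_label)
qed

lemma encodes_lower:
  assumes "encodes_proof_tree P p"
  shows "encodes_proof_tree (lower i L P) (vlower (enc_index i) l p)"
proof -
  have "vrev (vsnd (enc_list (map enc_index ks))) = enc_list (map enc_index (rev (tl ks)))" for ks
    by (simp add: vsnd_enc_list rev_map flip: map_tl)
  then show ?thesis
    unfolding lower_def vlower_def vanchor_label vbranch_eq descent_def
    using encodes_carry[OF encodes_clause_label assms] by simp
qed

lemma vleaf_index_eq:
  assumes x: "encodes_qcbf \<psi> x" "qcbf_instance \<psi>" and leaf: "leaf_node \<psi> L"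
  shows "vleaf_index x l = enc_index (leaf_index \<psi> L)"
proof -
  let ?Q = "\<lambda>i. \<exists>\<alpha>. sub_at \<psi> i = Some (Clause \<alpha>) \<and> label \<psi> (i, \<alpha>) = L"
  let ?P = "\<lambda>i. vlabel_eq (vlabel x i (vsnd (vsub_at x i))) l"
  have wf: "wf_qcbf \<psi>" "free \<psi> = {}" using x(2) by (auto simp: qcbf_instance_def)
  have "?P (enc_index i) \<longleftrightarrow> ?Q i" if i: "i \<in> set (clause_paths \<psi>)" for i
  proof -
    obtain \<alpha> where \<alpha>: "sub_at \<psi> i = Some (Clause \<alpha>)" using i by (auto simp: set_clause_paths)
    then obtain w where w: "vsub_at x (enc_index i) = Cell Atom w" "encodes_clause \<alpha> w"
      using encodes_qcbf_vsub_at[OF x(1) \<alpha>] by auto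
    have "encodes_label (label \<psi> (i, \<alpha>)) (vlabel x (enc_index i) w)"
      using x(1) wf(2) clause_judgement[OF wf(1) \<alpha>] w(2) by (rule encodes_label_vlabel)
    from vlabel_eq_iff[OF this l] show ?thesis using \<alpha> w(1) by simp
  qed
  then have "vfilter ?P (vclause_paths x) = enc_list (map enc_index (filter ?Q (clause_paths \<psi>)))"
    unfolding vclause_paths_eq[OF x(1)] by (rule vfilter_enc_index)
  moreover have "filter ?Q (clause_paths \<psi>) \<noteq> []"
    using leaf_node_is_label[OF L leaf] by (auto simp: filter_empty_conv set_clause_paths)
  moreover have "vfst (enc_list (map enc_index is)) = enc_index (hd is)" if "is \<noteq> []" for "is"
    using that by (cases "is") simp_all
  ultimately show ?thesis unfolding vleaf_index_def leaf_index_def by simp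
qed

end

lemma vanchor_binary_node:
  assumes "trace_label \<psi> L" "binary_node \<psi> L L0 L1"
    and "encodes_label L0 l0" "encodes_label L1 l1"
  shows "vanchor (vappend (vfst l0) (vfst l1)) = enc_index (anchor (fst L0 \<union> fst L1))"
proof (rule vanchor_eq)
  show "coherent_located \<psi> (fst L0 \<union> fst L1)"
    using assms(1,2) by (cases L) (auto elim: binary_nodeE)
  show "set (dec_list (vappend (vfst l0) (vfst l1))) = enc_located ` (fst L0 \<union> fst L1)"
    using assms(3,4) by (cases L0; cases L1) (auto simp: encodes_label_iff enumerates_def)
qed

lemma encodes_proof_step:
  assumes x: "encodes_qcbf \<psi> x" "qcbf_instance \<psi>" and L: "trace_label \<psi> L" "trace_node \<psi> L Ls"
    and Ls: "\<And>L'. L' \<in> set Ls \<Longrightarrow> trace_label \<psi> L'"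
    and l: "encodes_label L l" and ls: "list_all2 encodes_label Ls ls"
    and ps: "list_all2 encodes_proof_tree Ps ps" and len: "length Ps = length Ls"
  shows "encodes_proof_tree (proof_step \<psi> L Ls Ps) (vproof_step x l (enc_list ls) (enc_list ps))"
proof -
  consider (leaf) "Ls = []" | (unary) L' where "Ls = [L']" | (binary) L0 L1 where "Ls = [L0, L1]"
    using L(2) by (cases "(\<psi>, L, Ls)" rule: trace_node.cases) auto
  then show ?thesis
  proof cases
    case leaf
    then show ?thesis
      using encodes_conclude[OF L(1) l, of "[]" "[]"] vleaf_index_eq[OF L(1) l x] L(2) ls
      by (simp add: vproof_step_def Let_def)
  next
    case (unary L')
    then obtain l' where l': "ls = [l']" "encodes_label L' l'"
      using ls by (auto simp: list_all2_Cons1)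
    obtain P p where p: "Ps = [P]" "ps = [p]"
      using ps len unary by (auto simp: list_all2_Cons1 length_Suc_conv)
    have "trace_label \<psi> L'" using Ls unary by simp
    then have "vbutlast (vanchor (vfst l')) = enc_index (butlast (anchor (fst L')))"
      using l'(2) by (simp add: vanchor_label enc_index_def vbutlast_enc_list map_butlast)
    then show ?thesis
      using encodes_conclude[OF L(1) l ps] unary l'(1) p by (simp add: vproof_step_def Let_def)
  next
    case (binary L0 L1)
    then obtain l0 l1 where l01: "ls = [l0, l1]" "encodes_label L0 l0" "encodes_label L1 l1"
      using ls by (auto simp: list_all2_Cons1)
    obtain P Q p q where p: "Ps = [P, Q]" "ps = [p, q]"
      "encodes_proof_tree P p" "encodes_proof_tree Q q"
      using ps len binary by (auto simp: list_all2_Cons1 length_Suc_conv)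
    let ?i = "anchor (fst L0 \<union> fst L1)"
    have "vanchor (vappend (vfst l0) (vfst l1)) = enc_index ?i"
      using L binary l01(2,3) by (intro vanchor_binary_node) simp_all
    moreover have "encodes_proof_tree (lower ?i L0 P) (vlower (enc_index ?i) l0 p)"
      "encodes_proof_tree (lower ?i L1 Q) (vlower (enc_index ?i) l1 q)"
      using encodes_lower[OF Ls l01(2) p(3)] encodes_lower[OF Ls l01(3) p(4)] binary by simp_all
    ultimately show ?thesis
      using encodes_conclude[OF L(1) l, of "[lower ?i L0 P, lower ?i L1 Q]"
          "[vlower (enc_index ?i) l0 p, vlower (enc_index ?i) l1 q]" ?i] binary l01(1) p(1,2)
      by (simp add: vproof_step_def Let_def)
  qed
qed

lemma is_trace_root: "is_trace \<psi> T \<Longrightarrow> trace_label \<psi> (root T)"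
  by (cases T) simp

lemma encodes_proof_tree_vproof:
  assumes "encodes_qcbf \<psi> x" "qcbf_instance \<psi>" "is_trace \<psi> T" "encodes_trace T v"
  shows "encodes_proof_tree (proof_of \<psi> T) (vproof x v)"
  unfolding proof_of_def vproof_def
proof (rule encodes_fold_tree[where Q = "is_trace \<psi>" and E = encodes_label])
  show "encodes_tree encodes_label T v" using assms(4) by (simp add: encodes_trace_def)
  show "encodes_proof_tree (proof_step \<psi> L (map root Ts) Ps)
      (vproof_step x l (enc_list ls) (enc_list ps))"
    if "is_trace \<psi> (Node L Ts)" "encodes_label L l" "list_all2 encodes_label (map root Ts) ls"
      "list_all2 encodes_proof_tree Ps ps" "length Ps = length Ts" for L Ts l ls Ps ps
    using that is_trace_root by (intro encodes_proof_step assms(1,2)) auto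
qed (use assms(3) in auto)

section \<open>Tree-like proofs and traces\<close>

lemma trace_of_tree_like_empty_clause_proof:
  assumes "qcbf_instance \<psi>" "tree_like_empty_clause_proof \<psi> P"
  shows "is_trace \<psi> (trace_of \<psi> P) \<and> root (trace_of \<psi> P) = ({}, Map.empty)
    \<and> num_nodes (trace_of \<psi> P) = num_nonflow \<psi> P"
  using assms traces_trace_of[of \<psi> P]
  by (cases "root P") (auto simp: tree_like_empty_clause_proof_iff qcbf_instance_def traces_def
      binders_def falsifier_def)

lemma tree_like_empty_clause_proof_proof_of:
  assumes "qcbf_instance \<psi>" "is_trace \<psi> T" "root T = ({}, Map.empty)"
  shows "tree_like_empty_clause_proof \<psi> (proof_of \<psi> T) \<and> num_nonflow \<psi> (proof_of \<psi> T) = num_nodes T"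
proof -
  have "falsified_clause Map.empty = {}"
    using cvars_falsified_clause[of Map.empty] by (auto simp: cvars_def)
  then show ?thesis
    using derives_proof_of[OF assms(1,2)] assms(3)
    by (auto simp: tree_like_empty_clause_proof_iff derives_def anchored_def)
qed

theorem theorem4p5:
  "(\<forall>\<psi> n. qcbf_instance \<psi> \<longrightarrow> n \<ge> 1 \<longrightarrow>
      ((\<exists>P. tree_like_empty_clause_proof \<psi> P \<and> num_nonflow \<psi> P = n) \<longleftrightarrow>
       (\<exists>T. is_trace \<psi> T \<and> root T = ({}, Map.empty) \<and> num_nodes T = n)))
   \<and> poly_time_translation encodes_proof_tree encodes_trace
       (\<lambda>\<psi> P. tree_like_empty_clause_proof \<psi> P)
       (\<lambda>\<psi> P T. is_trace \<psi> T \<and> root T = ({}, Map.empty) \<and> num_nodes T = num_nonflow \<psi> P)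
   \<and> poly_time_translation encodes_trace encodes_proof_tree
       (\<lambda>\<psi> T. is_trace \<psi> T \<and> root T = ({}, Map.empty))
       (\<lambda>\<psi> T P. tree_like_empty_clause_proof \<psi> P \<and> num_nonflow \<psi> P = num_nodes T)"
proof (intro conjI allI impI)
  note to_trace = trace_of_tree_like_empty_clause_proof
    and to_proof = tree_like_empty_clause_proof_proof_of
  show "(\<exists>P. tree_like_empty_clause_proof \<psi> P \<and> num_nonflow \<psi> P = n) \<longleftrightarrow>
      (\<exists>T. is_trace \<psi> T \<and> root T = ({}, Map.empty) \<and> num_nodes T = n)"
    if "qcbf_instance \<psi>" for \<psi> n
    using that to_trace to_proof by metis
  show "poly_time_translation encodes_proof_tree encodes_trace
      (\<lambda>\<psi> P. tree_like_empty_clause_proof \<psi> P)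
      (\<lambda>\<psi> P T. is_trace \<psi> T \<and> root T = ({}, Map.empty) \<and> num_nodes T = num_nonflow \<psi> P)"
    using ptime_vtrace
    by (rule poly_time_translationI[where g = trace_of])
      (simp add: to_trace encodes_trace_vtrace qcbf_instance_def tree_like_empty_clause_proof_iff)
  show "poly_time_translation encodes_trace encodes_proof_tree
      (\<lambda>\<psi> T. is_trace \<psi> T \<and> root T = ({}, Map.empty))
      (\<lambda>\<psi> T P. tree_like_empty_clause_proof \<psi> P \<and> num_nonflow \<psi> P = num_nodes T)"
    using ptime_vproof
    by (rule poly_time_translationI[where g = proof_of])
      (simp add: to_proof encodes_proof_tree_vproof)
qed

end
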